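(* There is an $\mathcal A$-linear monoidal functor $$\Xi:\mathcal{D}_{\mathfrak{sp}_4}\longrightarrow U_q^{\mathcal A}(\mathfrak{sp}_4)\text{-mod}$$ defined on objects by $\Xi(1)=V^{\mathcal A}(\varpi_1)$, $\Xi(2)=V^{\mathcal A}(\varpi_2)$ and extended monoidally, and defined on generating morphisms by $$\mathrm{cap}_1\mapsto\mathbf{cap}_1,\quad \mathrm{cap}_2\mapsto\mathbf{cap}_2,\quad \mathrm{cup}_1\mapsto\mathbf{cup}_1,\quad \mathrm{cup}_2\mapsto\mathbf{cup}_2,\quad p\mapsto\mathbf p,\quad i\mapsto\mathbf i,$$ and then extended $\mathcal A$-linearly so that horizontal concatenation of diagrams corresponds to tensor product and vertical composition to composition of morphisms.
   Context: **The category $\mathcal{D}_{\mathfrak{sp}_4}$.** $[n]_q=\frac{q^n-q^{-n}}{q-q^{-1}}$, $[n]_q!=[n]_q\cdots[1]_q$, $\mathcal{A}=\mathbb{Z}[q,q^{-1},[2]_q^{-1}]$. $\mathcal{D}_{\mathfrak{sp}_4}$ is the strict $\mathcal{A}$-linear monoidal category whose objects are words in $1,2$ (monoidal product: concatenation; unit: the empty word $\emptyset$), with generating morphisms $\mathrm{cap}_1:11\to\emptyset$, $\mathrm{cap}_2:22\to\emptyset$, $\mathrm{cup}_1:\emptyset\to11$, $\mathrm{cup}_2:\emptyset\to22$, $p:11\to2$, $i:2\to11$ (drawn as coloured caps, cups and trivalent vertices, read from bottom to top) and relations: - $(\mathrm{id}_a\otimes\mathrm{cap}_a)\circ(\mathrm{cup}_a\otimes\mathrm{id}_a)=\mathrm{id}_a=(\mathrm{cap}_a\otimes\mathrm{id}_a)\circ(\mathrm{id}_a\otimes\mathrm{cup}_a)$,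 $a=1,2$; - $p=(\mathrm{id}_2\otimes\mathrm{cap}_1)\circ(\mathrm{id}_2\otimes\mathrm{id}_1\otimes\mathrm{cap}_1\otimes\mathrm{id}_1)\circ(\mathrm{id}_2\otimes i\otimes\mathrm{id}_1\otimes\mathrm{id}_1)\circ(\mathrm{cup}_2\otimes\mathrm{id}_1\otimes\mathrm{id}_1)$ and $p=(\mathrm{cap}_1\otimes\mathrm{id}_2)\circ(\mathrm{id}_1\otimes\mathrm{cap}_1\otimes\mathrm{id}_1\otimes\mathrm{id}_2)\circ(\mathrm{id}_1\otimes\mathrm{id}_1\otimes i\otimes\mathrm{id}_2)\circ(\mathrm{id}_1\otimes\mathrm{id}_1\otimes\mathrm{cup}_2)$; - $\mathrm{cap}_1\circ\mathrm{cup}_1=-\frac{[6]_q[2]_q}{[3]_q}$, $\mathrm{cap}_2\circ\mathrm{cup}_2=\frac{[6]_q[5]_q}{[3]_q[2]_q}$ (these equal $-([5]_q-[1]_q)$ and $[7]_q-[5]_q+[3]_q$); - $\mathrm{cap}_1\circ i=0$; $p\circ i=-[2]_q\mathrm{id}_2$; $(p\otimes p)\circ(\mathrm{id}_1\otimes\mathrm{cup}_1\otimes\mathrm{id}_1)\circ i=0$; - $H=\frac1{[2]_q}\mathrm{id}_{11}+i\circ p-\frac1{[2]_q}\mathrm{cup}_1\circ\mathrm{cap}_1$, where $H=(\mathrm{id}_1\otimes\mathrm{id}_1\otimes\mathrm{cap}_1)\circ(\mathrm{id}_1\otimes(i\circ p)\otimes\mathrm{id}_1)\circ(\mathrm{cup}_1\otimes\mathrm{id}_1\otimes\mathrm{id}_1)$.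 **Quantum group.** $\alpha_s=\epsilon_1-\epsilon_2$, $\alpha_t=2\epsilon_2$ with $(\epsilon_i,\epsilon_j)=\delta_{ij}$. $U_q(\mathfrak{sp}_4)$ is the $\mathbb{Q}(q)$-algebra on $E_s,E_t,F_s,F_t,K_s^{\pm1},K_t^{\pm1}$ with relations: the $K$'s commute and are invertible; $K_\alpha E_\beta=q^{(\alpha,\beta)}E_\beta K_\alpha$, $K_\alpha F_\beta=q^{-(\alpha,\beta)}F_\beta K_\alpha$; $E_sF_t=F_tE_s$, $E_tF_s=F_sE_t$, $E_sF_s-F_sE_s=\frac{K_s-K_s^{-1}}{q-q^{-1}}$, $E_tF_t-F_tE_t=\frac{K_t-K_t^{-1}}{q^2-q^{-2}}$; $E_t^2E_s-\frac{[4]_q}{[2]_q}E_tE_sE_t+E_sE_t^2=0$, $E_s^3E_t-[3]_qE_s^2E_tE_s+[3]_qE_sE_tE_s^2-E_tE_s^3=0$, and the same Serre relations for the $F$'s. Its coproduct is $\Delta(E_\alpha)=E_\alpha\otimes1+K_\alpha\otimes E_\alpha$, $\Delta(F_\alpha)=F_\alpha\otimes K_\alpha^{-1}+1\otimes F_\alpha$, $\Delta(K_\alpha)=K_\alpha\otimes K_\alpha$; antipode $S(E_\alpha)=-K_\alpha^{-1}E_\alpha$, $S(F_\alpha)=-F_\alpha K_\alpha$, $S(K_\alpha)=K_\alpha^{-1}$; counit $\epsilon(E_\alpha)=\epsilon(F_\alpha)=0$, $\epsilon(K_\alpha)=1$. $U_q^{\mathcal A}(\mathfrak{sp}_4)$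 is the $\mathcal A$-subalgebra (a Hopf subalgebra) generated by $K_s^{\pm1},K_t^{\pm1}$ and $E_s^{(n)}=E_s^n/[n]_q!$, $F_s^{(n)}=F_s^n/[n]_q!$, $E_t^{(n)}=E_t^n/[n]_{q^2}!$, $F_t^{(n)}=F_t^n/[n]_{q^2}!$, $n\ge1$. $U_q^{\mathcal A}(\mathfrak{sp}_4)$-mod is monoidal via $\Delta$, with unit the trivial module $\mathcal A$. **Modules.** $V^{\mathcal A}(\varpi_1)$ is free over $\mathcal A$ on $v_{(1,0)},v_{(-1,1)},v_{(1,-1)},v_{(-1,0)}$ with $F_sv_{(1,0)}=v_{(-1,1)}$, $F_tv_{(-1,1)}=v_{(1,-1)}$, $F_sv_{(1,-1)}=v_{(-1,0)}$, $E_sv_{(-1,0)}=v_{(1,-1)}$, $E_tv_{(1,-1)}=v_{(-1,1)}$, $E_sv_{(-1,1)}=v_{(1,0)}$. $V^{\mathcal A}(\varpi_2)$ is free on $v_{(0,1)},v_{(2,-1)},v_{(0,0)},v_{(-2,1)},v_{(0,-1)}$ with $F_tv_{(0,1)}=v_{(2,-1)}$, $F_sv_{(2,-1)}=v_{(0,0)}$, $F_sv_{(0,0)}=[2]_qv_{(-2,1)}$, $F_tv_{(-2,1)}=v_{(0,-1)}$, $E_tv_{(0,-1)}=v_{(-2,1)}$, $E_sv_{(-2,1)}=v_{(0,0)}$, $E_sv_{(0,0)}=[2]_qv_{(2,-1)}$, $E_tv_{(2,-1)}=v_{(0,1)}$. All other actions of $E_\alpha,F_\alpha$ on basis vectors are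 $0$; $K_sv_{(i,j)}=q^iv_{(i,j)}$, $K_tv_{(i,j)}=q^{2j}v_{(i,j)}$; divided powers act accordingly (e.g. $F_s^{(2)}v_{(2,-1)}=v_{(-2,1)}$). **Module maps** ($\mathcal A$-linear, $V_1=V^{\mathcal A}(\varpi_1)$, $V_2=V^{\mathcal A}(\varpi_2)$): - $\mathbf{cup}_1:\mathcal A\to V_1\otimes V_1$, $1\mapsto -q^{-4}v_{(1,0)}\otimes v_{(-1,0)}+q^{-3}v_{(-1,1)}\otimes v_{(1,-1)}-q^{-1}v_{(1,-1)}\otimes v_{(-1,1)}+v_{(-1,0)}\otimes v_{(1,0)}$; - $\mathbf{cup}_2:\mathcal A\to V_2\otimes V_2$, $1\mapsto q^{-6}v_{(0,1)}\otimes v_{(0,-1)}-q^{-4}v_{(2,-1)}\otimes v_{(-2,1)}+\frac{q^{-2}}{[2]_q}v_{(0,0)}\otimes v_{(0,0)}-q^{-2}v_{(-2,1)}\otimes v_{(2,-1)}+v_{(0,-1)}\otimes v_{(0,1)}$; - $\mathbf{cap}_1:V_1\otimes V_1\to\mathcal A$: $v_{(1,0)}\otimes v_{(-1,0)}\mapsto1$, $v_{(-1,1)}\otimes v_{(1,-1)}\mapsto-q$, $v_{(1,-1)}\otimes v_{(-1,1)}\mapsto q^3$, $v_{(-1,0)}\otimes v_{(1,0)}\mapsto-q^4$, all other $v_\mu\otimes v_\nu\mapsto0$; - $\mathbf{cap}_2:V_2\otimes V_2\to\mathcal A$: $v_{(0,1)}\otimes v_{(0,-1)}\mapsto1$, $v_{(2,-1)}\otimes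 v_{(-2,1)}\mapsto-q^2$, $v_{(0,0)}\otimes v_{(0,0)}\mapsto q^2[2]_q$, $v_{(-2,1)}\otimes v_{(2,-1)}\mapsto-q^4$, $v_{(0,-1)}\otimes v_{(0,1)}\mapsto q^6$, all others $\mapsto0$; - $\mathbf i:V_2\to V_1\otimes V_1$: $v_{(0,1)}\mapsto q^{-1}v_{(1,0)}\otimes v_{(-1,1)}-v_{(-1,1)}\otimes v_{(1,0)}$; $v_{(2,-1)}\mapsto q^{-1}v_{(1,0)}\otimes v_{(1,-1)}-v_{(1,-1)}\otimes v_{(1,0)}$; $v_{(0,0)}\mapsto q^{-1}v_{(1,0)}\otimes v_{(-1,0)}+q^{-2}v_{(-1,1)}\otimes v_{(1,-1)}-v_{(1,-1)}\otimes v_{(-1,1)}-q^{-1}v_{(-1,0)}\otimes v_{(1,0)}$; $v_{(-2,1)}\mapsto q^{-1}v_{(-1,1)}\otimes v_{(-1,0)}-v_{(-1,0)}\otimes v_{(-1,1)}$; $v_{(0,-1)}\mapsto q^{-1}v_{(1,-1)}\otimes v_{(-1,0)}-v_{(-1,0)}\otimes v_{(1,-1)}$; - $\mathbf p:V_1\otimes V_1\to V_2$: $v_\mu\otimes v_\mu\mapsto0$; $v_{(1,0)}\otimes v_{(-1,1)}\mapsto-v_{(0,1)}$, $v_{(-1,1)}\otimes v_{(1,0)}\mapsto qv_{(0,1)}$; $v_{(1,0)}\otimes v_{(1,-1)}\mapsto-v_{(2,-1)}$, $v_{(1,-1)}\otimes v_{(1,0)}\mapsto qv_{(2,-1)}$;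 $v_{(1,0)}\otimes v_{(-1,0)}\mapsto\frac{-q}{[2]_q}v_{(0,0)}$, $v_{(-1,1)}\otimes v_{(1,-1)}\mapsto\frac{-1}{[2]_q}v_{(0,0)}$, $v_{(1,-1)}\otimes v_{(-1,1)}\mapsto\frac{q^2}{[2]_q}v_{(0,0)}$, $v_{(-1,0)}\otimes v_{(1,0)}\mapsto\frac{q}{[2]_q}v_{(0,0)}$; $v_{(-1,1)}\otimes v_{(-1,0)}\mapsto-v_{(-2,1)}$, $v_{(-1,0)}\otimes v_{(-1,1)}\mapsto qv_{(-2,1)}$; $v_{(1,-1)}\otimes v_{(-1,0)}\mapsto-v_{(0,-1)}$, $v_{(-1,0)}\otimes v_{(1,-1)}\mapsto qv_{(0,-1)}$. *)

theory Defs
  imports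
    "HOL-Library.Poly_Mapping"
    "HOL-Library.Product_Plus"
    "HOL-Computational_Algebra.Polynomial"
    "HOL-Computational_Algebra.Fraction_Field"
    "HOL-Algebra.Module"
    "HOL-Algebra.QuotRing"
    "HOL-Algebra.Generated_Rings"
    "HOL-Algebra.Free_Abelian_Groups"
    "HOL-Algebra.Algebraic_Closure_Type"
begin

section \<open>Scalars\<close>

type_synonym Kq = "rat poly fract"

definition qv :: Kq where
  "qv = Fract [:0, 1:] 1"

definition qint :: "Kq \<Rightarrow> nat \<Rightarrow> Kq" where
  "qint b n = (b ^ n - inverse b ^ n) / (b - inverse b)"

definition qfact :: "Kq \<Rightarrow> nat \<Rightarrow> Kq" where
  "qfact b n = (\<Prod>k = 1..n. qint b k)"

abbreviation qn :: "nat \<Rightarrow> Kq" where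
  "qn n \<equiv> qint qv n"

text \<open>The ring \<open>\<A> = \<int>[q, q\<inverse>, [2]\<inverse>]\<close>, as a subring of \<open>\<rat>(q)\<close>.\<close>

definition Aring :: "Kq ring" where
  "Aring = ring_of_type_algebra
     \<lparr>carrier := generate_ring ring_of_type_algebra {qv, inverse qv, inverse (qn 2)}\<rparr>"

abbreviation Aset :: "Kq set" where
  "Aset \<equiv> carrier Aring"


section \<open>Strict linear monoidal categories\<close>

text \<open>Each morphism space is an \<open>\<A>\<close>-module in the sense of HOL-Algebra; the ring
  multiplication and unit fields of a module record play no role.\<close>

record ('o, 'f) moncat =
  Obj :: "'o set"
  Hom :: "'o \<Rightarrow> 'o \<Rightarrow> (Kq, 'f) module"
  Idm :: "'o \<Rightarrow> 'f"
  Cmp :: "'f \<Rightarrow> 'f \<Rightarrow> 'f"  (infixl \<open>\<cdot>\<index>\<close> 75)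
  OTen :: "'o \<Rightarrow> 'o \<Rightarrow> 'o"
  MTen :: "'f \<Rightarrow> 'f \<Rightarrow> 'f"
  Unt :: "'o"

abbreviation arr :: "('o, 'f, 'x) moncat_scheme \<Rightarrow> 'o \<Rightarrow> 'o \<Rightarrow> 'f set" where
  "arr C u v \<equiv> carrier (Hom C u v)"

locale strict_linear_monoidal_category =
  fixes C :: "('o, 'f) moncat" (structure)
  assumes hom_module: "\<lbrakk>u \<in> Obj C; v \<in> Obj C\<rbrakk> \<Longrightarrow> module Aring (Hom C u v)"
    and id_closed: "u \<in> Obj C \<Longrightarrow> Idm C u \<in> arr C u u"
    and comp_closed: "\<lbrakk>u \<in> Obj C; v \<in> Obj C; w \<in> Obj C; g \<in> arr C v w; f \<in> arr C u v\<rbrakk>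
      \<Longrightarrow> g \<cdot> f \<in> arr C u w"
    and comp_id_left: "\<lbrakk>u \<in> Obj C; v \<in> Obj C; f \<in> arr C u v\<rbrakk> \<Longrightarrow> Idm C v \<cdot> f = f"
    and comp_id_right: "\<lbrakk>u \<in> Obj C; v \<in> Obj C; f \<in> arr C u v\<rbrakk> \<Longrightarrow> f \<cdot> Idm C u = f"
    and comp_assoc: "\<lbrakk>u \<in> Obj C; v \<in> Obj C; w \<in> Obj C; x \<in> Obj C;
        h \<in> arr C w x; g \<in> arr C v w; f \<in> arr C u v\<rbrakk>
      \<Longrightarrow> (h \<cdot> g) \<cdot> f = h \<cdot> (g \<cdot> f)"
    and comp_add_left: "\<lbrakk>u \<in> Obj C; v \<in> Obj C; w \<in> Obj C;
        g \<in> arr C v w; g' \<in> arr C v w; f \<in> arr C u v\<rbrakk>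
      \<Longrightarrow> (g \<oplus>\<^bsub>Hom C v w\<^esub> g') \<cdot> f = (g \<cdot> f) \<oplus>\<^bsub>Hom C u w\<^esub> (g' \<cdot> f)"
    and comp_add_right: "\<lbrakk>u \<in> Obj C; v \<in> Obj C; w \<in> Obj C;
        g \<in> arr C v w; f \<in> arr C u v; f' \<in> arr C u v\<rbrakk>
      \<Longrightarrow> g \<cdot> (f \<oplus>\<^bsub>Hom C u v\<^esub> f') = (g \<cdot> f) \<oplus>\<^bsub>Hom C u w\<^esub> (g \<cdot> f')"
    and comp_smult_left: "\<lbrakk>u \<in> Obj C; v \<in> Obj C; w \<in> Obj C; a \<in> Aset;
        g \<in> arr C v w; f \<in> arr C u v\<rbrakk>
      \<Longrightarrow> (a \<odot>\<^bsub>Hom C v w\<^esub> g) \<cdot> f = a \<odot>\<^bsub>Hom C u w\<^esub> (g \<cdot> f)"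
    and comp_smult_right: "\<lbrakk>u \<in> Obj C; v \<in> Obj C; w \<in> Obj C; a \<in> Aset;
        g \<in> arr C v w; f \<in> arr C u v\<rbrakk>
      \<Longrightarrow> g \<cdot> (a \<odot>\<^bsub>Hom C u v\<^esub> f) = a \<odot>\<^bsub>Hom C u w\<^esub> (g \<cdot> f)"
    and unit_obj: "Unt C \<in> Obj C"
    and oten_closed: "\<lbrakk>u \<in> Obj C; v \<in> Obj C\<rbrakk> \<Longrightarrow> OTen C u v \<in> Obj C"
    and oten_assoc: "\<lbrakk>u \<in> Obj C; v \<in> Obj C; w \<in> Obj C\<rbrakk>
      \<Longrightarrow> OTen C (OTen C u v) w = OTen C u (OTen C v w)"
    and oten_unit_left: "u \<in> Obj C \<Longrightarrow> OTen C (Unt C) u = u"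
    and oten_unit_right: "u \<in> Obj C \<Longrightarrow> OTen C u (Unt C) = u"
    and mten_closed: "\<lbrakk>u \<in> Obj C; u' \<in> Obj C; v \<in> Obj C; v' \<in> Obj C;
        f \<in> arr C u u'; g \<in> arr C v v'\<rbrakk>
      \<Longrightarrow> MTen C f g \<in> arr C (OTen C u v) (OTen C u' v')"
    and mten_add_left: "\<lbrakk>u \<in> Obj C; u' \<in> Obj C; v \<in> Obj C; v' \<in> Obj C;
        f \<in> arr C u u'; f' \<in> arr C u u'; g \<in> arr C v v'\<rbrakk>
      \<Longrightarrow> MTen C (f \<oplus>\<^bsub>Hom C u u'\<^esub> f') g
        = MTen C f g \<oplus>\<^bsub>Hom C (OTen C u v) (OTen C u' v')\<^esub> MTen C f' g"
    and mten_add_right: "\<lbrakk>u \<in> Obj C; u' \<in> Obj C; v \<in> Obj C; v' \<in> Obj C;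
        f \<in> arr C u u'; g \<in> arr C v v'; g' \<in> arr C v v'\<rbrakk>
      \<Longrightarrow> MTen C f (g \<oplus>\<^bsub>Hom C v v'\<^esub> g')
        = MTen C f g \<oplus>\<^bsub>Hom C (OTen C u v) (OTen C u' v')\<^esub> MTen C f g'"
    and mten_smult_left: "\<lbrakk>u \<in> Obj C; u' \<in> Obj C; v \<in> Obj C; v' \<in> Obj C; a \<in> Aset;
        f \<in> arr C u u'; g \<in> arr C v v'\<rbrakk>
      \<Longrightarrow> MTen C (a \<odot>\<^bsub>Hom C u u'\<^esub> f) g
        = a \<odot>\<^bsub>Hom C (OTen C u v) (OTen C u' v')\<^esub> MTen C f g"
    and mten_smult_right: "\<lbrakk>u \<in> Obj C; u' \<in> Obj C; v \<in> Obj C; v' \<in> Obj C; a \<in> Aset;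
        f \<in> arr C u u'; g \<in> arr C v v'\<rbrakk>
      \<Longrightarrow> MTen C f (a \<odot>\<^bsub>Hom C v v'\<^esub> g)
        = a \<odot>\<^bsub>Hom C (OTen C u v) (OTen C u' v')\<^esub> MTen C f g"
    and mten_id: "\<lbrakk>u \<in> Obj C; v \<in> Obj C\<rbrakk>
      \<Longrightarrow> MTen C (Idm C u) (Idm C v) = Idm C (OTen C u v)"
    and interchange: "\<lbrakk>u \<in> Obj C; v \<in> Obj C; w \<in> Obj C; u' \<in> Obj C; v' \<in> Obj C; w' \<in> Obj C;
        g \<in> arr C v w; f \<in> arr C u v; g' \<in> arr C v' w'; f' \<in> arr C u' v'\<rbrakk>
      \<Longrightarrow> MTen C (g \<cdot> f) (g' \<cdot> f') = MTen C g g' \<cdot> MTen C f f'"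
    and mten_assoc: "\<lbrakk>u \<in> Obj C; u' \<in> Obj C; v \<in> Obj C; v' \<in> Obj C; w \<in> Obj C; w' \<in> Obj C;
        f \<in> arr C u u'; g \<in> arr C v v'; h \<in> arr C w w'\<rbrakk>
      \<Longrightarrow> MTen C (MTen C f g) h = MTen C f (MTen C g h)"
    and mten_unit_left: "\<lbrakk>u \<in> Obj C; v \<in> Obj C; f \<in> arr C u v\<rbrakk>
      \<Longrightarrow> MTen C (Idm C (Unt C)) f = f"
    and mten_unit_right: "\<lbrakk>u \<in> Obj C; v \<in> Obj C; f \<in> arr C u v\<rbrakk>
      \<Longrightarrow> MTen C f (Idm C (Unt C)) = f"


section \<open>The diagrammatic category\<close>

datatype colour = C1 | C2

type_synonym cword = "colour list"

datatype dgen = Cap1 | Cap2 | Cup1 | Cup2 | Pgen | Igen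

primrec dgen_src :: "dgen \<Rightarrow> cword" where
  "dgen_src Cap1 = [C1, C1]"
| "dgen_src Cap2 = [C2, C2]"
| "dgen_src Cup1 = []"
| "dgen_src Cup2 = []"
| "dgen_src Pgen = [C1, C1]"
| "dgen_src Igen = [C2]"

primrec dgen_tgt :: "dgen \<Rightarrow> cword" where
  "dgen_tgt Cap1 = []"
| "dgen_tgt Cap2 = []"
| "dgen_tgt Cup1 = [C1, C1]"
| "dgen_tgt Cup2 = [C2, C2]"
| "dgen_tgt Pgen = [C2]"
| "dgen_tgt Igen = [C1, C1]"

text \<open>Formal \<open>\<A>\<close>-linear expressions in the generators; \<open>g \<circ>\<^sub>D f\<close> is ``\<open>g\<close> after \<open>f\<close>''.\<close>

datatype dterm =
    DId cword
  | DGen dgen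
  | DComp dterm dterm  (infixl \<open>\<circ>\<^sub>D\<close> 70)
  | DTens dterm dterm  (infixr \<open>\<otimes>\<^sub>D\<close> 75)
  | DZero cword cword
  | DAdd dterm dterm  (infixl \<open>+\<^sub>D\<close> 65)
  | DScale Kq dterm  (infixr \<open>*\<^sub>D\<close> 68)

inductive dtyped :: "dterm \<Rightarrow> cword \<Rightarrow> cword \<Rightarrow> bool" where
  "dtyped (DId u) u u"
| "dtyped (DGen x) (dgen_src x) (dgen_tgt x)"
| "\<lbrakk>dtyped g v w; dtyped f u v\<rbrakk> \<Longrightarrow> dtyped (g \<circ>\<^sub>D f) u w"
| "\<lbrakk>dtyped f u u'; dtyped g v v'\<rbrakk> \<Longrightarrow> dtyped (f \<otimes>\<^sub>D g) (u @ v) (u' @ v')"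
| "dtyped (DZero u v) u v"
| "\<lbrakk>dtyped f u v; dtyped g u v\<rbrakk> \<Longrightarrow> dtyped (f +\<^sub>D g) u v"
| "\<lbrakk>a \<in> Aset; dtyped f u v\<rbrakk> \<Longrightarrow> dtyped (a *\<^sub>D f) u v"

abbreviation "id1 \<equiv> DId [C1]"
abbreviation "id2 \<equiv> DId [C2]"
abbreviation "cap1 \<equiv> DGen Cap1"
abbreviation "cap2 \<equiv> DGen Cap2"
abbreviation "cup1 \<equiv> DGen Cup1"
abbreviation "cup2 \<equiv> DGen Cup2"
abbreviation "pgen \<equiv> DGen Pgen"
abbreviation "igen \<equiv> DGen Igen"

definition Hdiag :: dterm where
  "Hdiag = (id1 \<otimes>\<^sub>D id1 \<otimes>\<^sub>D cap1) \<circ>\<^sub>D (id1 \<otimes>\<^sub>D (igen \<circ>\<^sub>D pgen) \<otimes>\<^sub>D id1)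
             \<circ>\<^sub>D (cup1 \<otimes>\<^sub>D id1 \<otimes>\<^sub>D id1)"

definition drels :: "(dterm \<times> dterm) set" where
  "drels = {
     ((id1 \<otimes>\<^sub>D cap1) \<circ>\<^sub>D (cup1 \<otimes>\<^sub>D id1), id1),
     ((cap1 \<otimes>\<^sub>D id1) \<circ>\<^sub>D (id1 \<otimes>\<^sub>D cup1), id1),
     ((id2 \<otimes>\<^sub>D cap2) \<circ>\<^sub>D (cup2 \<otimes>\<^sub>D id2), id2),
     ((cap2 \<otimes>\<^sub>D id2) \<circ>\<^sub>D (id2 \<otimes>\<^sub>D cup2), id2),
     (pgen, (id2 \<otimes>\<^sub>D cap1) \<circ>\<^sub>D (id2 \<otimes>\<^sub>D id1 \<otimes>\<^sub>D cap1 \<otimes>\<^sub>D id1)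
              \<circ>\<^sub>D (id2 \<otimes>\<^sub>D igen \<otimes>\<^sub>D id1 \<otimes>\<^sub>D id1) \<circ>\<^sub>D (cup2 \<otimes>\<^sub>D id1 \<otimes>\<^sub>D id1)),
     (pgen, (cap1 \<otimes>\<^sub>D id2) \<circ>\<^sub>D (id1 \<otimes>\<^sub>D cap1 \<otimes>\<^sub>D id1 \<otimes>\<^sub>D id2)
              \<circ>\<^sub>D (id1 \<otimes>\<^sub>D id1 \<otimes>\<^sub>D igen \<otimes>\<^sub>D id2) \<circ>\<^sub>D (id1 \<otimes>\<^sub>D id1 \<otimes>\<^sub>D cup2)),
     (cap1 \<circ>\<^sub>D cup1, (- (qn 6 * qn 2 / qn 3)) *\<^sub>D DId []),
     (cap2 \<circ>\<^sub>D cup2, (qn 6 * qn 5 / (qn 3 * qn 2)) *\<^sub>D DId []),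
     (cap1 \<circ>\<^sub>D igen, DZero [C2] []),
     (pgen \<circ>\<^sub>D igen, (- qn 2) *\<^sub>D id2),
     ((pgen \<otimes>\<^sub>D pgen) \<circ>\<^sub>D (id1 \<otimes>\<^sub>D cup1 \<otimes>\<^sub>D id1) \<circ>\<^sub>D igen, DZero [C2] [C2, C2]),
     (Hdiag, (1 / qn 2) *\<^sub>D DId [C1, C1] +\<^sub>D igen \<circ>\<^sub>D pgen
               +\<^sub>D (- (1 / qn 2)) *\<^sub>D (cup1 \<circ>\<^sub>D cap1))}"

text \<open>\<open>deq u v\<close> is the smallest congruence on expressions \<open>u \<rightarrow> v\<close> that contains the
  axioms of a strict \<open>\<A>\<close>-linear monoidal category and the defining relations.\<close>

inductive deq :: "cword \<Rightarrow> cword \<Rightarrow> dterm \<Rightarrow> dterm \<Rightarrow> bool" where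
  deq_refl: "dtyped f u v \<Longrightarrow> deq u v f f"
| deq_sym: "deq u v f g \<Longrightarrow> deq u v g f"
| deq_trans: "\<lbrakk>deq u v f g; deq u v g h\<rbrakk> \<Longrightarrow> deq u v f h"
| cong_comp: "\<lbrakk>deq v w g g'; deq u v f f'\<rbrakk> \<Longrightarrow> deq u w (g \<circ>\<^sub>D f) (g' \<circ>\<^sub>D f')"
| cong_tens: "\<lbrakk>deq u u' f f'; deq v v' g g'\<rbrakk>
    \<Longrightarrow> deq (u @ v) (u' @ v') (f \<otimes>\<^sub>D g) (f' \<otimes>\<^sub>D g')"
| cong_add: "\<lbrakk>deq u v f f'; deq u v g g'\<rbrakk> \<Longrightarrow> deq u v (f +\<^sub>D g) (f' +\<^sub>D g')"
| cong_scale: "\<lbrakk>a \<in> Aset; deq u v f f'\<rbrakk> \<Longrightarrow> deq u v (a *\<^sub>D f) (a *\<^sub>D f')"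
| add_assoc: "\<lbrakk>dtyped f u v; dtyped g u v; dtyped h u v\<rbrakk>
    \<Longrightarrow> deq u v (f +\<^sub>D g +\<^sub>D h) (f +\<^sub>D (g +\<^sub>D h))"
| add_comm: "\<lbrakk>dtyped f u v; dtyped g u v\<rbrakk> \<Longrightarrow> deq u v (f +\<^sub>D g) (g +\<^sub>D f)"
| add_zero: "dtyped f u v \<Longrightarrow> deq u v (DZero u v +\<^sub>D f) f"
| add_neg: "dtyped f u v \<Longrightarrow> deq u v (f +\<^sub>D (- 1) *\<^sub>D f) (DZero u v)"
| scale_add_left: "\<lbrakk>a \<in> Aset; b \<in> Aset; dtyped f u v\<rbrakk>
    \<Longrightarrow> deq u v ((a + b) *\<^sub>D f) (a *\<^sub>D f +\<^sub>D b *\<^sub>D f)"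
| scale_add_right: "\<lbrakk>a \<in> Aset; dtyped f u v; dtyped g u v\<rbrakk>
    \<Longrightarrow> deq u v (a *\<^sub>D (f +\<^sub>D g)) (a *\<^sub>D f +\<^sub>D a *\<^sub>D g)"
| scale_scale: "\<lbrakk>a \<in> Aset; b \<in> Aset; dtyped f u v\<rbrakk>
    \<Longrightarrow> deq u v ((a * b) *\<^sub>D f) (a *\<^sub>D b *\<^sub>D f)"
| scale_one: "dtyped f u v \<Longrightarrow> deq u v (1 *\<^sub>D f) f"
| comp_id_left: "dtyped f u v \<Longrightarrow> deq u v (DId v \<circ>\<^sub>D f) f"
| comp_id_right: "dtyped f u v \<Longrightarrow> deq u v (f \<circ>\<^sub>D DId u) f"
| comp_assoc: "\<lbrakk>dtyped h w x; dtyped g v w; dtyped f u v\<rbrakk>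
    \<Longrightarrow> deq u x (h \<circ>\<^sub>D g \<circ>\<^sub>D f) (h \<circ>\<^sub>D (g \<circ>\<^sub>D f))"
| comp_add_left: "\<lbrakk>dtyped g v w; dtyped g' v w; dtyped f u v\<rbrakk>
    \<Longrightarrow> deq u w ((g +\<^sub>D g') \<circ>\<^sub>D f) (g \<circ>\<^sub>D f +\<^sub>D g' \<circ>\<^sub>D f)"
| comp_add_right: "\<lbrakk>dtyped g v w; dtyped f u v; dtyped f' u v\<rbrakk>
    \<Longrightarrow> deq u w (g \<circ>\<^sub>D (f +\<^sub>D f')) (g \<circ>\<^sub>D f +\<^sub>D g \<circ>\<^sub>D f')"
| comp_scale_left: "\<lbrakk>a \<in> Aset; dtyped g v w; dtyped f u v\<rbrakk>
    \<Longrightarrow> deq u w ((a *\<^sub>D g) \<circ>\<^sub>D f) (a *\<^sub>D (g \<circ>\<^sub>D f))"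
| comp_scale_right: "\<lbrakk>a \<in> Aset; dtyped g v w; dtyped f u v\<rbrakk>
    \<Longrightarrow> deq u w (g \<circ>\<^sub>D (a *\<^sub>D f)) (a *\<^sub>D (g \<circ>\<^sub>D f))"
| tens_add_left: "\<lbrakk>dtyped f u u'; dtyped f' u u'; dtyped g v v'\<rbrakk>
    \<Longrightarrow> deq (u @ v) (u' @ v') ((f +\<^sub>D f') \<otimes>\<^sub>D g) (f \<otimes>\<^sub>D g +\<^sub>D f' \<otimes>\<^sub>D g)"
| tens_add_right: "\<lbrakk>dtyped f u u'; dtyped g v v'; dtyped g' v v'\<rbrakk>
    \<Longrightarrow> deq (u @ v) (u' @ v') (f \<otimes>\<^sub>D (g +\<^sub>D g')) (f \<otimes>\<^sub>D g +\<^sub>D f \<otimes>\<^sub>D g')"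
| tens_scale_left: "\<lbrakk>a \<in> Aset; dtyped f u u'; dtyped g v v'\<rbrakk>
    \<Longrightarrow> deq (u @ v) (u' @ v') ((a *\<^sub>D f) \<otimes>\<^sub>D g) (a *\<^sub>D (f \<otimes>\<^sub>D g))"
| tens_scale_right: "\<lbrakk>a \<in> Aset; dtyped f u u'; dtyped g v v'\<rbrakk>
    \<Longrightarrow> deq (u @ v) (u' @ v') (f \<otimes>\<^sub>D (a *\<^sub>D g)) (a *\<^sub>D (f \<otimes>\<^sub>D g))"
| tens_id: "deq (u @ v) (u @ v) (DId u \<otimes>\<^sub>D DId v) (DId (u @ v))"
| interchange: "\<lbrakk>dtyped g v w; dtyped f u v; dtyped g' v' w'; dtyped f' u' v'\<rbrakk>
    \<Longrightarrow> deq (u @ u') (w @ w') ((g \<circ>\<^sub>D f) \<otimes>\<^sub>D (g' \<circ>\<^sub>D f')) ((g \<otimes>\<^sub>D g') \<circ>\<^sub>D (f \<otimes>\<^sub>D f'))"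
| tens_assoc: "\<lbrakk>dtyped f u u'; dtyped g v v'; dtyped h w w'\<rbrakk>
    \<Longrightarrow> deq (u @ v @ w) (u' @ v' @ w') ((f \<otimes>\<^sub>D g) \<otimes>\<^sub>D h) (f \<otimes>\<^sub>D (g \<otimes>\<^sub>D h))"
| tens_unit_left: "dtyped f u v \<Longrightarrow> deq u v (DId [] \<otimes>\<^sub>D f) f"
| tens_unit_right: "dtyped f u v \<Longrightarrow> deq u v (f \<otimes>\<^sub>D DId []) f"
| relation: "\<lbrakk>(f, g) \<in> drels; dtyped f u v; dtyped g u v\<rbrakk> \<Longrightarrow> deq u v f g"

definition dcls :: "dterm \<Rightarrow> dterm set" where
  "dcls f = {g. \<exists>u v. deq u v f g}"

definition Dsp4 :: "(cword, dterm set) moncat" where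
  "Dsp4 = \<lparr>
     Obj = UNIV,
     Hom = (\<lambda>u v. \<lparr>
       carrier = {dcls f | f. dtyped f u v},
       monoid.mult = undefined, monoid.one = undefined,
       ring.zero = dcls (DZero u v),
       ring.add = (\<lambda>Z Y. \<Union>f\<in>Z. \<Union>g\<in>Y. dcls (f +\<^sub>D g)),
       module.smult = (\<lambda>a Z. \<Union>f\<in>Z. dcls (a *\<^sub>D f))\<rparr>),
     Idm = (\<lambda>u. dcls (DId u)),
     Cmp = (\<lambda>Z Y. \<Union>f\<in>Z. \<Union>g\<in>Y. dcls (f \<circ>\<^sub>D g)),
     OTen = (@),
     MTen = (\<lambda>Z Y. \<Union>f\<in>Z. \<Union>g\<in>Y. dcls (f \<otimes>\<^sub>D g)),
     Unt = []\<rparr>"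


section \<open>The quantum group\<close>

subsection \<open>Free algebras\<close>

text \<open>Words form a free monoid, written additively so that finitely supported functions on
  words carry the convolution product of the library: this is the free algebra.\<close>

datatype 'a fmon = FMon (letters: "'a list")

instantiation fmon :: (type) monoid_add
begin

definition zero_fmon :: "'a fmon" where
  "zero_fmon = FMon []"

definition plus_fmon :: "'a fmon \<Rightarrow> 'a fmon \<Rightarrow> 'a fmon" where
  "plus_fmon v w = FMon (letters v @ letters w)"

instance
  by standard (simp_all add: zero_fmon_def plus_fmon_def)

end

datatype sroot = S | T

datatype ugen = E sroot | F sroot | K sroot | Kinv sroot

type_synonym falg = "ugen fmon \<Rightarrow>\<^sub>0 Kq"

type_synonym falg2 = "(ugen fmon \<times> ugen fmon) \<Rightarrow>\<^sub>0 Kq"  \<comment> \<open>\<open>falg \<otimes> falg\<close> over \<open>\<rat>(q)\<close>\<close>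

abbreviation cst :: "Kq \<Rightarrow> ('a::monoid_add) \<Rightarrow>\<^sub>0 Kq" where
  "cst c \<equiv> Poly_Mapping.single 0 c"

definition fgen :: "ugen \<Rightarrow> falg" where
  "fgen x = Poly_Mapping.single (FMon [x]) 1"

definition ftens :: "falg \<Rightarrow> falg \<Rightarrow> falg2" where
  "ftens x y = (\<Sum>v\<in>Poly_Mapping.keys x. \<Sum>w\<in>Poly_Mapping.keys y.
     Poly_Mapping.single (v, w) (Poly_Mapping.lookup x v * Poly_Mapping.lookup y w))"

text \<open>The algebra homomorphism out of the free algebra with given values on scalars and
  generators.\<close>

definition fext :: "(Kq \<Rightarrow> 'b::ring_1) \<Rightarrow> (ugen \<Rightarrow> 'b) \<Rightarrow> falg \<Rightarrow> 'b" where
  "fext c g x = (\<Sum>w\<in>Poly_Mapping.keys x.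
     c (Poly_Mapping.lookup x w) * prod_list (map g (letters w)))"

subsection \<open>Generators and relations\<close>

primrec qroot :: "sroot \<Rightarrow> Kq" where
  "qroot S = qv"
| "qroot T = qv ^ 2"

fun rootform :: "sroot \<Rightarrow> sroot \<Rightarrow> int" where
  "rootform S S = 2"
| "rootform T T = 4"
| "rootform S T = - 2"
| "rootform T S = - 2"

definition serre :: "(sroot \<Rightarrow> ugen) \<Rightarrow> falg set" where
  "serre Z = (let s = fgen (Z S); t = fgen (Z T) in {
     t ^ 2 * s - cst (qn 4 / qn 2) * (t * s * t) + s * t ^ 2,
     s ^ 3 * t - cst (qn 3) * (s ^ 2 * t * s) + cst (qn 3) * (s * t * s ^ 2) - t * s ^ 3})"

definition urels :: "falg set" where
  "urels =
     {fgen (K a) * fgen (K b) - fgen (K b) * fgen (K a) | a b. True}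
     \<union> {fgen (K a) * fgen (Kinv a) - 1 | a. True}
     \<union> {fgen (Kinv a) * fgen (K a) - 1 | a. True}
     \<union> {fgen (K a) * fgen (E b) - cst (qv powi rootform a b) * (fgen (E b) * fgen (K a))
         | a b. True}
     \<union> {fgen (K a) * fgen (F b) - cst (qv powi (- rootform a b)) * (fgen (F b) * fgen (K a))
         | a b. True}
     \<union> {fgen (E a) * fgen (F b) - fgen (F b) * fgen (E a) | a b. a \<noteq> b}
     \<union> {fgen (E a) * fgen (F a) - fgen (F a) * fgen (E a)
          - cst (1 / (qroot a - inverse (qroot a))) * (fgen (K a) - fgen (Kinv a)) | a. True}
     \<union> serre E \<union> serre F"

definition uideal :: "falg set" where
  "uideal = genideal ring_of_type_algebra urels"

definition Uq :: "falg set ring" where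
  "Uq = ring_of_type_algebra Quot uideal"

definition ucls :: "falg \<Rightarrow> falg set" where
  "ucls x = uideal +>\<^bsub>ring_of_type_algebra\<^esub> x"

definition urep :: "falg set \<Rightarrow> falg" where
  "urep Z = (SOME x. x \<in> Z)"

definition divpow :: "(sroot \<Rightarrow> ugen) \<Rightarrow> sroot \<Rightarrow> nat \<Rightarrow> falg" where
  "divpow Z a n = cst (1 / qfact (qroot a) n) * fgen (Z a) ^ n"

text \<open>Adjoining the scalars from \<open>\<A>\<close> makes the generated subring the generated
  \<open>\<A>\<close>-subalgebra.\<close>

definition UA :: "falg set ring" where
  "UA = Uq \<lparr>carrier := generate_ring Uq (ucls `
     (cst ` Aset
      \<union> range (\<lambda>a. fgen (K a)) \<union> range (\<lambda>a. fgen (Kinv a))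
      \<union> {divpow E a n | a n. n \<ge> 1} \<union> {divpow F a n | a n. n \<ge> 1}))\<rparr>"

subsection \<open>Coproduct and counit\<close>

text \<open>\<open>U \<otimes> U\<close> over \<open>\<rat>(q)\<close>, where \<open>U = falg / I\<close>, is the quotient of \<open>falg \<otimes> falg\<close> by
  the ideal \<open>I \<otimes> falg + falg \<otimes> I\<close>.\<close>

definition uuideal :: "falg2 set" where
  "uuideal = genideal ring_of_type_algebra
     ((\<lambda>x. ftens x 1) ` uideal \<union> (\<lambda>x. ftens 1 x) ` uideal)"

definition UU :: "falg2 set ring" where
  "UU = ring_of_type_algebra Quot uuideal"

definition uucls :: "falg2 \<Rightarrow> falg2 set" where
  "uucls z = uuideal +>\<^bsub>ring_of_type_algebra\<^esub> z"

definition utens :: "falg set \<Rightarrow> falg set \<Rightarrow> falg2 set" where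
  "utens Z Y = uucls (ftens (urep Z) (urep Y))"

primrec cop_gen :: "ugen \<Rightarrow> falg2" where
  "cop_gen (E a) = ftens (fgen (E a)) 1 + ftens (fgen (K a)) (fgen (E a))"
| "cop_gen (F a) = ftens (fgen (F a)) (fgen (Kinv a)) + ftens 1 (fgen (F a))"
| "cop_gen (K a) = ftens (fgen (K a)) (fgen (K a))"
| "cop_gen (Kinv a) = ftens (fgen (Kinv a)) (fgen (Kinv a))"

definition ucop :: "falg set \<Rightarrow> falg2 set" where
  "ucop Z = uucls (fext cst cop_gen (urep Z))"

primrec counit_gen :: "ugen \<Rightarrow> Kq" where
  "counit_gen (E a) = 0"
| "counit_gen (F a) = 0"
| "counit_gen (K a) = 1"
| "counit_gen (Kinv a) = 1"

definition ucounit :: "falg set \<Rightarrow> Kq" where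
  "ucounit Z = fext (\<lambda>c. c) counit_gen (urep Z)"

text \<open>A way of writing \<open>\<Delta>(u) = \<Sum> u'\<^sub>i \<otimes> u''\<^sub>i\<close> with all \<open>u'\<^sub>i, u''\<^sub>i\<close> in the \<open>\<A>\<close>-form, which is
  possible because the \<open>\<A>\<close>-form is a Hopf subalgebra. The form is free over \<open>\<A>\<close>, so its
  tensor square over \<open>\<A>\<close> embeds into \<^term>\<open>UU\<close>, and nothing below depends on the choice.\<close>

definition sweedler :: "falg set \<Rightarrow> (falg set \<times> falg set) list" where
  "sweedler u = (SOME l. set l \<subseteq> carrier UA \<times> carrier UA \<and>
     ucop u = foldr (\<lambda>(x, y) s. utens x y \<oplus>\<^bsub>UU\<^esub> s) l \<zero>\<^bsub>UU\<^esub>)"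


section \<open>The monoidal category of modules\<close>

text \<open>The library's locale \<^locale>\<open>module\<close> with a not necessarily commutative ring.\<close>

locale left_module = R?: ring R + M?: abelian_group M
  for R :: "('a, 'd) ring_scheme" (structure) and M :: "('a, 'b, 'c) module_scheme" (structure) +
  assumes smult_closed:
      "\<lbrakk>a \<in> carrier R; x \<in> carrier M\<rbrakk> \<Longrightarrow> a \<odot>\<^bsub>M\<^esub> x \<in> carrier M"
    and smult_l_distr:
      "\<lbrakk>a \<in> carrier R; b \<in> carrier R; x \<in> carrier M\<rbrakk>
       \<Longrightarrow> (a \<oplus>\<^bsub>R\<^esub> b) \<odot>\<^bsub>M\<^esub> x = a \<odot>\<^bsub>M\<^esub> x \<oplus>\<^bsub>M\<^esub> b \<odot>\<^bsub>M\<^esub> x"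
    and smult_r_distr:
      "\<lbrakk>a \<in> carrier R; x \<in> carrier M; y \<in> carrier M\<rbrakk>
       \<Longrightarrow> a \<odot>\<^bsub>M\<^esub> (x \<oplus>\<^bsub>M\<^esub> y) = a \<odot>\<^bsub>M\<^esub> x \<oplus>\<^bsub>M\<^esub> a \<odot>\<^bsub>M\<^esub> y"
    and smult_assoc1:
      "\<lbrakk>a \<in> carrier R; b \<in> carrier R; x \<in> carrier M\<rbrakk>
       \<Longrightarrow> (a \<otimes>\<^bsub>R\<^esub> b) \<odot>\<^bsub>M\<^esub> x = a \<odot>\<^bsub>M\<^esub> (b \<odot>\<^bsub>M\<^esub> x)"
    and smult_one: "x \<in> carrier M \<Longrightarrow> \<one>\<^bsub>R\<^esub> \<odot>\<^bsub>M\<^esub> x = x"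

type_synonym 'm umod = "(falg set, 'm) module"

text \<open>Every \<^term>\<open>UA\<close>-module is an \<open>\<A>\<close>-module through \<open>a \<mapsto> a \<cdot> 1\<close>.\<close>

definition ascal :: "'m umod \<Rightarrow> Kq \<Rightarrow> 'm \<Rightarrow> 'm" where
  "ascal M a x = ucls (cst a) \<odot>\<^bsub>M\<^esub> x"

definition umod_hom :: "'m umod \<Rightarrow> 'n umod \<Rightarrow> ('m \<Rightarrow> 'n) set" where
  "umod_hom M N = {h \<in> carrier M \<rightarrow> carrier N.
     (\<forall>x\<in>carrier M. \<forall>y\<in>carrier M. h (x \<oplus>\<^bsub>M\<^esub> y) = h x \<oplus>\<^bsub>N\<^esub> h y) \<and>
     (\<forall>u\<in>carrier UA. \<forall>x\<in>carrier M. h (u \<odot>\<^bsub>M\<^esub> x) = u \<odot>\<^bsub>N\<^esub> h x)}"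

definition umod_iso :: "'m umod \<Rightarrow> 'n umod \<Rightarrow> ('m \<Rightarrow> 'n) set" where
  "umod_iso M N = {h \<in> umod_hom M N. bij_betw h (carrier M) (carrier N)}"

subsection \<open>Tensor products over \<open>\<A>\<close>\<close>

type_synonym ('m, 'n) tens = "(('m \<times> 'n) \<Rightarrow>\<^sub>0 int) set"

abbreviation tfree :: "'m umod \<Rightarrow> 'n umod \<Rightarrow> (('m \<times> 'n) \<Rightarrow>\<^sub>0 int) monoid" where
  "tfree M N \<equiv> free_Abelian_group (carrier M \<times> carrier N)"

definition trels :: "'m umod \<Rightarrow> 'n umod \<Rightarrow> (('m \<times> 'n) \<Rightarrow>\<^sub>0 int) set" where
  "trels M N =
     {frag_of (x \<oplus>\<^bsub>M\<^esub> x', y) - frag_of (x, y) - frag_of (x', y) | x x' y.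
        x \<in> carrier M \<and> x' \<in> carrier M \<and> y \<in> carrier N}
     \<union> {frag_of (x, y \<oplus>\<^bsub>N\<^esub> y') - frag_of (x, y) - frag_of (x, y') | x y y'.
        x \<in> carrier M \<and> y \<in> carrier N \<and> y' \<in> carrier N}
     \<union> {frag_of (ascal M a x, y) - frag_of (x, ascal N a y) | a x y.
        a \<in> Aset \<and> x \<in> carrier M \<and> y \<in> carrier N}"

definition tsub :: "'m umod \<Rightarrow> 'n umod \<Rightarrow> (('m \<times> 'n) \<Rightarrow>\<^sub>0 int) set" where
  "tsub M N = generate (tfree M N) (trels M N)"

definition tpure :: "'m umod \<Rightarrow> 'n umod \<Rightarrow> 'm \<Rightarrow> 'n \<Rightarrow> ('m, 'n) tens" where
  "tpure M N x y = tsub M N #>\<^bsub>tfree M N\<^esub> frag_of (x, y)"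

text \<open>The tensor product as an abelian group in additive notation.\<close>

definition tgroup :: "'m umod \<Rightarrow> 'n umod \<Rightarrow> ('m, 'n) tens ring" where
  "tgroup M N = (let Q = tfree M N Mod tsub M N in
     \<lparr>carrier = carrier Q, monoid.mult = undefined, monoid.one = undefined,
      ring.zero = monoid.one Q, ring.add = monoid.mult Q\<rparr>)"

text \<open>The additive map on the tensor product sending \<open>x \<otimes> y\<close> to \<open>f x y\<close>, for balanced
  biadditive \<open>f\<close> with values in \<open>P\<close>.\<close>

definition tlift :: "('p, 'x) ring_scheme \<Rightarrow> ('m \<Rightarrow> 'n \<Rightarrow> 'p) \<Rightarrow> ('m, 'n) tens \<Rightarrow> 'p" where
  "tlift P f Z = (let r = (SOME r. r \<in> Z) in
     \<Oplus>\<^bsub>P\<^esub>k\<in>Poly_Mapping.keys r. [Poly_Mapping.lookup r k] \<cdot>\<^bsub>P\<^esub> f (fst k) (snd k))"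

text \<open>The action is \<open>u \<cdot> (x \<otimes> y) = \<Sum> u'\<^sub>i x \<otimes> u''\<^sub>i y\<close> where \<open>\<Delta>(u) = \<Sum> u'\<^sub>i \<otimes> u''\<^sub>i\<close>.\<close>

definition tensor :: "'m umod \<Rightarrow> 'n umod \<Rightarrow> ('m, 'n) tens umod" where
  "tensor M N = \<lparr>
     carrier = carrier (tgroup M N),
     monoid.mult = undefined, monoid.one = undefined,
     ring.zero = \<zero>\<^bsub>tgroup M N\<^esub>,
     ring.add = ring.add (tgroup M N),
     module.smult = (\<lambda>u. tlift (tgroup M N) (\<lambda>x y.
       foldr (\<lambda>(a, b) s. tpure M N (a \<odot>\<^bsub>M\<^esub> x) (b \<odot>\<^bsub>N\<^esub> y) \<oplus>\<^bsub>tgroup M N\<^esub> s)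
         (sweedler u) \<zero>\<^bsub>tgroup M N\<^esub>))\<rparr>"

definition tmap :: "'m umod \<Rightarrow> 'n umod \<Rightarrow> ('a \<Rightarrow> 'm) \<Rightarrow> ('b \<Rightarrow> 'n)
    \<Rightarrow> ('a, 'b) tens \<Rightarrow> ('m, 'n) tens" where
  "tmap M N h k = tlift (tensor M N) (\<lambda>x y. tpure M N (h x) (k y))"

definition uunit :: "Kq umod" where
  "uunit = \<lparr>carrier = Aset, monoid.mult = undefined, monoid.one = undefined,
     ring.zero = 0, ring.add = (+),
     module.smult = (\<lambda>u a. ucounit u * a)\<rparr>"

definition tassoc :: "'m umod \<Rightarrow> 'n umod \<Rightarrow> 'p umod
    \<Rightarrow> (('m, 'n) tens, 'p) tens \<Rightarrow> ('m, ('n, 'p) tens) tens" where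
  "tassoc M N P =
     (let R = tensor M (tensor N P) in
      tlift R (\<lambda>Z z. tlift R (\<lambda>x y. tpure M (tensor N P) x (tpure N P y z)) Z))"

definition tlunit :: "'m umod \<Rightarrow> (Kq, 'm) tens \<Rightarrow> 'm" where
  "tlunit M = tlift M (\<lambda>a x. ascal M a x)"

definition trunit :: "'m umod \<Rightarrow> ('m, Kq) tens \<Rightarrow> 'm" where
  "trunit M = tlift M (\<lambda>x a. ascal M a x)"

subsection \<open>Monoidal functors\<close>

text \<open>An \<open>\<A>\<close>-linear (strong) monoidal functor \<open>(F, \<mu>, \<eta>)\<close> from a strict \<open>\<A>\<close>-linear monoidal
  category to \<^term>\<open>UA\<close>-modules: \<open>\<mu> u v : F u \<otimes> F v \<cong> F (u \<otimes> v)\<close> and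
  \<open>\<eta> : \<A> \<cong> F \<one>\<close>, subject to naturality and the usual associativity and unit coherence.
  Maps of modules are compared on carriers only.\<close>

locale linear_monoidal_functor = strict_linear_monoidal_category C
  for C :: "('o, 'f) moncat" (structure) +
  fixes F0 :: "'o \<Rightarrow> 'm umod"
    and F1 :: "'f \<Rightarrow> 'm \<Rightarrow> 'm"
    and \<mu> :: "'o \<Rightarrow> 'o \<Rightarrow> ('m, 'm) tens \<Rightarrow> 'm"
    and \<eta> :: "Kq \<Rightarrow> 'm"
  assumes obj: "u \<in> Obj C \<Longrightarrow> left_module UA (F0 u)"
    and mor: "\<lbrakk>u \<in> Obj C; v \<in> Obj C; f \<in> arr C u v\<rbrakk> \<Longrightarrow> F1 f \<in> umod_hom (F0 u) (F0 v)"
    and map_id: "\<lbrakk>u \<in> Obj C; x \<in> carrier (F0 u)\<rbrakk> \<Longrightarrow> F1 (Idm C u) x = x"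
    and map_comp: "\<lbrakk>u \<in> Obj C; v \<in> Obj C; w \<in> Obj C; g \<in> arr C v w; f \<in> arr C u v;
        x \<in> carrier (F0 u)\<rbrakk> \<Longrightarrow> F1 (g \<cdot> f) x = F1 g (F1 f x)"
    and map_add: "\<lbrakk>u \<in> Obj C; v \<in> Obj C; f \<in> arr C u v; g \<in> arr C u v; x \<in> carrier (F0 u)\<rbrakk>
      \<Longrightarrow> F1 (f \<oplus>\<^bsub>Hom C u v\<^esub> g) x = F1 f x \<oplus>\<^bsub>F0 v\<^esub> F1 g x"
    and map_smult: "\<lbrakk>u \<in> Obj C; v \<in> Obj C; a \<in> Aset; f \<in> arr C u v; x \<in> carrier (F0 u)\<rbrakk>
      \<Longrightarrow> F1 (a \<odot>\<^bsub>Hom C u v\<^esub> f) x = ascal (F0 v) a (F1 f x)"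
    and mu_iso: "\<lbrakk>u \<in> Obj C; v \<in> Obj C\<rbrakk>
      \<Longrightarrow> \<mu> u v \<in> umod_iso (tensor (F0 u) (F0 v)) (F0 (OTen C u v))"
    and mu_natural: "\<lbrakk>u \<in> Obj C; u' \<in> Obj C; v \<in> Obj C; v' \<in> Obj C;
        f \<in> arr C u u'; g \<in> arr C v v'; t \<in> carrier (tensor (F0 u) (F0 v))\<rbrakk>
      \<Longrightarrow> F1 (MTen C f g) (\<mu> u v t) = \<mu> u' v' (tmap (F0 u') (F0 v') (F1 f) (F1 g) t)"
    and eta_iso: "\<eta> \<in> umod_iso uunit (F0 (Unt C))"
    and mu_assoc: "\<lbrakk>u \<in> Obj C; v \<in> Obj C; w \<in> Obj C;
        s \<in> carrier (tensor (tensor (F0 u) (F0 v)) (F0 w))\<rbrakk>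
      \<Longrightarrow> \<mu> (OTen C u v) w (tmap (F0 (OTen C u v)) (F0 w) (\<mu> u v) (\<lambda>z. z) s)
        = \<mu> u (OTen C v w) (tmap (F0 u) (F0 (OTen C v w)) (\<lambda>x. x) (\<mu> v w)
            (tassoc (F0 u) (F0 v) (F0 w) s))"
    and mu_unit_left: "\<lbrakk>u \<in> Obj C; y \<in> carrier (tensor uunit (F0 u))\<rbrakk>
      \<Longrightarrow> \<mu> (Unt C) u (tmap (F0 (Unt C)) (F0 u) \<eta> (\<lambda>x. x) y) = tlunit (F0 u) y"
    and mu_unit_right: "\<lbrakk>u \<in> Obj C; z \<in> carrier (tensor (F0 u) uunit)\<rbrakk>
      \<Longrightarrow> \<mu> u (Unt C) (tmap (F0 u) (F0 (Unt C)) (\<lambda>x. x) \<eta> z) = trunit (F0 u) z"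


section \<open>The fundamental modules\<close>

type_synonym weight = "int \<times> int"

text \<open>The basis vector of weight \<open>\<mu>\<close> is indexed by the one-letter word \<open>[\<mu>]\<close>, and
  coefficients are taken in \<open>\<rat>(q)\<close>; the \<open>\<A>\<close>-forms are cut out as carriers. Indexing by
  words leaves room for all values of a functor with these values on \<open>1\<close> and \<open>2\<close> within a
  single type.\<close>

type_synonym vec = "weight list \<Rightarrow>\<^sub>0 Kq"

definition vb :: "int \<Rightarrow> int \<Rightarrow> vec" where
  "vb i j = Poly_Mapping.single [(i, j)] 1"

definition vscale :: "Kq \<Rightarrow> vec \<Rightarrow> vec" where
  "vscale c x = Poly_Mapping.map ((*) c) x"

definition vlin :: "(weight \<Rightarrow> vec) \<Rightarrow> vec \<Rightarrow> vec" where
  "vlin f x = (\<Sum>k\<in>Poly_Mapping.keys x. vscale (Poly_Mapping.lookup x k) (f (hd k)))"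

definition falg_act :: "(ugen \<Rightarrow> weight \<Rightarrow> vec) \<Rightarrow> falg \<Rightarrow> vec \<Rightarrow> vec" where
  "falg_act \<rho> x v = (\<Sum>w\<in>Poly_Mapping.keys x.
     vscale (Poly_Mapping.lookup x w) (foldr (\<lambda>g. vlin (\<rho> g)) (letters w) v))"

text \<open>The free \<open>\<A>\<close>-module on the weights in \<open>B\<close>, on which \<^term>\<open>UA\<close> acts by restricting the
  action of \<^term>\<open>Uq\<close> on the \<open>\<rat>(q)\<close>-span of \<open>B\<close> given by \<open>\<rho>\<close> on generators. In particular
  divided powers act by the corresponding divided operators.\<close>

definition wmod :: "weight set \<Rightarrow> (ugen \<Rightarrow> weight \<Rightarrow> vec) \<Rightarrow> vec umod" where
  "wmod B \<rho> = \<lparr>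
     carrier = {x. Poly_Mapping.keys x \<subseteq> (\<lambda>w. [w]) ` B \<and> range (Poly_Mapping.lookup x) \<subseteq> Aset},
     monoid.mult = undefined, monoid.one = undefined, ring.zero = 0, ring.add = (+),
     module.smult = (\<lambda>u. falg_act \<rho> (urep u))\<rparr>"

definition tabled :: "('k \<times> 'v::zero) list \<Rightarrow> 'k \<Rightarrow> 'v" where
  "tabled l k = (case map_of l k of None \<Rightarrow> 0 | Some x \<Rightarrow> x)"

primrec kexp :: "sroot \<Rightarrow> weight \<Rightarrow> int" where
  "kexp S w = fst w"
| "kexp T w = 2 * snd w"

fun rho1 :: "ugen \<Rightarrow> weight \<Rightarrow> vec" where
  "rho1 (F S) w = tabled [((1, 0), vb (- 1) 1), ((1, - 1), vb (- 1) 0)] w"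
| "rho1 (F T) w = tabled [((- 1, 1), vb 1 (- 1))] w"
| "rho1 (E S) w = tabled [((- 1, 0), vb 1 (- 1)), ((- 1, 1), vb 1 0)] w"
| "rho1 (E T) w = tabled [((1, - 1), vb (- 1) 1)] w"
| "rho1 (K a) w = vscale (qv powi kexp a w) (vb (fst w) (snd w))"
| "rho1 (Kinv a) w = vscale (qv powi (- kexp a w)) (vb (fst w) (snd w))"

fun rho2 :: "ugen \<Rightarrow> weight \<Rightarrow> vec" where
  "rho2 (F T) w = tabled [((0, 1), vb 2 (- 1)), ((- 2, 1), vb 0 (- 1))] w"
| "rho2 (F S) w = tabled [((2, - 1), vb 0 0), ((0, 0), vscale (qn 2) (vb (- 2) 1))] w"
| "rho2 (E T) w = tabled [((0, - 1), vb (- 2) 1), ((2, - 1), vb 0 1)] w"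
| "rho2 (E S) w = tabled [((- 2, 1), vb 0 0), ((0, 0), vscale (qn 2) (vb 2 (- 1)))] w"
| "rho2 (K a) w = vscale (qv powi kexp a w) (vb (fst w) (snd w))"
| "rho2 (Kinv a) w = vscale (qv powi (- kexp a w)) (vb (fst w) (snd w))"

definition V1 :: "vec umod" where
  "V1 = wmod {(1, 0), (- 1, 1), (1, - 1), (- 1, 0)} rho1"

definition V2 :: "vec umod" where
  "V2 = wmod {(0, 1), (2, - 1), (0, 0), (- 2, 1), (0, - 1)} rho2"

subsection \<open>The module maps\<close>

definition lincomb :: "'m umod \<Rightarrow> (Kq \<times> 'm) list \<Rightarrow> 'm" where
  "lincomb M l = foldr (\<lambda>(c, x) s. ascal M c x \<oplus>\<^bsub>M\<^esub> s) l \<zero>\<^bsub>M\<^esub>"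

abbreviation V11 :: "(vec, vec) tens umod" where "V11 \<equiv> tensor V1 V1"
abbreviation V22 :: "(vec, vec) tens umod" where "V22 \<equiv> tensor V2 V2"

abbreviation t1 :: "weight \<Rightarrow> weight \<Rightarrow> (vec, vec) tens" where
  "t1 x y \<equiv> tpure V1 V1 (vb (fst x) (snd x)) (vb (fst y) (snd y))"
abbreviation t2 :: "weight \<Rightarrow> weight \<Rightarrow> (vec, vec) tens" where
  "t2 x y \<equiv> tpure V2 V2 (vb (fst x) (snd x)) (vb (fst y) (snd y))"

definition mcup1 :: "Kq \<Rightarrow> (vec, vec) tens" where
  "mcup1 a = ascal V11 a (lincomb V11 [
     (- (qv powi (- 4)), t1 (1, 0) (- 1, 0)),
     (qv powi (- 3), t1 (- 1, 1) (1, - 1)),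
     (- (qv powi (- 1)), t1 (1, - 1) (- 1, 1)),
     (1, t1 (- 1, 0) (1, 0))])"

definition mcup2 :: "Kq \<Rightarrow> (vec, vec) tens" where
  "mcup2 a = ascal V22 a (lincomb V22 [
     (qv powi (- 6), t2 (0, 1) (0, - 1)),
     (- (qv powi (- 4)), t2 (2, - 1) (- 2, 1)),
     (qv powi (- 2) / qn 2, t2 (0, 0) (0, 0)),
     (- (qv powi (- 2)), t2 (- 2, 1) (2, - 1)),
     (1, t2 (0, - 1) (0, 1))])"

definition mcap :: "((weight \<times> weight) \<times> Kq) list \<Rightarrow> (vec, vec) tens \<Rightarrow> Kq" where
  "mcap l = tlift uunit (\<lambda>x y. \<Sum>k\<in>Poly_Mapping.keys x. \<Sum>m\<in>Poly_Mapping.keys y.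
     Poly_Mapping.lookup x k * Poly_Mapping.lookup y m * tabled l (hd k, hd m))"

definition mcap1 :: "(vec, vec) tens \<Rightarrow> Kq" where
  "mcap1 = mcap [
     (((1, 0), (- 1, 0)), 1),
     (((- 1, 1), (1, - 1)), - qv),
     (((1, - 1), (- 1, 1)), qv ^ 3),
     (((- 1, 0), (1, 0)), - (qv ^ 4))]"

definition mcap2 :: "(vec, vec) tens \<Rightarrow> Kq" where
  "mcap2 = mcap [
     (((0, 1), (0, - 1)), 1),
     (((2, - 1), (- 2, 1)), - (qv ^ 2)),
     (((0, 0), (0, 0)), qv ^ 2 * qn 2),
     (((- 2, 1), (2, - 1)), - (qv ^ 4)),
     (((0, - 1), (0, 1)), qv ^ 6)]"

definition mi_basis :: "weight \<Rightarrow> (Kq \<times> (vec, vec) tens) list" where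
  "mi_basis w =
    (if w = (0, 1) then
       [(inverse qv, t1 (1, 0) (- 1, 1)), (- 1, t1 (- 1, 1) (1, 0))]
     else if w = (2, - 1) then
       [(inverse qv, t1 (1, 0) (1, - 1)), (- 1, t1 (1, - 1) (1, 0))]
     else if w = (0, 0) then
       [(inverse qv, t1 (1, 0) (- 1, 0)), (qv powi (- 2), t1 (- 1, 1) (1, - 1)),
        (- 1, t1 (1, - 1) (- 1, 1)), (- inverse qv, t1 (- 1, 0) (1, 0))]
     else if w = (- 2, 1) then
       [(inverse qv, t1 (- 1, 1) (- 1, 0)), (- 1, t1 (- 1, 0) (- 1, 1))]
     else if w = (0, - 1) then
       [(inverse qv, t1 (1, - 1) (- 1, 0)), (- 1, t1 (- 1, 0) (1, - 1))]
     else [])"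

definition mi :: "vec \<Rightarrow> (vec, vec) tens" where
  "mi x = (\<Oplus>\<^bsub>V11\<^esub>k\<in>Poly_Mapping.keys x.
     ascal V11 (Poly_Mapping.lookup x k) (lincomb V11 (mi_basis (hd k))))"

definition mp_table :: "((weight \<times> weight) \<times> vec) list" where
  "mp_table = [
     (((1, 0), (- 1, 1)), vscale (- 1) (vb 0 1)),
     (((- 1, 1), (1, 0)), vscale qv (vb 0 1)),
     (((1, 0), (1, - 1)), vscale (- 1) (vb 2 (- 1))),
     (((1, - 1), (1, 0)), vscale qv (vb 2 (- 1))),
     (((1, 0), (- 1, 0)), vscale (- qv / qn 2) (vb 0 0)),
     (((- 1, 1), (1, - 1)), vscale (- 1 / qn 2) (vb 0 0)),
     (((1, - 1), (- 1, 1)), vscale (qv ^ 2 / qn 2) (vb 0 0)),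
     (((- 1, 0), (1, 0)), vscale (qv / qn 2) (vb 0 0)),
     (((- 1, 1), (- 1, 0)), vscale (- 1) (vb (- 2) 1)),
     (((- 1, 0), (- 1, 1)), vscale qv (vb (- 2) 1)),
     (((1, - 1), (- 1, 0)), vscale (- 1) (vb 0 (- 1))),
     (((- 1, 0), (1, - 1)), vscale qv (vb 0 (- 1)))]"

definition mp :: "(vec, vec) tens \<Rightarrow> vec" where
  "mp = tlift V2 (\<lambda>x y. \<Sum>k\<in>Poly_Mapping.keys x. \<Sum>m\<in>Poly_Mapping.keys y.
     vscale (Poly_Mapping.lookup x k * Poly_Mapping.lookup y m) (tabled mp_table (hd k, hd m)))"

end

theory Submission
  imports Defs
begin

text \<open>The idea is to turn diagrams into matrices. The two fundamental modules have bases of weight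
  vectors and no weight in common, so the tensor product belonging to an object
  \<open>c\<^sub>1 \<dots> c\<^sub>n\<close> of the diagrammatic category can be realised as the free \<open>\<A>\<close>-module on the
  words of weights whose \<open>i\<close>-th letter is a weight of the \<open>c\<^sub>i\<close>-th module (\<open>Xi0\<close>). Tensor products
  of vectors become concatenations of words (\<open>conc\<close>), which makes the monoidal structure strictly
  associative on words, and a diagram becomes the linear map \<open>dmat\<close> that is put together from the
  given values on generators. Three things have to be shown.

  First, words form a module over the quantum group and over its integral form. The generators act
  on words through the coproduct, and a relation that holds on single letters holds on all words as
  soon as the coproduct sends it to zero in \<open>U \<otimes> U\<close> (\<open>piD_urels\<close>, \<open>Act_uideal\<close>). The hard case is
  that of the Serre relations: both summands of \<open>\<Delta>(E) = E \<otimes> 1 + K \<otimes> E\<close> satisfy them and the summands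
  \<open>q\<close>-commute, and this is enough for the sum to satisfy them (\<open>qserre_add\<close>). The action of the
  integral form on a tensor product is given by a decomposition of the coproduct inside the integral
  form. Such a decomposition exists by the \<open>q\<close>-binomial theorem for divided powers (\<open>qbinomial\<close>,
  \<open>UA_coproduct\<close>), and by the same decomposition the \<open>\<A>\<close>-span of the words is stable (\<open>Act_Aspan\<close>).

  Secondly, the tensor product, a quotient of a free abelian group, has to be
  identified with the module on concatenated words. Its universal property (\<open>tlift_pure\<close>) gives a
  map to words, and cutting words in two gives the inverse (\<open>mu_inverse\<close>). The coherence
  conditions of a monoidal functor can then be compared on pure tensors, where both sides are
  the same concatenation.

  Thirdly, the matrices satisfy the relations between diagrams and commute with the quantum
  group. For the generators and the defining relations this is a computation with rational functions
  in \<open>q\<close> on finitely many words (\<open>dmat_drels\<close>, \<open>gmat_gact\<close>). It extends to all diagrams because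
  matrices themselves obey the laws of a linear monoidal category (\<open>deq_dmat\<close>, \<open>dmat_Act\<close>).\<close>


section \<open>Scalars\<close>

lemma ring_of_ring_1: "ring (ring_of_type_algebra :: 'a::ring_1 ring)"
proof -
  have "\<exists>y. y + x = 0 \<and> x + y = 0" for x :: 'a
    by (intro exI[of _ "- x"]) simp
  thus ?thesis
    unfolding ring_of_type_algebra_def
    by unfold_locales (auto simp: algebra_simps Units_def)
qed

lemma ring_of_simps [simp]:
  "carrier (ring_of_type_algebra :: 'a::ring_1 ring) = UNIV"
  "x \<otimes>\<^bsub>(ring_of_type_algebra :: 'a::ring_1 ring)\<^esub> y = x * y"
  "\<one>\<^bsub>(ring_of_type_algebra :: 'a::ring_1 ring)\<^esub> = 1"
  "\<zero>\<^bsub>(ring_of_type_algebra :: 'a::ring_1 ring)\<^esub> = 0"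
  "x \<oplus>\<^bsub>(ring_of_type_algebra :: 'a::ring_1 ring)\<^esub> y = x + y"
  by (simp_all add: ring_of_type_algebra_def)

lemma ring_of_a_inv [simp]: "\<ominus>\<^bsub>(ring_of_type_algebra :: 'a::ring_1 ring)\<^esub> x = - x"
proof -
  interpret ring "ring_of_type_algebra :: 'a ring" by (rule ring_of_ring_1)
  show ?thesis using minus_equality[of "- x" x] by simp
qed

lemma qv_nonzero [simp]: "qv \<noteq> 0"
  by (simp add: qv_def Zero_fract_def eq_fract)

lemma qv_power: "qv ^ n = Fract (monom 1 n) 1"
proof (induction n)
  case (Suc n)
  then show ?case by (simp add: qv_def monom_Suc)
qed (simp add: One_fract_def)

lemma qv_power_neq_1: "n > 0 \<Longrightarrow> qv ^ n \<noteq> 1"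
  by (simp add: qv_power One_fract_def eq_fract)
    (metis degree_1 degree_monom_eq less_numeral_extra(3) one_neq_zero)

lemma qv_power2_neq_1 [simp]: "qv ^ 2 \<noteq> 1" "qv * qv \<noteq> 1"
  using qv_power_neq_1[of 2] by (auto simp: power2_eq_square)

lemma qint_nonzero:
  assumes b: "b \<noteq> 0" "\<And>k. k > 0 \<Longrightarrow> b ^ k \<noteq> 1" and n: "n > 0"
  shows "qint b n \<noteq> 0"
proof -
  have *: "b ^ k - inverse b ^ k \<noteq> 0" if "k > 0" for k
  proof
    assume "b ^ k - inverse b ^ k = 0"
    hence "b ^ k = inverse (b ^ k)" by (simp add: power_inverse)
    hence "b ^ k * b ^ k = 1" using b(1) by (metis power_not_zero right_inverse)
    hence "b ^ (k + k) = 1" by (simp add: power_add)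
    thus False using b(2)[of "k + k"] that by simp
  qed
  show ?thesis using *[OF n] *[of 1] by (simp add: qint_def)
qed

lemma qroot_power_neq_1: "n > 0 \<Longrightarrow> qroot a ^ n \<noteq> 1"
  by (cases a) (auto simp: qv_power_neq_1 simp flip: power_mult)

lemma qroot_nonzero [simp]: "qroot a \<noteq> 0"
  by (cases a) auto

lemma qfact_nonzero: "qfact (qroot a) n \<noteq> 0"
  using qint_nonzero[OF qroot_nonzero qroot_power_neq_1] by (auto simp: qfact_def)

lemma qn_nonzero: "n > 0 \<Longrightarrow> qn n \<noteq> 0"
  by (rule qint_nonzero) (auto simp: qv_power_neq_1)

text \<open>All quantum integers that occur are Laurent polynomials in \<open>q\<close>; clearing the denominator
  \<open>q - q\<inverse>\<close> once and for all leaves \<open>q\<close> and \<open>q\<^sup>2 + 1\<close> as the only denominators in the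
  computations below.\<close>

lemma qv_sq_plus_1 [simp]: "qv * qv + 1 \<noteq> 0" "1 + qv * qv \<noteq> 0" "qv ^ 2 + 1 \<noteq> 0" "1 + qv ^ 2 \<noteq> 0"
proof -
  have "qv ^ 4 \<noteq> 1" by (rule qv_power_neq_1) simp
  moreover have "qv ^ 4 - 1 = (qv * qv + 1) * (qv * qv - 1)" by (simp add: algebra_simps power4_eq_xxxx)
  ultimately show *: "qv * qv + 1 \<noteq> 0" by auto
  thus "1 + qv * qv \<noteq> 0" "qv ^ 2 + 1 \<noteq> 0" "1 + qv ^ 2 \<noteq> 0"
    by (simp_all add: power2_eq_square add.commute)
qed

lemma qv_diff_inverse_nonzero: "qv - inverse qv \<noteq> 0"
  by (simp add: field_simps)

lemma qn_2: "qn 2 = (qv * qv + 1) / qv"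
proof -
  have "(qv * qv + 1) / qv * (qv - inverse qv) = qv ^ 2 - inverse qv ^ 2"
    by (simp add: field_simps power2_eq_square)
  thus ?thesis using qv_diff_inverse_nonzero by (simp add: qint_def field_simps)
qed

lemma qn_3: "qn 3 = qv ^ 2 + 1 + inverse qv ^ 2"
proof -
  have "(qv ^ 2 + 1 + inverse qv ^ 2) * (qv - inverse qv) = qv ^ 3 - inverse qv ^ 3"
    by (simp add: field_simps power2_eq_square power3_eq_cube)
  thus ?thesis using qv_diff_inverse_nonzero by (simp add: qint_def field_simps)
qed

lemma qint_4_over_2: "qn 4 / qn 2 = qv ^ 2 + inverse qv ^ 2"
proof -
  have 1: "qv ^ 4 - inverse qv ^ 4 = (qv ^ 2 - inverse qv ^ 2) * (qv ^ 2 + inverse qv ^ 2)"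
    by (simp add: algebra_simps flip: power_add)
  have "qn 4 = qn 2 * (qv ^ 2 + inverse qv ^ 2)" unfolding qint_def 1 by simp
  thus ?thesis using qn_nonzero[of 2] by simp
qed

lemma Aring_simps [simp]:
  "\<one>\<^bsub>Aring\<^esub> = 1" "\<zero>\<^bsub>Aring\<^esub> = 0" "x \<otimes>\<^bsub>Aring\<^esub> y = x * y" "x \<oplus>\<^bsub>Aring\<^esub> y = x + y"
  by (simp_all add: Aring_def)

lemma Aset_eq: "Aset = generate_ring ring_of_type_algebra {qv, inverse qv, inverse (qn 2)}"
  by (simp add: Aring_def)

lemma Aset_1 [simp, intro]: "1 \<in> Aset"
  using generate_ring.one[of "ring_of_type_algebra :: Kq ring"] unfolding Aset_eq by simp

lemma Aset_minus [simp, intro]: "a \<in> Aset \<Longrightarrow> - a \<in> Aset"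
  using generate_ring.a_inv[of _ "ring_of_type_algebra :: Kq ring"] unfolding Aset_eq by fastforce

lemma Aset_add [simp, intro]: "a \<in> Aset \<Longrightarrow> b \<in> Aset \<Longrightarrow> a + b \<in> Aset"
  using generate_ring.eng_add[of _ "ring_of_type_algebra :: Kq ring"] unfolding Aset_eq by fastforce

lemma Aset_mult [simp, intro]: "a \<in> Aset \<Longrightarrow> b \<in> Aset \<Longrightarrow> a * b \<in> Aset"
  using generate_ring.eng_mult[of _ "ring_of_type_algebra :: Kq ring"] unfolding Aset_eq by fastforce

lemma Aset_0 [simp, intro]: "0 \<in> Aset"
  using Aset_add[OF Aset_1 Aset_minus[OF Aset_1]] by simp

lemma Aset_power [simp, intro]: "a \<in> Aset \<Longrightarrow> a ^ n \<in> Aset"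
  by (induction n) auto

lemma Aset_gens [simp, intro]: "qv \<in> Aset" "inverse qv \<in> Aset" "inverse (qn 2) \<in> Aset"
  unfolding Aset_eq by (auto intro: generate_ring.incl)

lemma Aset_powi [simp, intro]: "qv powi k \<in> Aset"
  by (auto simp: power_int_def)

lemma Aset_qn_2 [simp, intro]: "qn 2 \<in> Aset"
proof -
  have "qn 2 = qv + inverse qv" by (simp add: qn_2 field_simps)
  thus ?thesis by simp
qed

lemma Aset_divide_qn_2 [simp, intro]: "a \<in> Aset \<Longrightarrow> a / qn 2 \<in> Aset"
  by (simp add: divide_inverse)

lemma Aring_cring: "cring Aring"
proof -
  interpret R: cring "ring_of_type_algebra :: Kq ring" by (rule cring_from_type_algebra)
  have "subcring Aset ring_of_type_algebra"
    unfolding Aset_eq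
    by (intro R.subcringI' R.generate_ring_is_subring) simp
  thus ?thesis unfolding Aring_def
    using R.subcring_iff[of Aset] by (simp add: Aring_def)
qed


section \<open>Linear algebra on finitely supported functions\<close>

abbreviation supp :: "('a \<Rightarrow>\<^sub>0 'b::zero) \<Rightarrow> 'a set" where "supp \<equiv> Poly_Mapping.keys"
abbreviation coef :: "('a \<Rightarrow>\<^sub>0 'b::zero) \<Rightarrow> 'a \<Rightarrow> 'b" where "coef \<equiv> Poly_Mapping.lookup"
abbreviation sng :: "'a \<Rightarrow> 'b::zero \<Rightarrow> ('a \<Rightarrow>\<^sub>0 'b)" where "sng \<equiv> Poly_Mapping.single"

text \<open>Scalar multiplication for functions on any index type; on vectors it is \<open>vscale\<close>.\<close>

definition psc :: "Kq \<Rightarrow> ('a \<Rightarrow>\<^sub>0 Kq) \<Rightarrow> ('a \<Rightarrow>\<^sub>0 Kq)" where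
  "psc c x = Poly_Mapping.map ((*) c) x"

lemma vscale_psc: "vscale = psc"
  by (simp add: fun_eq_iff vscale_def psc_def)

lemma coef_psc [simp]: "coef (psc c x) k = c * coef x k"
  by (simp add: psc_def Poly_Mapping.map.rep_eq when_def)

lemma psc_simps [simp]:
  "psc c 0 = 0" "psc 0 x = 0" "psc 1 x = x"
  "psc c (sng k a) = sng k (c * a)"
  by (rule poly_mapping_eqI; simp add: lookup_single when_def)+

lemma psc_add: "psc c (x + y) = psc c x + psc c y"
  and psc_add_left: "psc (c + d) x = psc c x + psc d x"
  and psc_diff: "psc c (x - y) = psc c x - psc c y"
  and psc_diff_left: "psc (c - d) x = psc c x - psc d x"
  and psc_minus: "psc c (- x) = - psc c x"
  and psc_minus_left: "psc (- c) x = - psc c x"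
  and psc_psc: "psc c (psc d x) = psc (c * d) x"
  by (rule poly_mapping_eqI; simp add: lookup_add lookup_minus algebra_simps)+

lemma psc_neg1: "psc (- 1) x = - x"
  by (simp add: psc_minus_left)

lemma psc_sum: "psc c (sum f I) = (\<Sum>i\<in>I. psc c (f i))"
  by (induction I rule: infinite_finite_induct) (auto simp: psc_add)

lemma supp_psc: "supp (psc c x) \<subseteq> supp x"
  by (auto simp: in_keys_iff)

lemma pm_expand: "finite A \<Longrightarrow> supp x \<subseteq> A \<Longrightarrow> x = (\<Sum>k\<in>A. sng k (coef x k))"
  by (rule poly_mapping_eqI)
    (auto simp: lookup_sum lookup_single when_def in_keys_iff)

lemma pm_induct [consumes 1, case_names zero single add]:
  assumes "supp x \<subseteq> A" "P 0" "\<And>k c. k \<in> A \<Longrightarrow> P (sng k c)"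
    "\<And>x y. supp x \<subseteq> A \<Longrightarrow> supp y \<subseteq> A \<Longrightarrow> P x \<Longrightarrow> P y \<Longrightarrow> P (x + y)"
  shows "P (x :: 'a \<Rightarrow>\<^sub>0 'b::comm_monoid_add)"
proof -
  have "supp (\<Sum>k\<in>I. sng k (coef x k)) \<subseteq> A \<and> P (\<Sum>k\<in>I. sng k (coef x k))"
    if "finite I" "I \<subseteq> A" for I
    using that
  proof (induction I)
    case (insert k I)
    let ?y = "\<Sum>k\<in>I. sng k (coef x k)"
    have s: "supp (sng k (coef x k)) \<subseteq> A" using insert.prems by simp
    have y: "supp ?y \<subseteq> A" "P ?y" using insert.IH insert.prems by blast+
    have "P (sng k (coef x k) + ?y)"
      using s y insert.prems by (intro assms(4) assms(3)) auto
    moreover have "supp (sng k (coef x k) + ?y) \<subseteq> A"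
      by (rule order_trans[OF keys_add]) (use s y in simp)
    ultimately show ?case using insert.hyps by simp
  qed (simp add: assms(2))
  from this[OF finite_keys assms(1)] show ?thesis
    using pm_expand[OF finite_keys order_refl, of x] by simp
qed

lemmas pm_induct_UNIV = pm_induct[OF subset_UNIV, case_names zero single add]

text \<open>The linear map with given values on basis vectors.\<close>

definition plin :: "('k \<Rightarrow> ('a \<Rightarrow>\<^sub>0 Kq)) \<Rightarrow> ('k \<Rightarrow>\<^sub>0 Kq) \<Rightarrow> ('a \<Rightarrow>\<^sub>0 Kq)" where
  "plin h x = (\<Sum>k\<in>supp x. psc (coef x k) (h k))"

lemma plin_superset:
  assumes "finite A" "supp x \<subseteq> A"
  shows "plin h x = (\<Sum>k\<in>A. psc (coef x k) (h k))"
  unfolding plin_def using assms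
  by (intro sum.mono_neutral_left) (auto simp: in_keys_iff)

lemma plin_add: "plin h (x + y) = plin h x + plin h y"
proof -
  let ?A = "supp x \<union> supp y"
  have "plin h (x + y) = (\<Sum>k\<in>?A. psc (coef (x + y) k) (h k))"
    by (rule plin_superset) (use keys_add[of x y] in auto)
  also have "\<dots> = (\<Sum>k\<in>?A. psc (coef x k) (h k)) + (\<Sum>k\<in>?A. psc (coef y k) (h k))"
    by (simp add: lookup_add psc_add_left sum.distrib)
  also have "\<dots> = plin h x + plin h y"
    by (simp add: plin_superset[of ?A x] plin_superset[of ?A y])
  finally show ?thesis .
qed

lemma plin_single [simp]: "plin h (sng k c) = psc c (h k)"
  by (simp add: plin_def)

lemma plin_zero [simp]: "plin h 0 = 0"
  by (simp add: plin_def)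

lemma plin_psc: "plin h (psc c x) = psc c (plin h x)"
  using plin_superset[of "supp x" "psc c x" h] supp_psc[of c x]
  by (simp add: plin_def[of h x] psc_sum psc_psc)

lemma plin_minus: "plin h (- x) = - plin h x"
  using plin_psc[of h "- 1" x] by (simp add: psc_neg1)

lemma plin_diff: "plin h (x - y) = plin h x - plin h y"
  using plin_add[of h x "- y"] by (simp add: plin_minus)

lemma plin_sum: "plin h (sum f I) = (\<Sum>i\<in>I. plin h (f i))"
  by (induction I rule: infinite_finite_induct) (auto simp: plin_add)

lemma plin_cong: "(\<And>k. k \<in> supp x \<Longrightarrow> f k = g k) \<Longrightarrow> plin f x = plin g x"
  by (simp add: plin_def)

lemma plin_fun_add: "plin (\<lambda>k. f k + g k) x = plin f x + plin g x"
  by (simp add: plin_def psc_add sum.distrib)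

lemma plin_fun_psc: "plin (\<lambda>k. psc c (f k)) x = psc c (plin f x)"
  by (simp add: plin_def psc_psc psc_sum mult.commute)

lemma plin_fun_zero [simp]: "plin (\<lambda>k. 0) x = 0"
  by (simp add: plin_def)

lemma plin_plin: "plin f (plin g x) = plin (\<lambda>k. plin f (g k)) x"
  by (simp add: plin_def[of "\<lambda>k. plin f (g k)"] plin_def[of g] plin_sum plin_psc)

lemma plin_id [simp]: "plin (\<lambda>k. sng k 1) x = x"
  using pm_expand[OF finite_keys order_refl, of x] by (simp add: plin_def)

lemma plin_swap: "plin (\<lambda>k. plin (h k) y) x = plin (\<lambda>m. plin (\<lambda>k. h k m) x) y"
  unfolding plin_def psc_sum
  by (subst sum.swap) (simp add: psc_psc mult.commute)

definition Qspan :: "'a set \<Rightarrow> ('a \<Rightarrow>\<^sub>0 Kq) set" where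
  "Qspan B = {x. supp x \<subseteq> B}"

definition Aspan :: "'a set \<Rightarrow> ('a \<Rightarrow>\<^sub>0 Kq) set" where
  "Aspan B = {x. supp x \<subseteq> B \<and> range (coef x) \<subseteq> Aset}"

lemma Aspan_Qspan: "x \<in> Aspan B \<Longrightarrow> x \<in> Qspan B"
  by (simp add: Aspan_def Qspan_def)

lemma Aspan_coef: "x \<in> Aspan B \<Longrightarrow> coef x k \<in> Aset"
  by (auto simp: Aspan_def)

lemma Aspan_supp: "x \<in> Aspan B \<Longrightarrow> k \<in> supp x \<Longrightarrow> k \<in> B"
  by (auto simp: Aspan_def)

lemma AspanI: "supp x \<subseteq> B \<Longrightarrow> (\<And>k. k \<in> B \<Longrightarrow> coef x k \<in> Aset) \<Longrightarrow> x \<in> Aspan B"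
  by (auto simp: Aspan_def) (metis Aset_0 in_keys_iff subsetD)

lemma Aspan_zero [simp, intro]: "0 \<in> Aspan B"
  by (simp add: Aspan_def)

lemma Aspan_single [intro]: "k \<in> B \<Longrightarrow> c \<in> Aset \<Longrightarrow> sng k c \<in> Aspan B"
  by (rule AspanI) (auto simp: lookup_single when_def)

lemma Aspan_add [intro]: "x \<in> Aspan B \<Longrightarrow> y \<in> Aspan B \<Longrightarrow> x + y \<in> Aspan B"
  by (rule AspanI) (use keys_add[of x y] in \<open>auto simp: lookup_add Aspan_coef dest: Aspan_supp\<close>)

lemma Aspan_psc [intro]: "c \<in> Aset \<Longrightarrow> x \<in> Aspan B \<Longrightarrow> psc c x \<in> Aspan B"
  by (rule AspanI) (use supp_psc[of c x] in \<open>auto simp: Aspan_coef dest: Aspan_supp\<close>)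

lemma Aspan_minus [intro]: "x \<in> Aspan B \<Longrightarrow> - x \<in> Aspan B"
  using Aspan_psc[of "- 1" x B] by (simp add: psc_neg1)

lemma Aspan_sum: "(\<And>i. i \<in> I \<Longrightarrow> f i \<in> Aspan B) \<Longrightarrow> sum f I \<in> Aspan B"
  by (induction I rule: infinite_finite_induct) auto

lemma Aspan_plin:
  assumes "x \<in> Aspan B" "\<And>k. k \<in> B \<Longrightarrow> h k \<in> Aspan D"
  shows "plin h x \<in> Aspan D"
  unfolding plin_def using assms by (intro Aspan_sum Aspan_psc) (auto simp: Aspan_def)

lemma Qspan_zero [simp, intro]: "0 \<in> Qspan B"
  by (simp add: Qspan_def)

lemma Qspan_single [intro]: "k \<in> B \<Longrightarrow> sng k c \<in> Qspan B"
  by (simp add: Qspan_def)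

lemma Qspan_add [intro]: "x \<in> Qspan B \<Longrightarrow> y \<in> Qspan B \<Longrightarrow> x + y \<in> Qspan B"
  using keys_add[of x y] by (auto simp: Qspan_def)

lemma Qspan_psc [intro]: "x \<in> Qspan B \<Longrightarrow> psc c x \<in> Qspan B"
  using supp_psc[of c x] by (auto simp: Qspan_def)

lemma Qspan_sum: "(\<And>i. i \<in> I \<Longrightarrow> f i \<in> Qspan B) \<Longrightarrow> sum f I \<in> Qspan B"
  by (induction I rule: infinite_finite_induct) auto

lemma Qspan_plin:
  assumes "x \<in> Qspan B" "\<And>k. k \<in> B \<Longrightarrow> h k \<in> Qspan D"
  shows "plin h x \<in> Qspan D"
  unfolding plin_def using assms by (intro Qspan_sum Qspan_psc) (auto simp: Qspan_def)

lemma plin_eqI: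
  assumes "x \<in> Qspan B" "\<And>k. k \<in> B \<Longrightarrow> f k = g k"
  shows "plin f x = plin g x"
  using assms by (intro plin_cong) (auto simp: Qspan_def)

text \<open>Tensor products of vectors become concatenation of words.\<close>

definition conc :: "vec \<Rightarrow> vec \<Rightarrow> vec" where
  "conc x y = plin (\<lambda>k. plin (\<lambda>m. sng (k @ m) 1) y) x"

lemma conc_single [simp]: "conc (sng k a) (sng m b) = sng (k @ m) (a * b)"
  by (simp add: conc_def)

lemma conc_add_left: "conc (x + x') y = conc x y + conc x' y"
  and conc_psc_left: "conc (psc c x) y = psc c (conc x y)"
  and conc_sum_left: "conc (sum f I) y = (\<Sum>i\<in>I. conc (f i) y)"
  and conc_minus_left: "conc (- x) y = - conc x y"
  and conc_zero_left [simp]: "conc 0 y = 0"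
  by (simp_all add: conc_def plin_add plin_psc plin_sum plin_minus)

lemma conc_add_right: "conc x (y + y') = conc x y + conc x y'"
  and conc_psc_right: "conc x (psc c y) = psc c (conc x y)"
  and conc_zero_right [simp]: "conc x 0 = 0"
  by (simp_all add: conc_def plin_add plin_psc plin_fun_add plin_fun_psc)

lemma conc_plin_left: "conc (plin f x) y = plin (\<lambda>k. conc (f k) y) x"
  by (simp add: conc_def plin_plin)

lemma conc_plin_right: "conc x (plin f y) = plin (\<lambda>k. conc x (f k)) y"
  unfolding conc_def plin_plin by (rule plin_swap)

lemma conc_assoc: "conc (conc x y) z = conc x (conc y z)"
proof -
  have "conc (conc x y) z = plin (\<lambda>k. plin (\<lambda>m. plin (\<lambda>n. sng (k @ m @ n) 1) z) y) x"
    by (simp add: conc_def plin_plin)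
  also have "\<dots> = conc x (conc y z)"
    by (simp add: conc_def plin_plin)
  finally show ?thesis .
qed

lemma plin_single_const: "plin (\<lambda>k. sng k c) x = psc c x"
  using plin_fun_psc[of c "\<lambda>k. sng k 1" x] by simp

lemma conc_Nil_left [simp]: "conc (sng [] c) x = psc c x"
  by (simp add: conc_def)

lemma conc_Nil_right [simp]: "conc x (sng [] c) = psc c x"
  by (simp add: conc_def plin_single_const)

lemma plin_conc:
  assumes "\<And>k m. k \<in> supp x \<Longrightarrow> m \<in> supp y \<Longrightarrow> f (k @ m) = h k m"
  shows "plin f (conc x y) = plin (\<lambda>k. plin (\<lambda>m. h k m) y) x"
  unfolding conc_def plin_plin
  by (intro plin_cong) (simp add: assms)

definition catset :: "'a list set \<Rightarrow> 'a list set \<Rightarrow> 'a list set" where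
  "catset B D = {k @ m | k m. k \<in> B \<and> m \<in> D}"

lemma Aspan_conc: "x \<in> Aspan B \<Longrightarrow> y \<in> Aspan D \<Longrightarrow> conc x y \<in> Aspan (catset B D)"
  unfolding conc_def by (intro Aspan_plin[where B = B] Aspan_plin[where B = D]) (auto simp: catset_def)


section \<open>The free algebra acting on words of weights\<close>

text \<open>The hypothesis under which \<open>fext\<close> is a homomorphism of algebras: words can be multiplied only after
  the scalars in between have been moved to the front.\<close>

locale central_scalars =
  fixes c :: "Kq \<Rightarrow> 'b::ring_1"
  assumes c_add: "c (a + b) = c a + c b"
    and c_mult: "c (a * b) = c a * c b"
    and c_one: "c 1 = 1"
    and c_central: "c a * y = y * c a"
begin

lemma c_zero: "c 0 = 0"
  using c_add[of 0 0] by simp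

lemma fext_superset:
  assumes "finite A" "supp x \<subseteq> A"
  shows "fext c g x = (\<Sum>w\<in>A. c (coef x w) * prod_list (map g (letters w)))"
  unfolding fext_def using assms
  by (intro sum.mono_neutral_left) (auto simp: in_keys_iff c_zero)

lemma fext_zero: "fext c g 0 = 0"
  by (simp add: fext_def)

lemma fext_single: "fext c g (sng w a) = c a * prod_list (map g (letters w))"
  by (simp add: fext_def c_zero)

lemma fext_add: "fext c g (x + y) = fext c g x + fext c g y"
proof -
  let ?A = "supp x \<union> supp y"
  have "fext c g (x + y) = (\<Sum>w\<in>?A. c (coef (x + y) w) * prod_list (map g (letters w)))"
    by (rule fext_superset) (use keys_add[of x y] in auto)
  also have "\<dots> = fext c g x + fext c g y"
    by (simp add: fext_superset[of ?A x] fext_superset[of ?A y] lookup_add c_add distrib_right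
        sum.distrib)
  finally show ?thesis .
qed

lemma fext_minus: "fext c g (- x) = - fext c g x"
  using fext_add[of g "- x" x] by (simp add: fext_zero eq_neg_iff_add_eq_0)

lemma fext_diff: "fext c g (x - y) = fext c g x - fext c g y"
  using fext_add[of g x "- y"] by (simp add: fext_minus)

lemma fext_cst: "fext c g (cst a) = c a"
  by (simp add: fext_single zero_fmon_def)

lemma fext_fgen: "fext c g (fgen x) = g x"
  by (simp add: fgen_def fext_single c_one)

lemma fext_mult: "fext c g (x * y) = fext c g x * fext c g y"
proof (induction x rule: pm_induct_UNIV)
  case (single v a)
  show ?case
  proof (induction y rule: pm_induct_UNIV)
    case (single w b)
    have "fext c g (sng v a) * fext c g (sng w b)
        = c a * (prod_list (map g (letters v)) * c b) * prod_list (map g (letters w))"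
      by (simp add: fext_single mult.assoc)
    also have "\<dots> = c (a * b) * prod_list (map g (letters v)) * prod_list (map g (letters w))"
      by (simp only: c_central[of b "prod_list (map g (letters v))", symmetric] c_mult mult.assoc)
    also have "\<dots> = fext c g (sng v a * sng w b)"
      by (simp add: mult_single fext_single plus_fmon_def mult.assoc)
    finally show ?case by simp
  qed (simp_all add: fext_zero distrib_left fext_add)
qed (simp_all add: fext_zero distrib_right fext_add)

lemma fext_one: "fext c g 1 = 1"
  using fext_cst[of g 1] by (simp add: c_one)

lemma fext_power: "fext c g (x ^ n) = fext c g x ^ n"
  by (induction n) (simp_all add: fext_one fext_mult)

lemmas fext_hom = fext_add fext_diff fext_minus fext_mult fext_one fext_zero fext_power
  fext_cst fext_fgen

end

lemma cst_central: "cst a * y = y * cst a"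
  by (induction y rule: pm_induct_UNIV) (simp_all add: mult_single distrib_left distrib_right mult.commute)

global_interpretation cst: central_scalars "cst :: Kq \<Rightarrow> 'a::monoid_add \<Rightarrow>\<^sub>0 Kq"
  by standard (simp_all add: single_add mult_single cst_central)

global_interpretation ident: central_scalars "\<lambda>a. a"
  by standard simp_all

text \<open>The two fundamental modules have no weight in common, so a weight remembers which of them
  it belongs to and a single action on words of weights covers all tensor products at once.\<close>

definition wrho :: "ugen \<Rightarrow> weight \<Rightarrow> vec" where
  "wrho g x = (if x \<in> {(1, 0), (- 1, 1), (1, - 1), (- 1, 0)} then rho1 g x else rho2 g x)"

text \<open>The empty word spans the trivial module, and a longer word is the tensor product of its first letter
  with the rest: the clauses are the counit and the coproducts of the generators.\<close>

fun ga :: "ugen \<Rightarrow> weight list \<Rightarrow> vec" where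
  "ga g [] = sng [] (counit_gen g)"
| "ga (E a) (x # k) = conc (wrho (E a) x) (sng k 1) + conc (wrho (K a) x) (ga (E a) k)"
| "ga (F a) (x # k) = conc (wrho (F a) x) (ga (Kinv a) k) + conc (sng [x] 1) (ga (F a) k)"
| "ga (K a) (x # k) = conc (wrho (K a) x) (ga (K a) k)"
| "ga (Kinv a) (x # k) = conc (wrho (Kinv a) x) (ga (Kinv a) k)"

abbreviation gact :: "ugen \<Rightarrow> vec \<Rightarrow> vec" where "gact g \<equiv> plin (ga g)"

lemma ga_singleton: "ga g [x] = wrho g x"
  by (cases g) simp_all

text \<open>Coassociativity: the rule for splitting off the first letter holds for every cut of a word.\<close>

lemma ga_append:
  "ga (K a) (k @ m) = conc (ga (K a) k) (ga (K a) m)"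
  "ga (Kinv a) (k @ m) = conc (ga (Kinv a) k) (ga (Kinv a) m)"
  "ga (E a) (k @ m) = conc (ga (E a) k) (sng m 1) + conc (ga (K a) k) (ga (E a) m)"
  "ga (F a) (k @ m) = conc (ga (F a) k) (ga (Kinv a) m) + conc (sng k 1) (ga (F a) m)"
proof -
  show K: "ga (K a) (k @ m) = conc (ga (K a) k) (ga (K a) m)"
    and L: "ga (Kinv a) (k @ m) = conc (ga (Kinv a) k) (ga (Kinv a) m)" for k
    by (induction k) (simp_all add: conc_assoc)
  show "ga (E a) (k @ m) = conc (ga (E a) k) (sng m 1) + conc (ga (K a) k) (ga (E a) m)"
    by (induction k) (simp_all add: conc_assoc conc_add_left conc_add_right algebra_simps)
  show "ga (F a) (k @ m) = conc (ga (F a) k) (ga (Kinv a) m) + conc (sng k 1) (ga (F a) m)"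
  proof (induction k)
    case (Cons x k)
    have "conc (sng (x # k) 1) y = conc (sng [x] 1) (conc (sng k 1) y)" for y
      by (simp flip: conc_assoc)
    thus ?case
      using Cons by (simp add: L conc_assoc conc_add_left conc_add_right add.assoc)
  qed simp
qed

lemma plin_append_eq:
  assumes "\<And>k m. f (k @ m) = conc (g k) (h m)"
  shows "plin f (conc x y) = conc (plin g x) (plin h y)"
  by (subst plin_conc[where f = f, OF assms]) (simp only: conc_plin_left, simp only: conc_plin_right)

lemma plin_append_eq2:
  assumes "\<And>k m. f (k @ m) = conc (g k) (h m) + conc (g' k) (h' m)"
  shows "plin f (conc x y) = conc (plin g x) (plin h y) + conc (plin g' x) (plin h' y)"
  by (subst plin_conc[where f = f, OF assms]) (simp only: conc_plin_left plin_fun_add, simp only: conc_plin_right plin_fun_add)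

lemma gact_conc:
  "gact (K a) (conc x y) = conc (gact (K a) x) (gact (K a) y)"
  "gact (Kinv a) (conc x y) = conc (gact (Kinv a) x) (gact (Kinv a) y)"
  "gact (E a) (conc x y) = conc (gact (E a) x) y + conc (gact (K a) x) (gact (E a) y)"
  "gact (F a) (conc x y) = conc (gact (F a) x) (gact (Kinv a) y) + conc x (gact (F a) y)"
proof -
  show "gact (K a) (conc x y) = conc (gact (K a) x) (gact (K a) y)"
    "gact (Kinv a) (conc x y) = conc (gact (Kinv a) x) (gact (Kinv a) y)"
    by (rule plin_append_eq; rule ga_append)+
  show "gact (E a) (conc x y) = conc (gact (E a) x) y + conc (gact (K a) x) (gact (E a) y)"
    using plin_append_eq2[of "ga (E a)" "ga (E a)" "\<lambda>m. sng m 1" "ga (K a)" "ga (E a)" x y]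
    by (simp add: ga_append)
  show "gact (F a) (conc x y) = conc (gact (F a) x) (gact (Kinv a) y) + conc x (gact (F a) y)"
    using plin_append_eq2[of "ga (F a)" "ga (F a)" "ga (Kinv a)" "\<lambda>m. sng m 1" "ga (F a)" x y]
    by (simp add: ga_append)
qed

definition wact :: "ugen list \<Rightarrow> vec \<Rightarrow> vec" where
  "wact gs = foldr gact gs"

lemma wact_simps [simp]:
  "wact [] v = v" "wact (g # gs) v = gact g (wact gs v)" "wact (gs @ hs) v = wact gs (wact hs v)"
  by (simp_all add: wact_def)

lemma wact_linear:
  "wact gs (x + y) = wact gs x + wact gs y" "wact gs (psc c x) = psc c (wact gs x)" "wact gs 0 = 0"
  by (induction gs) (simp_all add: plin_add plin_psc)

lemma wact_plin: "wact gs (plin h x) = plin (\<lambda>k. wact gs (h k)) x"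
  by (induction gs) (simp_all add: plin_plin)

definition Act :: "falg \<Rightarrow> vec \<Rightarrow> vec" where
  "Act x v = plin (\<lambda>w. wact (letters w) v) x"

lemma Act_add: "Act (x + y) v = Act x v + Act y v"
  and Act_diff: "Act (x - y) v = Act x v - Act y v"
  and Act_minus: "Act (- x) v = - Act x v"
  and Act_zero [simp]: "Act 0 v = 0"
  and Act_single: "Act (sng w c) v = psc c (wact (letters w) v)"
  by (simp_all add: Act_def plin_add plin_diff plin_minus)

lemma Act_cst: "Act (cst c) v = psc c v"
  and Act_fgen: "Act (fgen g) v = gact g v"
  and Act_one: "Act 1 v = v"
  by (simp_all add: Act_single fgen_def zero_fmon_def flip: single_one)

lemma Act_vadd: "Act x (u + v) = Act x u + Act x v"
  and Act_vpsc: "Act x (psc c v) = psc c (Act x v)"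
  and Act_vzero [simp]: "Act x 0 = 0"
  by (simp_all add: Act_def wact_linear plin_fun_add plin_fun_psc)

lemma Act_vminus: "Act x (- v) = - Act x v"
  using Act_vpsc[of x "- 1" v] by (simp add: psc_neg1)

lemma Act_vdiff: "Act x (u - v) = Act x u - Act x v"
  using Act_vadd[of x u "- v"] by (simp add: Act_vminus)

lemma Act_plin: "Act x (plin h y) = plin (\<lambda>k. Act x (h k)) y"
  unfolding Act_def wact_plin by (rule plin_swap)

lemma Act_mult: "Act (x * y) v = Act x (Act y v)"
proof (induction x rule: pm_induct_UNIV)
  case (single p a)
  show ?case
    by (induction y rule: pm_induct_UNIV)
      (simp_all add: mult_single Act_single plus_fmon_def wact_linear psc_psc distrib_left
        Act_add Act_vadd psc_add)
qed (simp_all add: distrib_right Act_add)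

lemma Act_cst_mult: "Act (cst c * x) v = psc c (Act x v)"
  by (simp add: Act_mult Act_cst)

text \<open>The action of \<open>falg \<otimes> falg\<close> on the tensor product of two vectors.\<close>

definition Act2 :: "falg2 \<Rightarrow> vec \<Rightarrow> vec \<Rightarrow> vec" where
  "Act2 z u v = plin (\<lambda>p. conc (wact (letters (fst p)) u) (wact (letters (snd p)) v)) z"

lemma Act2_add: "Act2 (x + y) u v = Act2 x u v + Act2 y u v"
  and Act2_diff: "Act2 (x - y) u v = Act2 x u v - Act2 y u v"
  and Act2_zero [simp]: "Act2 0 u v = 0"
  and Act2_sum: "Act2 (sum f I) u v = (\<Sum>i\<in>I. Act2 (f i) u v)"
  by (simp_all add: Act2_def plin_add plin_diff plin_sum)

lemma Act2_single:
  "Act2 (sng p c) u v = psc c (conc (wact (letters (fst p)) u) (wact (letters (snd p)) v))"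
  by (simp add: Act2_def)

lemma ftens_plin:
  "ftens x y = plin (\<lambda>v. plin (\<lambda>w. sng (v, w) 1) y) x"
  by (simp add: ftens_def plin_def psc_sum)

lemma ftens_simps:
  "ftens (x + x') y = ftens x y + ftens x' y" "ftens x (y + y') = ftens x y + ftens x y'"
  "ftens (- x) y = - ftens x y" "ftens (x - x') y = ftens x y - ftens x' y"
  "ftens 0 y = 0" "ftens x 0 = 0" "ftens (sng v a) (sng w b) = sng (v, w) (a * b)"
  by (simp_all add: ftens_plin plin_add plin_diff plin_fun_add plin_minus)

lemma ftens_diff_right: "ftens x (y - y') = ftens x y - ftens x y'"
  using ftens_simps(2)[of x "y - y'" y'] by (simp add: algebra_simps)

lemma ftens_mult: "ftens x y * ftens x' y' = ftens (x * x') (y * y')"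
proof (induction x rule: pm_induct_UNIV)
  case (single p a)
  show ?case
  proof (induction x' rule: pm_induct_UNIV)
    case (single p' a')
    show ?case
    proof (induction y rule: pm_induct_UNIV)
      case (single r b)
      show ?case
        by (induction y' rule: pm_induct_UNIV)
          (simp_all add: ftens_simps mult_single distrib_left algebra_simps)
    qed (simp_all add: ftens_simps distrib_right)
  qed (simp_all add: ftens_simps distrib_left)
qed (simp_all add: ftens_simps distrib_right)

lemma ftens_one: "ftens 1 1 = 1"
  using ftens_simps(7)[of 0 1 0 1] by (simp flip: zero_prod_def)

lemma ftens_cst: "ftens (cst c) 1 = cst c" "ftens 1 (cst c) = cst c"
  using ftens_simps(7)[of 0 c 0 1] ftens_simps(7)[of 0 1 0 c] by (simp_all flip: zero_prod_def)

lemma Act2_ftens: "Act2 (ftens x y) u v = conc (Act x u) (Act y v)"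
proof (induction x rule: pm_induct_UNIV)
  case (single p a)
  show ?case
    by (induction y rule: pm_induct_UNIV)
      (simp_all add: ftens_simps Act2_add Act2_single Act_add Act_single conc_psc_left conc_psc_right
        psc_psc conc_add_right psc_add mult.commute)
qed (simp_all add: ftens_simps Act2_add Act_add conc_add_left)

lemma falg2_induct [case_names zero ftens add]:
  assumes "P 0" "\<And>x y. P (ftens x y)" "\<And>x y. P x \<Longrightarrow> P y \<Longrightarrow> P (x + y)"
  shows "P (z :: falg2)"
proof (induction z rule: pm_induct_UNIV)
  case (single k c)
  show ?case using assms(2)[of "sng (fst k) c" "sng (snd k) 1"] by (simp add: ftens_simps)
qed (use assms in auto)

abbreviation Delta :: "falg \<Rightarrow> falg2" where "Delta \<equiv> fext cst cop_gen"

lemma gact_Act2: "gact g (Act2 z u v) = Act2 (cop_gen g * z) u v"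
proof (induction z rule: falg2_induct)
  case (ftens x y)
  show ?case
    by (cases g)
      (simp_all add: Act2_ftens gact_conc distrib_right ftens_mult Act2_add Act_mult Act_fgen)
qed (simp_all add: plin_add distrib_left Act2_add)

lemma Act2_cst_mult: "Act2 (cst c * z) u v = psc c (Act2 z u v)"
proof (induction z rule: falg2_induct)
  case (ftens x y)
  show ?case
    by (simp add: ftens_cst(1)[symmetric] ftens_mult Act2_ftens Act_cst_mult conc_psc_left)
qed (simp_all add: distrib_left Act2_add psc_add)

text \<open>On generators this is the definition of the action on longer words; both sides are
  multiplicative in \<open>x\<close>.\<close>

lemma Act_conc: "Act x (conc u v) = Act2 (Delta x) u v"
proof (induction x rule: pm_induct_UNIV)
  case (single w c)
  have *: "wact gs (conc u v) = Act2 (prod_list (map cop_gen gs)) u v" for gs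
    by (induction gs) (simp_all add: gact_Act2 Act2_ftens Act_one flip: ftens_one)
  show ?case by (simp add: Act_single * cst.fext_single Act2_cst_mult)
qed (simp_all add: Act_add cst.fext_hom Act2_add)

primrec Wt :: "colour \<Rightarrow> weight set" where
  "Wt C1 = {(1, 0), (- 1, 1), (1, - 1), (- 1, 0)}"
| "Wt C2 = {(0, 1), (2, - 1), (0, 0), (- 2, 1), (0, - 1)}"

definition words :: "cword \<Rightarrow> weight list set" where
  "words w = {k. list_all2 (\<lambda>x c. x \<in> Wt c) k w}"

lemma words_Nil [simp]: "words [] = {[]}"
  by (auto simp: words_def)

lemma words_single: "words [c] = (\<lambda>x. [x]) ` Wt c"
  by (auto simp: words_def list_all2_Cons2)

lemma words_length: "k \<in> words w \<Longrightarrow> length k = length w"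
  by (auto simp: words_def list_all2_lengthD)

lemma words_append: "words (u @ v) = catset (words u) (words v)"
  by (auto simp: words_def catset_def list_all2_append2 dest: list_all2_lengthD)

lemma words_appendI: "k \<in> words u \<Longrightarrow> m \<in> words v \<Longrightarrow> k @ m \<in> words (u @ v)"
  by (auto simp: words_append catset_def)

lemma words_appendE:
  assumes "k \<in> words (u @ v)"
  obtains k1 k2 where "k = k1 @ k2" "k1 \<in> words u" "k2 \<in> words v"
    "take (length u) k = k1" "drop (length u) k = k2"
  using assms words_length by (auto simp: words_append catset_def)

lemma words_Cons: "words (c # w) = catset (words [c]) (words w)"
  using words_append[of "[c]" w] by simp

lemma Aspan_conc_words: "x \<in> Aspan (words u) \<Longrightarrow> y \<in> Aspan (words v) \<Longrightarrow> conc x y \<in> Aspan (words (u @ v))"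
  by (simp add: words_append Aspan_conc)

lemma wrho_K:
  "wrho (K a) x = sng [x] (qv powi kexp a x)" "wrho (Kinv a) x = sng [x] (qv powi (- kexp a x))"
  by (cases x; simp add: wrho_def vb_def vscale_psc)+

lemma wrho_EF:
  "wrho (F S) (1, 0) = sng [(- 1, 1)] 1"
  "wrho (F S) (- 1, 1) = 0"
  "wrho (F S) (1, - 1) = sng [(- 1, 0)] 1"
  "wrho (F S) (- 1, 0) = 0"
  "wrho (F S) (0, 1) = 0"
  "wrho (F S) (2, - 1) = sng [(0, 0)] 1"
  "wrho (F S) (0, 0) = sng [(- 2, 1)] (qn 2)"
  "wrho (F S) (- 2, 1) = 0"
  "wrho (F S) (0, - 1) = 0"
  "wrho (F T) (1, 0) = 0"
  "wrho (F T) (- 1, 1) = sng [(1, - 1)] 1"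
  "wrho (F T) (1, - 1) = 0"
  "wrho (F T) (- 1, 0) = 0"
  "wrho (F T) (0, 1) = sng [(2, - 1)] 1"
  "wrho (F T) (2, - 1) = 0"
  "wrho (F T) (0, 0) = 0"
  "wrho (F T) (- 2, 1) = sng [(0, - 1)] 1"
  "wrho (F T) (0, - 1) = 0"
  "wrho (E S) (1, 0) = 0"
  "wrho (E S) (- 1, 1) = sng [(1, 0)] 1"
  "wrho (E S) (1, - 1) = 0"
  "wrho (E S) (- 1, 0) = sng [(1, - 1)] 1"
  "wrho (E S) (0, 1) = 0"
  "wrho (E S) (2, - 1) = 0"
  "wrho (E S) (0, 0) = sng [(2, - 1)] (qn 2)"
  "wrho (E S) (- 2, 1) = sng [(0, 0)] 1"
  "wrho (E S) (0, - 1) = 0"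
  "wrho (E T) (1, 0) = 0"
  "wrho (E T) (- 1, 1) = 0"
  "wrho (E T) (1, - 1) = sng [(- 1, 1)] 1"
  "wrho (E T) (- 1, 0) = 0"
  "wrho (E T) (0, 1) = 0"
  "wrho (E T) (2, - 1) = sng [(0, 1)] 1"
  "wrho (E T) (0, 0) = 0"
  "wrho (E T) (- 2, 1) = 0"
  "wrho (E T) (0, - 1) = sng [(- 2, 1)] 1"
  by (simp_all add: wrho_def vb_def vscale_psc tabled_def)

lemmas letter_simps = ga_singleton wrho_K wrho_EF

lemma wrho_Aspan:
  assumes "x \<in> Wt c"
  shows "wrho g x \<in> Aspan (words [c])"
proof -
  have "wrho (E a) x \<in> Aspan (words [c])" "wrho (F a) x \<in> Aspan (words [c])" for a
    using assms by (cases a; cases c; auto simp: wrho_EF words_single intro!: Aspan_single)+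
  moreover have "wrho (K a) x \<in> Aspan (words [c])" "wrho (Kinv a) x \<in> Aspan (words [c])" for a
    using assms by (auto simp: wrho_K words_single intro!: Aspan_single)
  ultimately show ?thesis by (cases g) auto
qed

lemma ga_Aspan: "k \<in> words w \<Longrightarrow> ga g k \<in> Aspan (words w)"
proof (induction w arbitrary: g k)
  case Nil
  thus ?case by (cases g) auto
next
  case (Cons c w)
  then obtain x m where k: "k = x # m" "x \<in> Wt c" "m \<in> words w"
    by (auto simp: words_def list_all2_Cons2)
  have x: "sng [x] 1 \<in> Aspan (words [c])" using k by (auto simp: words_single)
  show ?case
    unfolding words_Cons[of c w] k
    by (cases g) (auto intro!: Aspan_add Aspan_conc wrho_Aspan Cons.IH x k)
qed

lemma gact_Qspan: "v \<in> Qspan (words w) \<Longrightarrow> gact g v \<in> Qspan (words w)"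
  by (rule Qspan_plin) (auto intro: Aspan_Qspan ga_Aspan)

lemma wact_Qspan: "v \<in> Qspan (words w) \<Longrightarrow> wact gs v \<in> Qspan (words w)"
  by (induction gs) (auto intro: gact_Qspan)

lemma Act_Qspan: "v \<in> Qspan (words w) \<Longrightarrow> Act x v \<in> Qspan (words w)"
  unfolding Act_def by (rule Qspan_plin[where B = UNIV]) (simp_all add: Qspan_def[of UNIV] wact_Qspan)

lemma qv_diff_nonzero [simp]: "qroot a - inverse (qroot a) \<noteq> 0"
proof
  assume "qroot a - inverse (qroot a) = 0"
  hence "qroot a = inverse (qroot a)" by simp
  hence "qroot a * qroot a = 1" by (metis qroot_nonzero right_inverse)
  thus False using qroot_power_neq_1[of 2 a] by (simp add: power2_eq_square)
qed

lemma urels_cases: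
  assumes "x \<in> urels"
  obtains (KK) a b where "x = fgen (K a) * fgen (K b) - fgen (K b) * fgen (K a)"
  | (KL) a where "x = fgen (K a) * fgen (Kinv a) - 1"
  | (LK) a where "x = fgen (Kinv a) * fgen (K a) - 1"
  | (KE) a b where "x = fgen (K a) * fgen (E b) - cst (qv powi rootform a b) * (fgen (E b) * fgen (K a))"
  | (KF) a b where "x = fgen (K a) * fgen (F b) - cst (qv powi (- rootform a b)) * (fgen (F b) * fgen (K a))"
  | (EF) a b where "a \<noteq> b" "x = fgen (E a) * fgen (F b) - fgen (F b) * fgen (E a)"
  | (EFK) a where "x = fgen (E a) * fgen (F a) - fgen (F a) * fgen (E a)
          - cst (1 / (qroot a - inverse (qroot a))) * (fgen (K a) - fgen (Kinv a))"
  | (serre) Z where "Z = E \<or> Z = F" "x \<in> serre Z"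
  using assms unfolding urels_def by blast

lemmas Act_simps = Act_add Act_diff Act_mult Act_cst Act_fgen Act_one Act_vadd Act_vdiff Act_vpsc
  plin_add plin_diff plin_psc

lemma single_eq_single_iff [simp]: "sng k a = sng k b \<longleftrightarrow> a = b"
  by (metis lookup_single_eq)

lemma single_eq_0_iff [simp]: "sng k a = 0 \<longleftrightarrow> a = 0"
  by (metis lookup_single_eq lookup_zero single_zero)

lemma Act_urels_Nil:
  assumes "x \<in> urels"
  shows "Act x (sng [] c) = 0"
  using assms
  by (cases rule: urels_cases)
    (auto simp: Act_simps serre_def Let_def power2_eq_square power3_eq_cube)

text \<open>The fundamental modules satisfy the relations. All weights are concrete, so each relation becomes an
  identity between table entries.\<close>

lemma Act_urels_letter:
  assumes "x \<in> urels" "w \<in> Wt c"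
  shows "Act x (sng [w] 1) = 0"
  using assms(1)
proof (cases rule: urels_cases)
  case (KK a b)
  thus ?thesis using assms(2)
    by (simp add: Act_simps letter_simps mult.commute)
next
  case (KL a)
  thus ?thesis using assms(2)
    by (simp add: Act_simps letter_simps power_int_minus)
next
  case (LK a)
  thus ?thesis using assms(2)
    by (simp add: Act_simps letter_simps power_int_minus)
next
  case (KE a b)
  show ?thesis using assms(2) unfolding KE
    by (cases c; cases a; cases b)
      (auto simp: Act_simps letter_simps power_int_def field_simps eval_nat_numeral)
next
  case (KF a b)
  show ?thesis using assms(2) unfolding KF
    by (cases c; cases a; cases b)
      (auto simp: Act_simps letter_simps power_int_def field_simps eval_nat_numeral)
next
  case (EF a b)
  thus ?thesis using assms(2)
    by (cases c; cases a; cases b) (auto simp: Act_simps letter_simps)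
next
  case (EFK a)
  \<comment> \<open>On a weight vector the right-hand side is a quantum integer \<open>0\<close>, \<open>\<plusminus> 1\<close> or \<open>\<plusminus> [2]\<close>;
    \<open>neg\<close> is for the quotients with value \<open>- 1\<close>.\<close>
  have ne: "qv \<noteq> inverse qv" "qv\<^sup>2 \<noteq> inverse (qv\<^sup>2)"
    using qv_diff_nonzero[of S] qv_diff_nonzero[of T] by auto
  have neg: "(b - d) / (d - b) = - 1" if "d \<noteq> b" for b d :: Kq
    using that by (simp add: field_simps)
  show ?thesis using assms(2) ne neg unfolding EFK(1)
    by (cases c; cases a)
      (auto simp: Act_simps letter_simps power_int_def qint_def power_inverse minus_divide_left
        simp flip: single_diff single_add single_uminus)
next
  case (serre Z)
  thus ?thesis using assms(2)
    by (cases c)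
     (auto simp: Act_simps letter_simps serre_def Let_def power2_eq_square power3_eq_cube
       simp flip: single_diff single_add)
qed


section \<open>Ideals and quotients\<close>

text \<open>Quotients of the free algebra and of its tensor square are treated alike.\<close>

locale two_sided_ideal =
  fixes I :: "'a::ring_1 set"
  assumes ideal_I: "ideal I (ring_of_type_algebra :: 'a ring)"
begin

interpretation ideal I "ring_of_type_algebra :: 'a ring" by (rule ideal_I)

definition cls :: "'a \<Rightarrow> 'a set" where
  "cls x = I +>\<^bsub>ring_of_type_algebra\<^esub> x"

lemma zero_mem [simp]: "0 \<in> I"
  using additive_subgroup.zero_closed[OF ideal.axioms(1)[OF ideal_I]] by simp

lemma add_mem: "x \<in> I \<Longrightarrow> y \<in> I \<Longrightarrow> x + y \<in> I"
  using additive_subgroup.a_closed[OF ideal.axioms(1)[OF ideal_I], of x y] by simp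

lemma minus_mem: "x \<in> I \<Longrightarrow> - x \<in> I"
  using additive_subgroup.a_inv_closed[OF ideal.axioms(1)[OF ideal_I], of x] by simp

lemma diff_mem: "x \<in> I \<Longrightarrow> y \<in> I \<Longrightarrow> x - y \<in> I"
  using add_mem[of x "- y"] minus_mem by simp

lemma mult_left_mem: "x \<in> I \<Longrightarrow> y * x \<in> I"
  using I_l_closed[of x y] by simp

lemma mult_right_mem: "x \<in> I \<Longrightarrow> x * y \<in> I"
  using I_r_closed[of x y] by simp

lemma cls_alt: "cls x = {y. y - x \<in> I}"
proof -
  have "y \<in> (\<Union>h\<in>I. {h + x}) \<longleftrightarrow> y - x \<in> I" for y
    by (auto intro: bexI[of _ "y - x"])
  thus ?thesis by (auto simp: cls_def a_r_coset_def r_coset_def)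
qed

lemma cls_self: "x \<in> cls x"
  by (simp add: cls_alt)

lemma cls_eq_iff: "cls x = cls y \<longleftrightarrow> x - y \<in> I"
proof
  assume "cls x = cls y"
  thus "x - y \<in> I" using cls_self[of x] by (simp add: cls_alt)
next
  assume *: "x - y \<in> I"
  have "z - x \<in> I \<longleftrightarrow> z - y \<in> I" for z
    using add_mem[OF _ *, of "z - x"] diff_mem[OF _ *, of "z - y"] by auto
  thus "cls x = cls y" by (simp add: cls_alt)
qed

lemma rep_mem: "(SOME z. z \<in> cls x) - x \<in> I"
  using someI[of "\<lambda>z. z \<in> cls x", OF cls_self] by (simp add: cls_alt)

lemma Quot_ring: "ring (ring_of_type_algebra Quot I)"
  by (rule quotient_is_ring)

lemma Quot_simps:
  "carrier (ring_of_type_algebra Quot I) = range cls"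
  "cls x \<otimes>\<^bsub>ring_of_type_algebra Quot I\<^esub> cls y = cls (x * y)"
  "cls x \<oplus>\<^bsub>ring_of_type_algebra Quot I\<^esub> cls y = cls (x + y)"
  "\<one>\<^bsub>ring_of_type_algebra Quot I\<^esub> = cls 1"
  "\<zero>\<^bsub>ring_of_type_algebra Quot I\<^esub> = cls 0"
proof -
  show "carrier (ring_of_type_algebra Quot I) = range cls"
    by (auto simp: FactRing_def A_RCOSETS_def' cls_def)
  show "cls x \<otimes>\<^bsub>ring_of_type_algebra Quot I\<^esub> cls y = cls (x * y)"
    using rcoset_mult_add[of x y] by (simp add: FactRing_def cls_def)
  show "cls x \<oplus>\<^bsub>ring_of_type_algebra Quot I\<^esub> cls y = cls (x + y)"
    using a_rcos_sum[of x y] by (simp add: FactRing_def cls_def)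
  show "\<one>\<^bsub>ring_of_type_algebra Quot I\<^esub> = cls 1"
    by (simp add: FactRing_def cls_def)
  show "\<zero>\<^bsub>ring_of_type_algebra Quot I\<^esub> = cls 0"
    by (simp add: FactRing_def cls_alt)
qed

lemma Quot_a_inv: "\<ominus>\<^bsub>ring_of_type_algebra Quot I\<^esub> cls x = cls (- x)"
proof -
  interpret Q: ring "ring_of_type_algebra Quot I" by (rule Quot_ring)
  show ?thesis by (rule Q.minus_equality) (simp_all add: Quot_simps)
qed

end

lemma ideal_classI:
  "ideal I (ring_of_type_algebra :: 'a::ring_1 ring)"
  if "0 \<in> I" "\<And>x y. x \<in> I \<Longrightarrow> y \<in> I \<Longrightarrow> x + y \<in> I" "\<And>x. x \<in> I \<Longrightarrow> - x \<in> I"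
    "\<And>x y. x \<in> I \<Longrightarrow> y * x \<in> I" "\<And>x y. x \<in> I \<Longrightarrow> x * y \<in> I"
proof (rule idealI)
  interpret R: ring "ring_of_type_algebra :: 'a ring" by (rule ring_of_ring_1)
  show "ring (ring_of_type_algebra :: 'a ring)" by (rule ring_of_ring_1)
  show "subgroup I (add_monoid (ring_of_type_algebra :: 'a ring))"
  proof (rule R.add.subgroupI)
    show "\<ominus>\<^bsub>ring_of_type_algebra\<^esub> a \<in> I" if "a \<in> I" for a
      using that \<open>\<And>x. x \<in> I \<Longrightarrow> - x \<in> I\<close> by simp
  qed (use that in auto)
qed (use that in auto)

lemma genideal_ideal: "two_sided_ideal (genideal (ring_of_type_algebra :: 'a::ring_1 ring) Z)"
  by (intro two_sided_ideal.intro ring.genideal_ideal[OF ring_of_ring_1]) simp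

lemma genideal_mem: "x \<in> Z \<Longrightarrow> x \<in> genideal (ring_of_type_algebra :: 'a::ring_1 ring) Z"
  using ring.genideal_self[OF ring_of_ring_1, of Z] by auto

lemma genideal_minimal:
  assumes "ideal I (ring_of_type_algebra :: 'a::ring_1 ring)" "Z \<subseteq> I"
  shows "genideal ring_of_type_algebra Z \<subseteq> I"
  by (rule ring.genideal_minimal[OF ring_of_ring_1]) fact+

text \<open>Since \<open>\<phi>\<close> is additive, the elements \<open>z\<close> with \<open>\<phi> (p z r) = 0\<close> for all \<open>p\<close> and \<open>r\<close> form a
  two-sided ideal.\<close>

lemma genideal_kernel:
  fixes \<phi> :: "'a::ring_1 \<Rightarrow> 'b::ab_group_add"
  assumes add: "\<And>x y. \<phi> (x + y) = \<phi> x + \<phi> y"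
    and gen: "\<And>z p r. z \<in> Z \<Longrightarrow> \<phi> (p * z * r) = 0"
    and x: "x \<in> genideal ring_of_type_algebra Z"
  shows "\<phi> x = 0"
proof -
  let ?I = "{z. \<forall>p r. \<phi> (p * z * r) = 0}"
  have zero: "\<phi> 0 = 0" using add[of 0 0] by simp
  have minus: "\<phi> (- y) = - \<phi> y" for y
    using add[of "- y" y] by (simp add: zero eq_neg_iff_add_eq_0)
  have "ideal ?I (ring_of_type_algebra :: 'a ring)"
  proof (rule ideal_classI)
    show "y * x \<in> ?I" if "x \<in> ?I" for x y
      using that by (auto simp flip: mult.assoc)
    show "x * y \<in> ?I" if "x \<in> ?I" for x y
      using that by (auto simp: mult.assoc)
  qed (auto simp: zero add minus distrib_left distrib_right)
  from genideal_minimal[OF this, of Z] gen x have "x \<in> ?I" by blast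
  hence "\<phi> (1 * x * 1) = 0" by blast
  thus ?thesis by simp
qed

global_interpretation ui: two_sided_ideal uideal
  rewrites "ui.cls = ucls"
proof -
  show *: "two_sided_ideal uideal" unfolding uideal_def by (rule genideal_ideal)
  show "two_sided_ideal.cls uideal = ucls"
    by (simp add: fun_eq_iff two_sided_ideal.cls_def[OF *] ucls_def)
qed

global_interpretation uui: two_sided_ideal uuideal
  rewrites "uui.cls = uucls"
proof -
  show *: "two_sided_ideal uuideal" unfolding uuideal_def by (rule genideal_ideal)
  show "two_sided_ideal.cls uuideal = uucls"
    by (simp add: fun_eq_iff two_sided_ideal.cls_def[OF *] uucls_def)
qed

lemma urep_mem: "urep (ucls x) - x \<in> uideal"
  unfolding urep_def by (rule ui.rep_mem)

lemma ftens_uideal_left: "x \<in> uideal \<Longrightarrow> ftens x y \<in> uuideal"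
  and ftens_uideal_right: "x \<in> uideal \<Longrightarrow> ftens y x \<in> uuideal"
proof -
  assume "x \<in> uideal"
  hence 1: "ftens x 1 \<in> uuideal" and 2: "ftens 1 x \<in> uuideal"
    unfolding uuideal_def by (auto intro: genideal_mem)
  show "ftens x y \<in> uuideal" using uui.mult_right_mem[OF 1, of "ftens 1 y"] by (simp add: ftens_mult)
  show "ftens y x \<in> uuideal" using uui.mult_left_mem[OF 2, of "ftens y 1"] by (simp add: ftens_mult)
qed


section \<open>The coproduct respects the relations\<close>

text \<open>The tensor square \<open>U \<otimes> U\<close> as a type rather than a carrier set: as an instance of \<^class>\<open>ring_1\<close> it
  is open to rewriting, which carries the noncommutative computations below.\<close>

quotient_type uq2 = falg2 / "\<lambda>x y. x - y \<in> uuideal"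
proof (rule equivpI)
  show "reflp (\<lambda>x y. x - y \<in> uuideal)" by (simp add: reflp_def)
  show "symp (\<lambda>x y. x - y \<in> uuideal)"
    unfolding symp_def using uui.minus_mem by fastforce
  show "transp (\<lambda>x y. x - y \<in> uuideal)"
    unfolding transp_def using uui.add_mem by fastforce
qed

text \<open>A vector all of whose images under the algebra are killed by the relations is killed by the ideal that they
  generate; on tensor products the same holds for the two-factor ideal.\<close>

lemma Act_uideal_zero:
  assumes "\<And>z r. z \<in> urels \<Longrightarrow> Act z (Act r v) = 0" "x \<in> uideal"
  shows "Act x v = 0"
proof (rule genideal_kernel[where \<phi> = "\<lambda>x. Act x v"])
  show "x \<in> genideal ring_of_type_algebra urels" using assms(2) by (simp add: uideal_def)
qed (simp_all add: Act_add Act_mult assms(1))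

lemma Act2_uuideal_zero:
  assumes "\<And>x. x \<in> uideal \<Longrightarrow> Act x u = 0" "\<And>x. x \<in> uideal \<Longrightarrow> Act x v = 0" "z \<in> uuideal"
  shows "Act2 z u v = 0"
proof (rule genideal_kernel[where \<phi> = "\<lambda>z. Act2 z u v"])
  show "z \<in> genideal ring_of_type_algebra ((\<lambda>x. ftens x 1) ` uideal \<union> (\<lambda>x. ftens 1 x) ` uideal)"
    using assms(3) by (simp add: uuideal_def)
next
  fix z p r
  assume z: "z \<in> (\<lambda>x. ftens x 1) ` uideal \<union> (\<lambda>x. ftens 1 x) ` uideal"
  show "Act2 (p * z * r) u v = 0"
  proof (induction p rule: falg2_induct)
    case (ftens p1 p2)
    show ?case
    proof (induction r rule: falg2_induct)
      case (ftens r1 r2)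
      from z show ?case
      proof (elim UnE imageE)
        fix x assume x: "z = ftens x 1" "x \<in> uideal"
        have "p1 * x * r1 \<in> uideal"
          using x by (intro ui.mult_left_mem ui.mult_right_mem)
        thus ?thesis by (simp add: x ftens_mult Act2_ftens assms)
      next
        fix x assume x: "z = ftens 1 x" "x \<in> uideal"
        have "p2 * x * r2 \<in> uideal"
          using x by (intro ui.mult_left_mem ui.mult_right_mem)
        thus ?thesis by (simp add: x ftens_mult Act2_ftens assms)
      qed
    qed (simp_all add: distrib_left Act2_add)
  qed (simp_all add: distrib_right Act2_add)
qed (simp add: Act2_add)

lemma Qspan_Nil: "v \<in> Qspan (words []) \<Longrightarrow> v = sng [] (coef v [])"
  using pm_expand[of "{[]}" v] by (simp add: Qspan_def)

lemma Act_uideal_Nil: "x \<in> uideal \<Longrightarrow> Act x (sng [] c) = 0"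
proof (erule Act_uideal_zero[rotated])
  fix z r assume "z \<in> urels"
  moreover have "Act r (sng [] c) \<in> Qspan (words [])" by (intro Act_Qspan Qspan_single) simp
  ultimately show "Act z (Act r (sng [] c)) = 0" using Act_urels_Nil Qspan_Nil by metis
qed

instantiation uq2 :: ring_1
begin

lift_definition zero_uq2 :: uq2 is 0 .
lift_definition one_uq2 :: uq2 is 1 .
lift_definition plus_uq2 :: "uq2 \<Rightarrow> uq2 \<Rightarrow> uq2" is "(+)"
  using uui.add_mem by (fastforce simp: algebra_simps)
lift_definition minus_uq2 :: "uq2 \<Rightarrow> uq2 \<Rightarrow> uq2" is "(-)"
  using uui.diff_mem by (fastforce simp: algebra_simps)
lift_definition uminus_uq2 :: "uq2 \<Rightarrow> uq2" is "uminus"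
  using uui.minus_mem by fastforce
lift_definition times_uq2 :: "uq2 \<Rightarrow> uq2 \<Rightarrow> uq2" is "(*)"
proof -
  fix x x' y y' :: falg2
  assume "x - x' \<in> uuideal" "y - y' \<in> uuideal"
  hence "(x - x') * y + x' * (y - y') \<in> uuideal"
    by (intro uui.add_mem uui.mult_left_mem uui.mult_right_mem)
  thus "x * y - x' * y' \<in> uuideal" by (simp add: algebra_simps)
qed

lemma one_notin_uuideal: "(1 :: falg2) \<notin> uuideal"
proof
  assume 1: "(1 :: falg2) \<in> uuideal"
  \<comment> \<open>The trivial representation on both factors separates \<open>1\<close> from the ideal.\<close>
  have "Act2 1 (sng [] 1) (sng [] 1) = 0"
    by (rule Act2_uuideal_zero[OF Act_uideal_Nil Act_uideal_Nil 1])
  thus False by (simp add: Act2_ftens Act_one flip: ftens_one)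
qed

instance
proof
  show "(0 :: uq2) \<noteq> 1"
    by transfer (use one_notin_uuideal uui.minus_mem in fastforce)
qed (transfer; simp add: algebra_simps)+

end

abbreviation \<pi> :: "falg2 \<Rightarrow> uq2" where "\<pi> \<equiv> abs_uq2"

lemma \<pi>_eq_iff: "\<pi> x = \<pi> y \<longleftrightarrow> x - y \<in> uuideal"
  by (rule uq2.abs_eq_iff)

lemma \<pi>_hom:
  "\<pi> (x + y) = \<pi> x + \<pi> y" "\<pi> (x * y) = \<pi> x * \<pi> y" "\<pi> (x - y) = \<pi> x - \<pi> y"
  "\<pi> (- x) = - \<pi> x" "\<pi> 1 = 1" "\<pi> 0 = 0"
  by (simp_all add: plus_uq2.abs_eq times_uq2.abs_eq minus_uq2.abs_eq uminus_uq2.abs_eq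
      one_uq2.abs_eq zero_uq2.abs_eq)

declare \<pi>_hom(5) [simp]

lemma \<pi>_power: "\<pi> (x ^ n) = \<pi> x ^ n"
  by (induction n) (simp_all add: \<pi>_hom)

lemma \<pi>_eq_0_iff: "\<pi> x = 0 \<longleftrightarrow> x \<in> uuideal"
  using \<pi>_eq_iff[of x 0] by (simp add: \<pi>_hom)

text \<open>Scalars and the two factors inside \<open>U \<otimes> U\<close>; the factors commute with each other, so every
  element can be brought into the form \<open>\<Sum> e1 x * e2 y\<close>.\<close>

abbreviation scal :: "Kq \<Rightarrow> uq2" where "scal c \<equiv> \<pi> (cst c)"
abbreviation e1 :: "falg \<Rightarrow> uq2" where "e1 x \<equiv> \<pi> (ftens x 1)"
abbreviation e2 :: "falg \<Rightarrow> uq2" where "e2 x \<equiv> \<pi> (ftens 1 x)"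

global_interpretation scal: central_scalars scal
proof
  show "scal a * y = y * scal a" for a y
  proof -
    obtain z where "y = \<pi> z" by (induction y rule: uq2.abs_induct) auto
    thus ?thesis using cst_central[of a z] by (simp flip: \<pi>_hom)
  qed
qed (simp_all add: single_add mult_single flip: \<pi>_hom)

lemma ftens_pow: "ftens x y ^ n = ftens (x ^ n) (y ^ n)"
  by (induction n) (simp_all add: ftens_mult ftens_one)

lemma e_hom:
  "e1 (x + y) = e1 x + e1 y" "e1 (x - y) = e1 x - e1 y" "e1 (x * y) = e1 x * e1 y" "e1 1 = 1"
  "e2 (x + y) = e2 x + e2 y" "e2 (x - y) = e2 x - e2 y" "e2 (x * y) = e2 x * e2 y" "e2 1 = 1"
  "e1 (cst c) = scal c" "e2 (cst c) = scal c" "e1 (x ^ n) = e1 x ^ n" "e2 (x ^ n) = e2 x ^ n"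
  using ftens_pow[of x 1 n] ftens_pow[of 1 x n]
  by (simp_all add: ftens_simps ftens_diff_right \<pi>_hom ftens_mult ftens_one ftens_cst flip: \<pi>_hom \<pi>_power)

lemma e_comm: "e2 y * e1 x = e1 x * e2 y"
  by (simp add: ftens_mult flip: \<pi>_hom)

lemma \<pi>_ftens: "\<pi> (ftens x y) = e1 x * e2 y"
  by (simp add: ftens_mult flip: \<pi>_hom)

lemma e_uideal: "x \<in> uideal \<Longrightarrow> e1 x = 0" "x \<in> uideal \<Longrightarrow> e2 x = 0"
  by (simp_all add: \<pi>_eq_0_iff ftens_uideal_left ftens_uideal_right)

lemma e_urels: "\<forall>x\<in>urels. e1 x = 0" "\<forall>x\<in>urels. e2 x = 0"
  by (simp_all add: e_uideal uideal_def genideal_mem)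

text \<open>The quantum Serre relations, with central elements \<open>p = q\<close> and \<open>r = q\<inverse>\<close>, solved for one word each so
  that they can serve as rewrite rules.\<close>

definition qserre :: "'a::ring_1 \<Rightarrow> 'a \<Rightarrow> 'a \<Rightarrow> 'a \<Rightarrow> bool" where
  "qserre p r t s \<longleftrightarrow>
     t * (t * s) = (p * p + r * r) * (t * (s * t)) - s * (t * t) \<and>
     s * (s * (s * t)) = (p * p + 1 + r * r) * (s * (s * (t * s)))
       - (p * p + 1 + r * r) * (s * (t * (s * s))) + t * (s * (s * s))"

lemma mult_left_assoc: "a * (b * z) = d * z" if "a * b = d" for a b d z :: "'a::ring_1"
  using that by (simp flip: mult.assoc)

text \<open>Moving every \<open>y\<close> to the right of every \<open>x\<close> turns the Serre expressions in \<open>x + y\<close> into sums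
  over words with all \<open>x\<close> in front. The pure words cancel by the relations for \<open>x\<close> and for
  \<open>y\<close>, and the exponents in the commutation rules, which are the values of the root form, are such
  that the coefficients of the mixed words cancel as well.\<close>

lemma qserre_add:
  fixes xt xs yt ys p r :: "'a::ring_1"
  assumes pr: "p * r = 1" and rp: "r * p = 1"
    and cp: "\<And>z. z * p = p * z" and cr: "\<And>z. z * r = r * z"
    and c: "yt * xt = p * (p * (p * (p * (xt * yt))))" "ys * xs = p * (p * (xs * ys))"
      "yt * xs = r * (r * (xs * yt))" "ys * xt = r * (r * (xt * ys))"
    and x: "qserre p r xt xs" and y: "qserre p r yt ys"
  shows "qserre p r (xt + yt) (xs + ys)"
proof -
  note pr' = mult_left_assoc[OF pr, simplified] mult_left_assoc[OF rp, simplified]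
  note c' = c[THEN mult_left_assoc]
  have cp': "z * p = p * z" "z * r = r * z" "z * (p * w) = p * (z * w)" "z * (r * w) = r * (z * w)"
    if "z \<in> {xt, xs, yt, ys}" for z w
    using mult.assoc[of z p w] mult.assoc[of z r w] by (simp_all add: cp[of z] cr[of z] mult.assoc)
  note rules = distrib_left distrib_right left_diff_distrib right_diff_distrib mult.assoc
    pr rp pr' cp'[of xt] cp'[of xs] cp'[of yt] cp'[of ys] c c'
  show ?thesis
    unfolding qserre_def
  proof
    show "(xt + yt) * ((xt + yt) * (xs + ys))
      = (p * p + r * r) * ((xt + yt) * ((xs + ys) * (xt + yt))) - (xs + ys) * ((xt + yt) * (xt + yt))"
      using x y by (simp add: qserre_def rules) (simp add: algebra_simps)?
    show "(xs + ys) * ((xs + ys) * ((xs + ys) * (xt + yt)))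
      = (p * p + 1 + r * r) * ((xs + ys) * ((xs + ys) * ((xt + yt) * (xs + ys))))
      - (p * p + 1 + r * r) * ((xs + ys) * ((xt + yt) * ((xs + ys) * (xs + ys))))
      + (xt + yt) * ((xs + ys) * ((xs + ys) * (xs + ys)))"
      using x y by (simp add: qserre_def rules) (simp add: algebra_simps)?
  qed
qed

text \<open>Twisting by a commuting pair multiplies every word of a fixed multidegree by the same
  element.\<close>

lemma qserre_twist:
  fixes kt ks zt zs p r :: "'a::ring_1"
  assumes cp: "\<And>z. z * p = p * z" and cr: "\<And>z. z * r = r * z"
    and k: "ks * kt = kt * ks"
    and kz: "zt * kt = kt * zt" "zt * ks = ks * zt" "zs * kt = kt * zs" "zs * ks = ks * zs"
    and z: "qserre p r zt zs"
  shows "qserre p r (kt * zt) (ks * zs)"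
proof -
  have cp': "z * p = p * z" "z * r = r * z" "z * (p * w) = p * (z * w)" "z * (r * w) = r * (z * w)"
    if "z \<in> {kt, ks, zt, zs}" for z w
    using mult.assoc[of z p w] mult.assoc[of z r w] by (simp_all add: cp[of z] cr[of z] mult.assoc)
  note rules = distrib_left distrib_right left_diff_distrib right_diff_distrib mult.assoc
    cp'[of kt] cp'[of ks] cp'[of zt] cp'[of zs] k k[THEN mult_left_assoc]
    kz kz[THEN mult_left_assoc]
  show ?thesis using z by (simp add: qserre_def rules)
qed

lemma serre_iff:
  fixes f :: "falg \<Rightarrow> uq2"
  assumes f: "\<And>x y. f (x + y) = f x + f y" "\<And>x y. f (x - y) = f x - f y"
    "\<And>x y. f (x * y) = f x * f y" "\<And>c. f (cst c) = scal c"
  shows "(\<forall>x\<in>serre Z. f x = 0) \<longleftrightarrow>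
    qserre (scal qv) (scal (inverse qv)) (f (fgen (Z T))) (f (fgen (Z S)))"
proof -
  let ?t = "f (fgen (Z T))" and ?s = "f (fgen (Z S))"
  have 1: "scal (qn 4 / qn 2) = scal qv * scal qv + scal (inverse qv) * scal (inverse qv)"
    by (simp add: qint_4_over_2 scal.c_add scal.c_mult power2_eq_square)
  have 2: "scal (qn 3) = scal qv * scal qv + 1 + scal (inverse qv) * scal (inverse qv)"
    by (simp add: qn_3 scal.c_add scal.c_mult \<pi>_hom power2_eq_square)
  have "(\<forall>x\<in>serre Z. f x = 0) \<longleftrightarrow>
      ?t * (?t * ?s) - scal (qn 4 / qn 2) * (?t * (?s * ?t)) + ?s * (?t * ?t) = 0 \<and>
      ?s * (?s * (?s * ?t)) - scal (qn 3) * (?s * (?s * (?t * ?s)))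
        + scal (qn 3) * (?s * (?t * (?s * ?s))) - ?t * (?s * (?s * ?s)) = 0"
    by (simp add: serre_def Let_def f power2_eq_square power3_eq_cube mult.assoc del: One_nat_def)
  also have "\<dots> \<longleftrightarrow> qserre (scal qv) (scal (inverse qv)) ?t ?s"
    unfolding qserre_def 1 2 by (auto simp: algebra_simps)
  finally show ?thesis .
qed

lemma urelsI:
  "fgen (K a) * fgen (K b) - fgen (K b) * fgen (K a) \<in> urels"
  "fgen (K a) * fgen (Kinv a) - 1 \<in> urels"
  "fgen (Kinv a) * fgen (K a) - 1 \<in> urels"
  "fgen (K a) * fgen (E b) - cst (qv powi rootform a b) * (fgen (E b) * fgen (K a)) \<in> urels"
  "fgen (K a) * fgen (F b) - cst (qv powi (- rootform a b)) * (fgen (F b) * fgen (K a)) \<in> urels"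
  "a \<noteq> b \<Longrightarrow> fgen (E a) * fgen (F b) - fgen (F b) * fgen (E a) \<in> urels"
  "fgen (E a) * fgen (F a) - fgen (F a) * fgen (E a)
    - cst (1 / (qroot a - inverse (qroot a))) * (fgen (K a) - fgen (Kinv a)) \<in> urels"
  unfolding urels_def by blast+

lemma rootform_sym: "rootform a b = rootform b a"
  by (cases a; cases b) simp_all

text \<open>The defining relations as equations between the images of the generators, together with those for
  \<open>K\<inverse>\<close>, which follow by conjugation. They are needed for both embeddings \<open>U \<rightarrow> U \<otimes> U\<close>.\<close>

lemma urels_hom:
  fixes f :: "falg \<Rightarrow> uq2"
  assumes f: "\<And>x y. f (x + y) = f x + f y" "\<And>x y. f (x - y) = f x - f y"
    "\<And>x y. f (x * y) = f x * f y" "\<And>c. f (cst c) = scal c" "f 1 = 1"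
    and kill: "\<forall>x\<in>urels. f x = 0"
  defines "g \<equiv> \<lambda>x. f (fgen x)"
  shows "g (K a) * g (K b) = g (K b) * g (K a)"
    and "g (K a) * g (Kinv a) = 1" "g (Kinv a) * g (K a) = 1"
    and "g (Kinv a) * g (Kinv b) = g (Kinv b) * g (Kinv a)"
    and "g (K a) * g (E b) = scal (qv powi rootform a b) * (g (E b) * g (K a))"
    and "g (K a) * g (F b) = scal (qv powi (- rootform a b)) * (g (F b) * g (K a))"
    and "g (Kinv a) * g (E b) = scal (qv powi (- rootform a b)) * (g (E b) * g (Kinv a))"
    and "g (Kinv a) * g (F b) = scal (qv powi rootform a b) * (g (F b) * g (Kinv a))"
    and "a \<noteq> b \<Longrightarrow> g (E a) * g (F b) = g (F b) * g (E a)"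
    and "g (E a) * g (F a) = g (F a) * g (E a)
      + scal (1 / (qroot a - inverse (qroot a))) * (g (K a) - g (Kinv a))"
    and "Z = E \<or> Z = F \<Longrightarrow> qserre (scal qv) (scal (inverse qv)) (g (Z T)) (g (Z S))"
    and "g (K a) * g (Kinv b) = g (Kinv b) * g (K a)"
proof -
  have gg: "f (fgen x) = g x" for x by (simp add: g_def)
  note k = urelsI[THEN kill[rule_format], unfolded f gg]
  have KK: "g (K a) * g (K b) = g (K b) * g (K a)"
    and KL: "g (K a) * g (Kinv a) = 1" "g (Kinv a) * g (K a) = 1"
    and KE: "g (K a) * g (E b) = scal (qv powi rootform a b) * (g (E b) * g (K a))"
    and KF: "g (K a) * g (F b) = scal (qv powi (- rootform a b)) * (g (F b) * g (K a))" for a b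
    using k(1)[of a b] k(2,3)[of a] k(4,5)[of a b] by simp_all
  note KL' = KL[THEN mult_left_assoc, simplified]
  have conj: "g (Kinv a) * y = scal (inverse c) * (y * g (Kinv a))"
    if "g (K a) * y = scal c * (y * g (K a))" "c \<noteq> 0" for a y c
  proof -
    have "y * g (Kinv a) = g (Kinv a) * (g (K a) * y) * g (Kinv a)"
      by (simp add: KL' flip: mult.assoc) (simp add: KL)
    also have "\<dots> = scal c * (g (Kinv a) * y)"
      using scal.c_central[of c "g (Kinv a)"] mult.assoc[of "g (Kinv a)" "scal c"]
      by (simp add: that mult.assoc KL) (simp flip: mult.assoc)
    finally show ?thesis
      using that(2) by (simp flip: mult.assoc scal.c_mult)
  qed
  have LK: "g (Kinv a) * g (K b) = g (K b) * g (Kinv a)" for a b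
    using conj[of a "g (K b)" 1] KK[of a b] by simp
  show "g (K a) * g (Kinv b) = g (Kinv b) * g (K a)"
    by (rule LK[symmetric])
  show "g (Kinv a) * g (Kinv b) = g (Kinv b) * g (Kinv a)"
    using conj[of b "g (Kinv a)" 1] LK[of a b] by simp
  show "g (K a) * g (K b) = g (K b) * g (K a)"
    "g (K a) * g (Kinv a) = 1" "g (Kinv a) * g (K a) = 1"
    "g (K a) * g (E b) = scal (qv powi rootform a b) * (g (E b) * g (K a))"
    "g (K a) * g (F b) = scal (qv powi (- rootform a b)) * (g (F b) * g (K a))"
    by (fact KK KL KE KF)+
  show "g (Kinv a) * g (E b) = scal (qv powi (- rootform a b)) * (g (E b) * g (Kinv a))"
    using conj[OF KE[of a b]] by (simp add: power_int_minus)
  show "g (Kinv a) * g (F b) = scal (qv powi rootform a b) * (g (F b) * g (Kinv a))"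
    using conj[OF KF[of a b]] by (simp add: power_int_minus)
  show "g (E a) * g (F b) = g (F b) * g (E a)" if "a \<noteq> b"
    using k(6)[OF that] by simp
  show "g (E a) * g (F a) = g (F a) * g (E a)
      + scal (1 / (qroot a - inverse (qroot a))) * (g (K a) - g (Kinv a))"
    using k(7)[of a] by (simp only: right_minus_eq diff_diff_eq)
  show "qserre (scal qv) (scal (inverse qv)) (g (Z T)) (g (Z S))" if "Z = E \<or> Z = F"
    using serre_iff[of f Z, OF f(1-4)] kill that by (auto simp: urels_def g_def)
qed

lemmas e1_rels = urels_hom[of e1, OF e_hom(1,2,3,9,4) e_urels(1)]
lemmas e2_rels = urels_hom[of e2, OF e_hom(5,6,7,10,8) e_urels(2)]

abbreviation piD :: "falg \<Rightarrow> uq2" where "piD x \<equiv> \<pi> (Delta x)"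

lemma piD_hom:
  "piD (x + y) = piD x + piD y" "piD (x - y) = piD x - piD y" "piD (x * y) = piD x * piD y"
  "piD (cst c) = scal c" "piD 1 = 1"
  by (simp_all add: cst.fext_hom \<pi>_hom)

lemma piD_gen:
  "piD (fgen (E a)) = e1 (fgen (E a)) + e1 (fgen (K a)) * e2 (fgen (E a))"
  "piD (fgen (F a)) = e2 (fgen (F a)) + e2 (fgen (Kinv a)) * e1 (fgen (F a))"
  "piD (fgen (K a)) = e1 (fgen (K a)) * e2 (fgen (K a))"
  "piD (fgen (Kinv a)) = e1 (fgen (Kinv a)) * e2 (fgen (Kinv a))"
proof -
  have "\<pi> (ftens (fgen (F a)) (fgen (Kinv a))) = e2 (fgen (Kinv a)) * e1 (fgen (F a))"
    by (subst \<pi>_ftens) (rule e_comm[symmetric])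
  thus "piD (fgen (F a)) = e2 (fgen (F a)) + e2 (fgen (Kinv a)) * e1 (fgen (F a))"
    by (simp only: cst.fext_fgen cop_gen.simps \<pi>_hom add.commute)
qed (simp_all only: cst.fext_fgen cop_gen.simps \<pi>_hom \<pi>_ftens[of "fgen (K a)" "fgen _"]
      \<pi>_ftens[of "fgen (Kinv a)" "fgen _"])

text \<open>For the Serre relations, \<open>\<Delta>(E\<^sub>a)\<close> is the sum of \<open>x\<^sub>a = E\<^sub>a \<otimes> 1\<close> and \<open>y\<^sub>a = K\<^sub>a \<otimes> E\<^sub>a\<close>, where \<open>y\<close> is
  a twist of the second copy of \<open>E\<close> and \<open>y\<^sub>a x\<^sub>b = q\<^bsup>(a,b)\<^esup> x\<^sub>b y\<^sub>a\<close>; for \<open>F\<close> the roles of the factors are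
  exchanged. In the other relations both sides have the same normal form once the second factor is
  moved to the right.\<close>

lemma piD_urels:
  assumes "x \<in> urels"
  shows "piD x = 0"
proof -
  define k where "k a = e1 (fgen (K a))" for a
  define l where "l a = e1 (fgen (Kinv a))" for a
  define u where "u a = e1 (fgen (E a))" for a
  define v where "v a = e1 (fgen (F a))" for a
  define k' where "k' a = e2 (fgen (K a))" for a
  define l' where "l' a = e2 (fgen (Kinv a))" for a
  define u' where "u' a = e2 (fgen (E a))" for a
  define v' where "v' a = e2 (fgen (F a))" for a
  note defs = k_def l_def u_def v_def k'_def l'_def u'_def v'_def
  note dp = piD_gen[folded defs]
  note r1 = e1_rels[folded defs] and r2 = e2_rels[folded defs]
  let ?p = "scal qv" and ?r = "scal (inverse qv)"
  have comm: "a' * a = a * a'"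
    if "a \<in> range k \<union> range l \<union> range u \<union> range v" "a' \<in> range k' \<union> range l' \<union> range u' \<union> range v'" for a a'
    using that unfolding defs by (auto simp: e_comm)
  have ac: "k' a * k b = k b * k' a" "k' a * l b = l b * k' a" "k' a * u b = u b * k' a" "k' a * v b = v b * k' a"
    "l' a * k b = k b * l' a" "l' a * l b = l b * l' a" "l' a * u b = u b * l' a" "l' a * v b = v b * l' a"
    "u' a * k b = k b * u' a" "u' a * l b = l b * u' a" "u' a * u b = u b * u' a" "u' a * v b = v b * u' a"
    "v' a * k b = k b * v' a" "v' a * l b = l b * v' a" "v' a * u b = u b * v' a" "v' a * v b = v b * v' a"
    for a b
    by (rule comm; blast)+
  note ac' = ac ac[THEN mult_left_assoc]
  have sc: "z * scal c = scal c * z" "z * (scal c * w) = scal c * (z * w)"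
    if "z \<in> range k \<union> range l \<union> range u \<union> range v \<union> range k' \<union> range l' \<union> range u' \<union> range v'" for z w c
    using scal.c_central[of c z] by (simp_all flip: mult.assoc)
  have sc': "z a * scal c = scal c * z a" "z a * (scal c * w) = scal c * (z a * w)"
    if "z \<in> {k, l, u, v, k', l', u', v'}" for z a w c
    using sc(1)[of "z a" c] sc(2)[of "z a" c w] that by auto
  note scs = sc'[of k] sc'[of l] sc'[of u] sc'[of v] sc'[of k'] sc'[of l'] sc'[of u'] sc'[of v']
  have prp: "?p * ?r = 1" "?r * ?p = 1" by (simp_all flip: scal.c_mult)
  have pw: "scal (qv powi 2) = ?p * ?p" "scal (qv powi (- 2)) = ?r * ?r"
    "scal (qv powi 4) = ?p * (?p * (?p * ?p))" "scal (qv ^ 2) = ?p * ?p"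
    "scal (qv ^ 4) = ?p * (?p * (?p * ?p))"
    by (simp_all add: power_int_def eval_nat_numeral nat_eq_iff flip: scal.c_mult)
  have sq: "qserre ?p ?r (piD (fgen (Z T))) (piD (fgen (Z S)))" if "Z = E \<or> Z = F" for Z
  proof -
    have cp: "z * ?p = ?p * z" "z * ?r = ?r * z" for z by (simp_all only: scal.c_central)
    have x: "qserre ?p ?r (u T) (u S)" "qserre ?p ?r (u' T) (u' S)"
      "qserre ?p ?r (v T) (v S)" "qserre ?p ?r (v' T) (v' S)"
      unfolding defs by (rule e1_rels(11) e2_rels(11); simp)+
    from that show ?thesis
    proof
      assume Z: "Z = E"
      have y: "qserre ?p ?r (k T * u' T) (k S * u' S)"
        by (rule qserre_twist[OF cp(1) cp(2) r1(1) _ _ _ _ x(2)]) (rule ac)+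
      show ?thesis unfolding Z dp
        by (rule qserre_add[OF prp(1) prp(2) cp(1) cp(2) _ _ _ _ x(1) y])
          (simp_all add: ac' r1(5) r1(5)[THEN mult_left_assoc] pw scs mult.assoc)
    next
      assume Z: "Z = F"
      have y: "qserre ?p ?r (l' T * v T) (l' S * v S)"
        by (rule qserre_twist[OF cp(1) cp(2) r2(4) _ _ _ _ x(3)]) (rule ac[symmetric])+
      show ?thesis unfolding Z dp
        by (rule qserre_add[OF prp(1) prp(2) cp(1) cp(2) _ _ _ _ x(4) y])
          (simp_all add: ac' r2(8) r2(8)[THEN mult_left_assoc] pw scs mult.assoc)
    qed
  qed
  from assms show ?thesis
  proof (cases rule: urels_cases)
    case (serre Z)
    thus ?thesis using serre_iff[of piD Z] sq[of Z] by (simp add: piD_hom)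
  next
    case (KK a b)
    show ?thesis unfolding KK piD_hom dp
      by (simp add: mult.assoc ac' r1(1)[of a b] r2(1)[of a b] r1(1)[of a b, THEN mult_left_assoc])
  next
    case (KL a)
    show ?thesis unfolding KL piD_hom dp
      by (simp add: mult.assoc ac' r1(2) r2(2) r1(2)[THEN mult_left_assoc, simplified])
  next
    case (LK a)
    show ?thesis unfolding LK piD_hom dp
      by (simp add: mult.assoc ac' r1(3) r2(3) r1(3)[THEN mult_left_assoc, simplified])
  next
    case (KE a b)
    show ?thesis unfolding KE piD_hom dp
      by (simp add: distrib_left distrib_right mult.assoc ac' scs r1(1)[of a b, THEN mult_left_assoc]
          r1(5)[of a b] r2(5)[of a b] r1(5)[of a b, THEN mult_left_assoc])
  next
    case (KF a b)
    show ?thesis unfolding KF piD_hom dp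
      by (simp add: distrib_left distrib_right mult.assoc ac' scs r2(1)[of a b]
          r2(2)[of a] r2(3) r2(12)[of a b]
          r1(6)[of a b] r2(6)[of a b] r1(6)[of a b, THEN mult_left_assoc])
  next
    case (EF a b)
    have fs: "rootform b a = rootform a b" by (rule rootform_sym)
    show ?thesis unfolding EF(2) piD_hom dp
      by (simp add: distrib_left distrib_right mult.assoc ac' scs r1(9)[OF EF(1)] r2(9)[OF EF(1)]
          r1(9)[OF EF(1), THEN mult_left_assoc] r1(6)[of a b, THEN mult_left_assoc] r2(7)[of b a] fs)
  next
    case (EFK a)
    show ?thesis unfolding EFK piD_hom dp
      by (simp add: distrib_left distrib_right left_diff_distrib right_diff_distrib mult.assoc
          ac' scs r1(10)[of a] r2(10)[of a] r1(10)[of a, THEN mult_left_assoc]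
          r1(6)[of a a, THEN mult_left_assoc] r2(7)[of a a])
  qed
qed

lemma piD_uideal:
  assumes "x \<in> uideal"
  shows "piD x = 0"
proof (rule genideal_kernel[where \<phi> = piD])
  show "x \<in> genideal ring_of_type_algebra urels" using assms by (simp add: uideal_def)
qed (simp_all add: piD_hom piD_urels)

text \<open>Induction on the word: the coproduct maps the ideal of relations into the two-factor ideal, and
  that ideal kills the tensor product of two vectors killed by all relations.\<close>

lemma Act_uideal:
  assumes "x \<in> uideal" "v \<in> Qspan (words w)"
  shows "Act x v = 0"
  using assms
proof (induction w arbitrary: x v)
  case Nil
  thus ?case using Act_uideal_Nil Qspan_Nil by metis
next
  case (Cons c w)
  have letter: "Act x (sng [a] 1) = 0" if x: "x \<in> uideal" and a: "a \<in> Wt c" for x a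
  proof (rule Act_uideal_zero[OF _ x])
    fix z r assume z: "z \<in> urels"
    have "Act r (sng [a] 1) \<in> Qspan (words [c])"
      using a by (intro Act_Qspan Qspan_single) (simp add: words_single)
    hence "Act z (Act r (sng [a] 1)) = plin (\<lambda>k. 0) (Act r (sng [a] 1))"
      by (subst (1) plin_id[symmetric], subst Act_plin, intro plin_eqI)
        (auto simp: words_single Act_urels_letter[OF z])
    thus "Act z (Act r (sng [a] 1)) = 0" by simp
  qed
  have "Act x (sng k 1) = 0" if "k \<in> words (c # w)" for k
  proof -
    from that obtain a m where k: "k = a # m" "a \<in> Wt c" "m \<in> words w"
      by (auto simp: words_def list_all2_Cons2)
    have "Delta x \<in> uuideal" using piD_uideal[OF Cons.prems(1)] by (simp add: \<pi>_eq_0_iff)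
    hence "Act2 (Delta x) (sng [a] 1) (sng m 1) = 0"
      using k by (intro Act2_uuideal_zero letter Cons.IH) auto
    hence "Act x (conc (sng [a] 1) (sng m 1)) = 0" by (simp only: Act_conc)
    thus ?thesis using k by simp
  qed
  hence "plin (\<lambda>k. Act x (sng k 1)) v = plin (\<lambda>k. 0) v"
    using Cons.prems(2) by (intro plin_eqI)
  thus ?case by (simp flip: Act_plin)
qed

lemma Act_congr:
  assumes "x - y \<in> uideal" "v \<in> Qspan (words w)"
  shows "Act x v = Act y v"
  using Act_uideal[OF assms] by (simp add: Act_diff)

lemma Act_urep: "v \<in> Qspan (words w) \<Longrightarrow> Act (urep (ucls x)) v = Act x v"
  by (rule Act_congr[OF urep_mem])


section \<open>The integral form and its coproduct\<close>

lemma Uq_simps [simp]: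
  "carrier Uq = range ucls"
  "ucls x \<otimes>\<^bsub>Uq\<^esub> ucls y = ucls (x * y)"
  "ucls x \<oplus>\<^bsub>Uq\<^esub> ucls y = ucls (x + y)"
  "\<one>\<^bsub>Uq\<^esub> = ucls 1" "\<zero>\<^bsub>Uq\<^esub> = ucls 0" "\<ominus>\<^bsub>Uq\<^esub> ucls x = ucls (- x)"
  unfolding Uq_def by (rule ui.Quot_simps ui.Quot_a_inv)+

lemma Uq_ring: "ring Uq"
  unfolding Uq_def by (rule ui.Quot_ring)

definition ugens :: "falg set" where
  "ugens = cst ` Aset \<union> range (\<lambda>a. fgen (K a)) \<union> range (\<lambda>a. fgen (Kinv a))
      \<union> {divpow E a n | a n. n \<ge> 1} \<union> {divpow F a n | a n. n \<ge> 1}"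

lemma carrier_UA: "carrier UA = generate_ring Uq (ucls ` ugens)"
  by (simp add: UA_def ugens_def)

lemma UA_simps [simp]:
  "x \<otimes>\<^bsub>UA\<^esub> y = x \<otimes>\<^bsub>Uq\<^esub> y" "x \<oplus>\<^bsub>UA\<^esub> y = x \<oplus>\<^bsub>Uq\<^esub> y" "\<one>\<^bsub>UA\<^esub> = ucls 1" "\<zero>\<^bsub>UA\<^esub> = ucls 0"
  by (simp_all add: UA_def)

lemma UA_ring: "ring UA"
  using ring.generate_ring_is_ring[OF Uq_ring, of "ucls ` ugens"]
  by (simp add: UA_def ugens_def image_subset_iff)

lemma UA_closed:
  "x \<in> ugens \<Longrightarrow> ucls x \<in> carrier UA" "ucls 1 \<in> carrier UA"
  "ucls x \<in> carrier UA \<Longrightarrow> ucls (- x) \<in> carrier UA"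
  "ucls x \<in> carrier UA \<Longrightarrow> ucls y \<in> carrier UA \<Longrightarrow> ucls (x + y) \<in> carrier UA"
  "ucls x \<in> carrier UA \<Longrightarrow> ucls y \<in> carrier UA \<Longrightarrow> ucls (x * y) \<in> carrier UA"
  unfolding carrier_UA
  using generate_ring.one[of Uq "ucls ` ugens"] generate_ring.a_inv[of "ucls x" Uq "ucls ` ugens"]
    generate_ring.eng_add[of "ucls x" Uq "ucls ` ugens" "ucls y"]
    generate_ring.eng_mult[of "ucls x" Uq "ucls ` ugens" "ucls y"]
  by (auto intro: generate_ring.incl)

lemma UA_power: "ucls x \<in> carrier UA \<Longrightarrow> ucls (x ^ n) \<in> carrier UA"
  by (induction n) (auto intro: UA_closed)

lemma divpow_0: "divpow Z a 0 = 1"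
  by (simp add: divpow_def qfact_def)

lemma UA_gens:
  "c \<in> Aset \<Longrightarrow> ucls (cst c) \<in> carrier UA" "ucls (fgen (K a)) \<in> carrier UA"
  "ucls (fgen (Kinv a)) \<in> carrier UA" "ucls (divpow E a n) \<in> carrier UA"
  "ucls (divpow F a n) \<in> carrier UA"
proof -
  have "ucls (divpow E a n) \<in> carrier UA" "ucls (divpow F a n) \<in> carrier UA" if "n \<ge> 1"
    using that unfolding ugens_def by (intro UA_closed(1); unfold ugens_def; blast)+
  moreover have "ucls (divpow E a n) \<in> carrier UA" "ucls (divpow F a n) \<in> carrier UA" if "n = 0"
    using that by (simp_all add: divpow_0 UA_closed)
  ultimately show "ucls (divpow E a n) \<in> carrier UA" "ucls (divpow F a n) \<in> carrier UA"
    by (cases n; simp)+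
qed (auto intro!: UA_closed(1) simp: ugens_def)

lemma UA_rep: "u \<in> carrier UA \<Longrightarrow> ucls (urep u) = u"
proof -
  assume "u \<in> carrier UA"
  hence "u \<in> carrier Uq"
    using ring.generate_ring_incl[OF Uq_ring, of "ucls ` ugens"] by (auto simp: carrier_UA image_subset_iff)
  then obtain x where "u = ucls x" by auto
  thus ?thesis using urep_mem[of x] by (simp add: ui.cls_eq_iff)
qed

text \<open>The rule \<open>congr\<close> accounts for the choice of a representative: the integral form consists of classes,
  while \<open>P\<close> speaks about elements of the free algebra.\<close>

lemma UA_induct [consumes 1, case_names congr one gen minus add mult]:
  assumes "ucls x \<in> carrier UA"
    and "\<And>x y. x - y \<in> uideal \<Longrightarrow> P y \<Longrightarrow> P x"
    and "P 1" "\<And>x. x \<in> ugens \<Longrightarrow> P x" "\<And>x. P x \<Longrightarrow> P (- x)"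
    "\<And>x y. P x \<Longrightarrow> P y \<Longrightarrow> P (x + y)" "\<And>x y. P x \<Longrightarrow> P y \<Longrightarrow> P (x * y)"
  shows "P x"
proof -
  have "\<exists>y. u = ucls y \<and> P y" if "u \<in> carrier UA" for u
    using that unfolding carrier_UA
  proof (induction u rule: generate_ring.induct)
    case one
    thus ?case using assms(3) by (intro exI[of _ 1]) simp
  next
    case (incl h)
    thus ?case using assms(4) by auto
  next
    case (a_inv h)
    then obtain y where "h = ucls y" "P y" by blast
    thus ?case using assms(5) by (intro exI[of _ "- y"]) simp
  next
    case (eng_add h1 h2)
    then obtain y1 y2 where "h1 = ucls y1" "P y1" "h2 = ucls y2" "P y2" by blast
    thus ?case using assms(6) by (intro exI[of _ "y1 + y2"]) simp
  next
    case (eng_mult h1 h2)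
    then obtain y1 y2 where "h1 = ucls y1" "P y1" "h2 = ucls y2" "P y2" by blast
    thus ?case using assms(7) by (intro exI[of _ "y1 * y2"]) simp
  qed
  from this[OF assms(1)] obtain y where "ucls x = ucls y" "P y" by blast
  thus ?thesis using assms(2)[of x y] by (simp add: ui.cls_eq_iff)
qed

text \<open>The image of the tensor square of the integral form in \<open>U \<otimes> U\<close>.\<close>

inductive_set tens_UA :: "uq2 set" where
  base: "ucls x \<in> carrier UA \<Longrightarrow> ucls y \<in> carrier UA \<Longrightarrow> e1 x * e2 y \<in> tens_UA"
| add: "z \<in> tens_UA \<Longrightarrow> w \<in> tens_UA \<Longrightarrow> z + w \<in> tens_UA"

lemma e_minus: "e1 (- x) = - e1 x"
  by (simp add: ftens_simps \<pi>_hom)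

lemma tens_UA_minus: "z \<in> tens_UA \<Longrightarrow> - z \<in> tens_UA"
proof (induction rule: tens_UA.induct)
  case (base x y)
  have "- (e1 x * e2 y) = e1 (- x) * e2 y" by (simp add: e_minus)
  thus ?case using base by (simp only: tens_UA.base UA_closed(3))
next
  case (add z w)
  thus ?case using tens_UA.add[of "- z" "- w"] by simp
qed

lemma tens_UA_mult:
  assumes "z \<in> tens_UA" "w \<in> tens_UA"
  shows "z * w \<in> tens_UA"
  using assms
proof (induction z rule: tens_UA.induct)
  case (base x y)
  from base(3) show ?case
  proof (induction w rule: tens_UA.induct)
    case (base x' y')
    have "e1 x * e2 y * (e1 x' * e2 y') = e1 x * (e2 y * e1 x') * e2 y'"
      by (simp only: mult.assoc)
    also have "\<dots> = e1 (x * x') * e2 (y * y')"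
      by (simp only: e_comm e_hom mult.assoc)
    finally show ?case using base \<open>ucls x \<in> carrier UA\<close> \<open>ucls y \<in> carrier UA\<close>
      by (simp only: tens_UA.base UA_closed(5))
  qed (auto simp: distrib_left intro: tens_UA.add)
qed (auto simp: distrib_right intro: tens_UA.add)

lemma tens_UA_sum: "finite A \<Longrightarrow> (\<And>i. i \<in> A \<Longrightarrow> f i \<in> tens_UA) \<Longrightarrow> sum f A \<in> tens_UA"
proof (induction A rule: finite_induct)
  case empty
  have "e1 (1 + - 1) * e2 1 \<in> tens_UA" by (intro tens_UA.base UA_closed)
  thus ?case by (simp add: ftens_simps \<pi>_hom)
qed (auto intro: tens_UA.add)

lemma tens_UA_list:
  assumes "z \<in> tens_UA"
  shows "\<exists>l. set l \<subseteq> carrier UA \<times> carrier UA \<and> z = (\<Sum>(a, b)\<leftarrow>l. e1 (urep a) * e2 (urep b))"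
  using assms
proof (induction rule: tens_UA.induct)
  case (base x y)
  have "e1 (urep (ucls x)) = e1 x" "e2 (urep (ucls y)) = e2 y"
    using e_uideal[OF urep_mem[of x]] e_uideal[OF urep_mem[of y]] by (simp_all add: e_hom)
  thus ?case using base by (intro exI[of _ "[(ucls x, ucls y)]"]) simp
next
  case (add z w)
  then obtain l m where
    "set l \<subseteq> carrier UA \<times> carrier UA" "z = (\<Sum>(a, b)\<leftarrow>l. e1 (urep a) * e2 (urep b))"
    "set m \<subseteq> carrier UA \<times> carrier UA" "w = (\<Sum>(a, b)\<leftarrow>m. e1 (urep a) * e2 (urep b))"
    by blast
  thus ?case by (intro exI[of _ "l @ m"]) simp
qed

definition dpow :: "Kq \<Rightarrow> uq2 \<Rightarrow> nat \<Rightarrow> uq2" where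
  "dpow b z n = scal (1 / qfact b n) * z ^ n"

lemma qfact_Suc: "qfact b (Suc n) = qint b (Suc n) * qfact b n"
  by (simp add: qfact_def mult.commute)

lemma qint_0: "qint b 0 = 0"
  by (simp add: qint_def)

lemma qint_shift:
  assumes "b \<noteq> 0"
  shows "b ^ k * qint b (m + k) = qint b m + b ^ (m + k) * qint b k"
proof -
  have "b ^ k * (b ^ (m + k) - inverse b ^ (m + k))
      = b ^ m - inverse b ^ m + b ^ (m + k) * (b ^ k - inverse b ^ k)"
    using assms by (simp add: field_simps power_add power_inverse)
  thus ?thesis unfolding qint_def by (metis add_divide_distrib times_divide_eq_right)
qed

text \<open>The \<open>q\<close>-binomial theorem in terms of divided powers: if \<open>y x = b\<^sup>2 x y\<close>, then
  \<open>(x + y)\<^sup>n / [n]! = \<Sum>\<^sub>k b\<^bsup>k(n-k)\<^esup> x\<^bsup>n-k\<^esup>/[n-k]! y\<^sup>k/[k]!\<close>. In this form no \<open>q\<close>-binomial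
  coefficients occur, and the induction step is the identity
  \<open>b\<^sup>k [m + k] = [m] + b\<^bsup>m+k\<^esup> [k]\<close>.\<close>

lemma qbinomial:
  fixes x y :: uq2
  assumes b: "b \<noteq> 0" "\<And>n. qfact b n \<noteq> 0" and yx: "y * x = scal (b ^ 2) * (x * y)"
  shows "dpow b (x + y) n = (\<Sum>k\<le>n. scal (b ^ (k * (n - k))) * (dpow b x (n - k) * dpow b y k))"
proof (induction n)
  case 0
  show ?case by (simp add: dpow_def qfact_def)
next
  case (Suc n)
  have sc: "z * (scal c * w) = scal c * (z * w)" for z w c
    using scal.c_central[of c z] by (simp flip: mult.assoc)
  have ss: "scal c * (scal d * w) = scal (c * d) * w" for c d w
    by (simp add: scal.c_mult mult.assoc)
  have q0: "qint b (Suc m) \<noteq> 0" for m using b(2)[of "Suc m"] by (simp add: qfact_Suc)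
  have step: "z * dpow b z m = scal (qint b (Suc m)) * dpow b z (Suc m)" for z m
  proof -
    have "z * dpow b z m = scal (1 / qfact b m) * z ^ Suc m"
      by (simp only: dpow_def sc[of z] power_Suc)
    also have "1 / qfact b m = qint b (Suc m) * (1 / qfact b (Suc m))"
      using q0[of m] by (simp add: qfact_Suc)
    finally show ?thesis by (simp only: dpow_def ss)
  qed
  have yxn: "y * x ^ m = scal (b ^ (2 * m)) * (x ^ m * y)" for m
  proof (induction m)
    case (Suc m)
    have b2: "b ^ 2 * b ^ (2 * m) = b ^ (2 * Suc m)" by (simp flip: power_add)
    have "y * x ^ Suc m = scal (b ^ 2) * (x * (y * x ^ m))"
      using mult_left_assoc[OF yx, of "x ^ m"] by (simp only: mult.assoc power_Suc)
    also have "\<dots> = scal (b ^ (2 * Suc m)) * (x ^ Suc m * y)"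
      by (simp only: Suc.IH sc[of x] ss mult.assoc power_Suc b2)
    finally show ?case .
  qed simp
  have ydx: "y * dpow b x m = scal (b ^ (2 * m)) * (dpow b x m * y)" for m
  proof -
    have "y * dpow b x m = scal (1 / qfact b m * b ^ (2 * m)) * (x ^ m * y)"
      by (simp only: dpow_def sc[of y] ss yxn)
    also have "1 / qfact b m * b ^ (2 * m) = b ^ (2 * m) * (1 / qfact b m)" by simp
    finally show ?thesis by (simp only: dpow_def ss mult.assoc)
  qed
  let ?D = "\<lambda>k. dpow b x (Suc n - k) * dpow b y k"
  have X: "x * (\<Sum>k\<le>n. scal (b ^ (k * (n - k))) * (dpow b x (n - k) * dpow b y k))
      = (\<Sum>k\<le>Suc n. scal (b ^ (k * (n - k)) * qint b (Suc n - k)) * ?D k)"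
  proof -
    have "x * (scal (b ^ (k * (n - k))) * (dpow b x (n - k) * dpow b y k))
        = scal (b ^ (k * (n - k)) * qint b (Suc n - k)) * ?D k" if "k \<le> n" for k
      using that
      by (simp only: sc[of x] mult_left_assoc[OF step] ss mult.assoc Suc_diff_le)
    thus ?thesis by (simp add: sum_distrib_left qint_0 \<pi>_hom)
  qed
  have Y: "y * (\<Sum>k\<le>n. scal (b ^ (k * (n - k))) * (dpow b x (n - k) * dpow b y k))
      = (\<Sum>k\<le>Suc n. scal (b ^ ((k + 1) * (Suc n - k)) * qint b k) * ?D k)"
  proof -
    have "y * (scal (b ^ (k * (n - k))) * (dpow b x (n - k) * dpow b y k))
        = scal (b ^ ((Suc k + 1) * (Suc n - Suc k)) * qint b (Suc k)) * ?D (Suc k)" if "k \<le> n" for k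
    proof -
      have "y * (scal (b ^ (k * (n - k))) * (dpow b x (n - k) * dpow b y k))
          = scal (b ^ (k * (n - k)) * b ^ (2 * (n - k))) * (dpow b x (n - k) * (y * dpow b y k))"
        by (simp only: sc[of y] ss mult_left_assoc[OF ydx] mult.assoc)
      also have "\<dots> = scal (b ^ (k * (n - k)) * b ^ (2 * (n - k)) * qint b (Suc k)) * ?D (Suc k)"
        by (simp only: step sc[of "dpow b x _"] ss) simp
      also have "b ^ (k * (n - k)) * b ^ (2 * (n - k)) = b ^ ((Suc k + 1) * (Suc n - Suc k))"
      proof -
        have "k * (n - k) + 2 * (n - k) = (Suc k + 1) * (Suc n - Suc k)"
          by (simp only: diff_Suc_Suc add_mult_distrib[symmetric]) simp
        thus ?thesis by (simp only: power_add[symmetric])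
      qed
      finally show ?thesis .
    qed
    thus ?thesis by (simp add: sum_distrib_left sum.atMost_Suc_shift qint_0 \<pi>_hom del: sum.atMost_Suc)
  qed
  have coef: "b ^ (k * (n - k)) * qint b (Suc n - k) + b ^ ((k + 1) * (Suc n - k)) * qint b k
      = qint b (Suc n) * b ^ (k * (Suc n - k))" if "k \<le> Suc n" for k
  proof (cases "k \<le> n")
    case True
    then obtain m where n: "n = m + k" by (metis add.commute le_Suc_ex)
    have "b ^ (k * m) * (b ^ k * qint b (Suc m + k))
        = b ^ (k * m) * (qint b (Suc m) + b ^ (Suc m + k) * qint b k)"
      using qint_shift[OF b(1), of k "Suc m"] by simp
    thus ?thesis by (simp add: n algebra_simps power_add Suc_diff_le)
  next
    case False
    hence "k = Suc n" using that by simp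
    thus ?thesis by (simp add: qint_0)
  qed
  have "scal (qint b (Suc n)) * dpow b (x + y) (Suc n) = (x + y) * dpow b (x + y) n"
    by (simp add: step)
  also have "\<dots> = (\<Sum>k\<le>Suc n. scal (qint b (Suc n) * b ^ (k * (Suc n - k))) * ?D k)"
    unfolding Suc.IH distrib_right X Y
    by (subst sum.distrib[symmetric], intro sum.cong refl)
      (simp only: coef atMost_iff distrib_right[symmetric] scal.c_add[symmetric])
  also have "\<dots> = scal (qint b (Suc n)) * (\<Sum>k\<le>Suc n. scal (b ^ (k * (Suc n - k))) * ?D k)"
    by (simp only: sum_distrib_left ss)
  finally have "scal (1 / qint b (Suc n)) * (scal (qint b (Suc n)) * dpow b (x + y) (Suc n))
      = scal (1 / qint b (Suc n)) * (scal (qint b (Suc n)) *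
          (\<Sum>k\<le>Suc n. scal (b ^ (k * (Suc n - k))) * ?D k))" by simp
  thus ?case using q0[of n] by (simp only: ss) simp
qed

lemma Aset_qroot [simp, intro]: "qroot a \<in> Aset"
  by (cases a) auto

lemma qroot_square: "qv powi rootform a a = qroot a ^ 2"
  by (cases a) (simp_all flip: power_mult)

lemma e12_power: "(e1 x * e2 y) ^ n = e1 (x ^ n) * e2 (y ^ n)"
  by (simp only: \<pi>_ftens[symmetric] \<pi>_power[symmetric] ftens_pow)

text \<open>With \<open>x = E\<^sub>a \<otimes> 1\<close> and \<open>y = K\<^sub>a \<otimes> E\<^sub>a\<close> one has \<open>y x = q\<^sub>a\<^sup>2 x y\<close>, so the \<open>q\<close>-binomial theorem
  writes the divided power of \<open>\<Delta>(E\<^sub>a) = x + y\<close> in terms of divided powers of \<open>x\<close> and \<open>y\<close>, which have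
  integral factors. For \<open>F\<^sub>a\<close> take \<open>x = 1 \<otimes> F\<^sub>a\<close> and \<open>y = F\<^sub>a \<otimes> K\<^sub>a\<inverse>\<close>.\<close>

lemma divpow_tens:
  "piD (divpow E a n) \<in> tens_UA" "piD (divpow F a n) \<in> tens_UA"
proof -
  let ?b = "qroot a"
  have sc: "z * (scal c * w) = scal c * (z * w)" for z w c
    using scal.c_central[of c z] by (simp flip: mult.assoc)
  have piD_div: "piD (divpow Z a n) = dpow ?b (piD (fgen (Z a))) n" for Z
    by (simp add: divpow_def dpow_def cst.fext_hom \<pi>_hom \<pi>_power)
  have e_div: "dpow ?b (e1 (fgen (Z a))) m = e1 (divpow Z a m)"
    "dpow ?b (e2 (fgen (Z a))) m = e2 (divpow Z a m)" for Z m
    by (simp_all add: divpow_def dpow_def e_hom)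
  note binom = qbinomial[OF qroot_nonzero qfact_nonzero]
  show "piD (divpow E a n) \<in> tens_UA"
  proof -
    let ?x = "e1 (fgen (E a))" and ?y = "e1 (fgen (K a)) * e2 (fgen (E a))"
    have "?y * ?x = scal (?b ^ 2) * (?x * ?y)"
      by (simp only: mult.assoc e_comm mult_left_assoc[OF e1_rels(5)[of a a]] qroot_square)
    from binom[OF this, of n] have eq: "piD (divpow E a n) =
        (\<Sum>k\<le>n. scal (?b ^ (k * (n - k))) * (dpow ?b ?x (n - k) * dpow ?b ?y k))"
      by (simp only: piD_div piD_gen)
    have "scal (?b ^ (k * (n - k))) * (dpow ?b ?x (n - k) * dpow ?b ?y k)
        = e1 (cst (?b ^ (k * (n - k))) * divpow E a (n - k) * fgen (K a) ^ k) * e2 (divpow E a k)" for k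
    proof -
      have "dpow ?b ?y k = e1 (fgen (K a) ^ k) * e2 (divpow E a k)"
        by (simp only: dpow_def e12_power divpow_def e_hom sc[of "e1 (fgen (K a)) ^ k"])
      thus ?thesis by (simp only: e_div(1) e_hom mult.assoc)
    qed
    thus ?thesis unfolding eq
      by (intro tens_UA_sum) (auto intro!: tens_UA.base UA_closed(5) UA_power UA_gens)
  qed
  show "piD (divpow F a n) \<in> tens_UA"
  proof -
    let ?x = "e2 (fgen (F a))" and ?y = "e2 (fgen (Kinv a)) * e1 (fgen (F a))"
    have "?y * ?x = scal (?b ^ 2) * (?x * ?y)"
      by (simp only: mult.assoc e_comm[symmetric] mult_left_assoc[OF e2_rels(8)[of a a]] qroot_square)
    from binom[OF this, of n] have eq: "piD (divpow F a n) =
        (\<Sum>k\<le>n. scal (?b ^ (k * (n - k))) * (dpow ?b ?x (n - k) * dpow ?b ?y k))"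
      by (simp only: piD_div piD_gen)
    have "scal (?b ^ (k * (n - k))) * (dpow ?b ?x (n - k) * dpow ?b ?y k)
        = e1 (cst (?b ^ (k * (n - k))) * divpow F a k) * e2 (divpow F a (n - k) * fgen (Kinv a) ^ k)" for k
    proof -
      have y: "dpow ?b ?y k = e2 (fgen (Kinv a) ^ k) * e1 (divpow F a k)"
        by (simp only: dpow_def e_comm e12_power) (simp only: e_hom divpow_def mult.assoc e_comm)
      have "dpow ?b ?x (n - k) * dpow ?b ?y k
          = e1 (divpow F a k) * e2 (divpow F a (n - k) * fgen (Kinv a) ^ k)"
        unfolding y e_div(2)
        by (simp only: mult.assoc[symmetric] e_hom(7)[symmetric] e_comm)
          (simp only: e_hom mult.assoc)
      thus ?thesis by (simp only: e_hom mult.assoc)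
    qed
    thus ?thesis unfolding eq
      by (intro tens_UA_sum) (auto intro!: tens_UA.base UA_closed(5) UA_power UA_gens)
  qed
qed

lemma UA_one: "ucls 1 \<in> carrier UA"
  by (rule UA_closed)

text \<open>The integral form is a Hopf subalgebra: the elements with coproduct in the span of
  \<open>u \<otimes> u'\<close> form a subring, and it contains the generators.\<close>

lemma UA_coproduct:
  assumes "ucls x \<in> carrier UA"
  shows "piD x \<in> tens_UA"
  using assms
proof (induction x rule: UA_induct)
  case (congr x y)
  have "piD x = piD y" using piD_uideal[OF congr(1)] by (simp add: piD_hom)
  thus ?case using congr by simp
next
  case one
  have "e1 1 * e2 1 \<in> tens_UA" by (intro tens_UA.base UA_one)
  thus ?case by (simp add: piD_hom e_hom)
next
  case (gen x)
  have 1: "e1 (cst c) * e2 1 \<in> tens_UA" if "c \<in> Aset" for c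
    using that by (intro tens_UA.base UA_one UA_gens)
  have 2: "e1 (fgen (K a)) * e2 (fgen (K a)) \<in> tens_UA" "e1 (fgen (Kinv a)) * e2 (fgen (Kinv a)) \<in> tens_UA" for a
    by (intro tens_UA.base UA_gens)+
  from gen show ?case
    unfolding ugens_def using 1 2 divpow_tens by (auto simp: piD_hom(4) piD_gen e_hom)
next
  case (minus x)
  thus ?case by (simp add: cst.fext_minus \<pi>_hom tens_UA_minus)
qed (simp_all add: piD_hom tens_UA.add tens_UA_mult)

lemma UU_sum:
  "foldr (\<lambda>(x, y) s. utens x y \<oplus>\<^bsub>UU\<^esub> s) l \<zero>\<^bsub>UU\<^esub> = uucls (\<Sum>(x, y)\<leftarrow>l. ftens (urep x) (urep y))"
  by (induction l) (auto simp: UU_def uui.Quot_simps utens_def)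

text \<open>A decomposition as required in the definition of \<open>sweedler\<close> exists by the previous lemma, so the chosen
  one has the two required properties.\<close>

lemma sweedler:
  assumes "u \<in> carrier UA"
  shows "set (sweedler u) \<subseteq> carrier UA \<times> carrier UA"
    and "Delta (urep u) - (\<Sum>(x, y)\<leftarrow>sweedler u. ftens (urep x) (urep y)) \<in> uuideal"
proof -
  have \<pi>_list: "\<pi> (\<Sum>(x, y)\<leftarrow>l. ftens (urep x) (urep y)) = (\<Sum>(x, y)\<leftarrow>l. e1 (urep x) * e2 (urep y))" for l
    by (induction l) (auto simp: \<pi>_hom \<pi>_ftens[of "urep _" "urep _"])
  have "piD (urep u) \<in> tens_UA" by (rule UA_coproduct) (simp add: UA_rep assms)
  then obtain l where l: "set l \<subseteq> carrier UA \<times> carrier UA"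
    "piD (urep u) = \<pi> (\<Sum>(x, y)\<leftarrow>l. ftens (urep x) (urep y))"
    using tens_UA_list by (metis \<pi>_list)
  have "ucop u = foldr (\<lambda>(x, y) s. utens x y \<oplus>\<^bsub>UU\<^esub> s) l \<zero>\<^bsub>UU\<^esub>"
    using l(2) by (simp add: UU_sum ucop_def uui.cls_eq_iff \<pi>_eq_iff)
  hence *: "set (sweedler u) \<subseteq> carrier UA \<times> carrier UA \<and>
     ucop u = foldr (\<lambda>(x, y) s. utens x y \<oplus>\<^bsub>UU\<^esub> s) (sweedler u) \<zero>\<^bsub>UU\<^esub>"
    unfolding sweedler_def using l(1) by (intro someI[of "\<lambda>l. set l \<subseteq> carrier UA \<times> carrier UA \<and>
     ucop u = foldr (\<lambda>(x, y) s. utens x y \<oplus>\<^bsub>UU\<^esub> s) l \<zero>\<^bsub>UU\<^esub>"] conjI)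
  show "set (sweedler u) \<subseteq> carrier UA \<times> carrier UA" using * by blast
  show "Delta (urep u) - (\<Sum>(x, y)\<leftarrow>sweedler u. ftens (urep x) (urep y)) \<in> uuideal"
    using * by (simp add: UU_sum ucop_def uui.cls_eq_iff)
qed

abbreviation uact :: "falg set \<Rightarrow> vec \<Rightarrow> vec" where
  "uact u \<equiv> Act (urep u)"

text \<open>Whatever decomposition of \<open>\<Delta>(u)\<close> the choice operator picks, its effect on a tensor product
  of two modules on words is the same, because two decompositions differ by an element of the
  two-factor ideal, which acts by zero.\<close>

lemma uact_conc:
  assumes "u \<in> carrier UA" "x \<in> Qspan (words v)" "y \<in> Qspan (words w)"
  shows "uact u (conc x y) = (\<Sum>(a, b)\<leftarrow>sweedler u. conc (uact a x) (uact b y))"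
proof -
  have l: "Act2 (\<Sum>(a, b)\<leftarrow>l. ftens (urep a) (urep b)) x y
      = (\<Sum>(a, b)\<leftarrow>l. conc (uact a x) (uact b y))" for l
    by (induction l) (auto simp: Act2_add Act2_ftens)
  have "Act2 (Delta (urep u) - (\<Sum>(a, b)\<leftarrow>sweedler u. ftens (urep a) (urep b))) x y = 0"
    using assms by (intro Act2_uuideal_zero sweedler) (auto intro: Act_uideal)
  thus ?thesis by (simp add: Act_conc Act2_diff l)
qed

lemma Aspan_sum_list: "(\<And>x. x \<in> set l \<Longrightarrow> f x \<in> Aspan X') \<Longrightarrow> sum_list (map f l) \<in> Aspan X'"
  by (induction l) auto

lemma Aspan_basis:
  assumes "v \<in> Aspan X'" "\<And>k. k \<in> X' \<Longrightarrow> Act x (sng k 1) \<in> Aspan D"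
  shows "Act x v \<in> Aspan D"
proof -
  have "Act x v = plin (\<lambda>k. Act x (sng k 1)) v" by (simp flip: Act_plin)
  thus ?thesis using Aspan_plin[OF assms] by simp
qed

lemma divpow_letter:
  assumes "x \<in> Wt c" "Z = E \<or> Z = F"
  shows "Act (divpow Z a n) (sng [x] 1) \<in> Aspan (words [c])"
proof -
  have g1: "gact (Z a) v \<in> Aspan (words [c])" if "v \<in> Aspan (words [c])" for v
    using that by (rule Aspan_plin) (rule ga_Aspan)
  have x: "sng [x] 1 \<in> Aspan (words [c])" using assms by (intro Aspan_single) (auto simp: words_single)
  have b: "qroot a - inverse (qroot a) \<noteq> 0" by (rule qv_diff_nonzero)
  have q1: "qint (qroot a) 1 = 1" using b by (simp add: qint_def)
  have q2: "qfact (qroot S) 2 = qn 2" using q1[unfolded qint_def] qint_0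
    by (simp add: qfact_def numeral_2_eq_2 qint_def)
  consider "n = 0" | "n = 1" | "n = 2" | m where "n = Suc (Suc (Suc m))"
    by (metis One_nat_def Suc_1 not0_implies_Suc)
  thus ?thesis
  proof cases
    case 1
    thus ?thesis using x by (simp add: divpow_0 Act_one)
  next
    case 2
    thus ?thesis using g1[OF x] q1 by (simp add: divpow_def qfact_def Act_fgen)
  next
    case 3
    \<comment> \<open>Two steps give a nonzero vector only from one end to the other of the string
      of weights \<open>(2, - 1), (0, 0), (- 2, 1)\<close>, with the factor \<open>[2]\<close> that the divided power removes.\<close>
    have "gact (Z a) (gact (Z a) (sng [x] 1)) = 0 \<or>
        a = S \<and> (\<exists>y\<in>Wt c. gact (Z a) (gact (Z a) (sng [x] 1)) = sng [y] (qn 2))"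
      using assms by (cases c; cases a) (auto simp: letter_simps)
    thus ?thesis
    proof (elim disjE conjE bexE)
      fix y assume y: "y \<in> Wt c" "a = S" "gact (Z a) (gact (Z a) (sng [x] 1)) = sng [y] (qn 2)"
      have "Act (divpow Z a n) (sng [x] 1) = sng [y] 1"
        using 3 y q2 qfact_nonzero[of S 2]
        by (simp add: divpow_def Act_cst_mult Act_cst Act_mult Act_fgen power2_eq_square)
      thus ?thesis using y by (auto simp: words_single)
    qed (use 3 in \<open>simp add: divpow_def Act_cst_mult Act_cst Act_mult Act_fgen power2_eq_square\<close>)
  next
    case 4
    have "gact (Z a) (gact (Z a) (gact (Z a) (sng [x] 1))) = 0"
      using assms by (cases c; cases a) (auto simp: letter_simps plin_psc)
    moreover have "fgen (Z a) ^ n = fgen (Z a) ^ m * (fgen (Z a) * (fgen (Z a) * fgen (Z a)))"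
      by (simp add: 4 power_Suc2 mult.assoc del: power_Suc)
    ultimately show ?thesis by (simp add: divpow_def Act_mult Act_fgen)
  qed
qed

lemma divpow_Nil:
  assumes "Z = E \<or> Z = F" "n \<ge> 1"
  shows "Act (divpow Z a n) (sng [] c) = 0"
proof -
  obtain m where n: "n = Suc m" using assms(2) by (cases n) auto
  have z: "gact (Z a) (sng [] c) = 0" using assms by auto
  show ?thesis unfolding divpow_def n power_Suc2 Act_mult Act_fgen z by simp
qed

text \<open>The weight strings of a single letter have at most three vectors, so that only the second divided
  powers of \<open>E\<^sub>s\<close> and \<open>F\<^sub>s\<close> need attention there. Longer words follow by induction, because the coproduct decomposes inside the integral form.\<close>

lemma Act_Aspan:
  assumes "ucls x \<in> carrier UA" "v \<in> Aspan (words w)"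
  shows "Act x v \<in> Aspan (words w)"
proof -
  have *: "\<forall>v\<in>Aspan (words w). Act x v \<in> Aspan (words w)"
    if x: "ucls x \<in> carrier UA" and
      div: "\<And>Z a n v. Z = E \<or> Z = F \<Longrightarrow> n \<ge> 1 \<Longrightarrow> v \<in> Aspan (words w) \<Longrightarrow> Act (divpow Z a n) v \<in> Aspan (words w)"
    for x w
    using x
  proof (induction x rule: UA_induct)
    case (congr x y)
    thus ?case by (simp add: Act_congr[OF congr(1) Aspan_Qspan])
  next
    case (gen x)
    have "gact g v \<in> Aspan (words w)" if "v \<in> Aspan (words w)" for v g
      using that by (rule Aspan_plin) (rule ga_Aspan)
    thus ?case using gen div unfolding ugens_def by (auto simp: Act_cst Act_fgen)
  qed (auto simp: Act_one Act_minus Act_add Act_mult)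
  show ?thesis
    using assms
  proof (induction w arbitrary: x v)
    case Nil
    have "Act (divpow Z a n) v \<in> Aspan (words [])"
      if "Z = E \<or> Z = F" "n \<ge> 1" "v \<in> Aspan (words [])" for Z a n v
      using divpow_Nil[OF that(1,2)] Qspan_Nil[OF Aspan_Qspan[OF that(3)]] by (metis Aspan_zero)
    thus ?case using *[OF Nil(1)] Nil(2) by blast
  next
    case (Cons c w)
    have letter: "Act x v \<in> Aspan (words [c])" if "ucls x \<in> carrier UA" "v \<in> Aspan (words [c])" for x v
    proof -
      have "Act (divpow Z a n) v \<in> Aspan (words [c])"
        if Z: "Z = E \<or> Z = F" and v: "v \<in> Aspan (words [c])" for Z a n v
      proof (rule Aspan_basis[OF v])
        fix k assume "k \<in> words [c]"
        then obtain y where "k = [y]" "y \<in> Wt c" unfolding words_single by blast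
        thus "Act (divpow Z a n) (sng k 1) \<in> Aspan (words [c])" using divpow_letter[OF _ Z] by metis
      qed
      thus ?thesis using *[of x "[c]"] that by blast
    qed
    let ?u = "ucls x"
    show ?case
    proof (rule Aspan_basis[OF Cons.prems(2)])
      fix k assume "k \<in> words (c # w)"
      then obtain a m where k: "k = a # m" "a \<in> Wt c" "m \<in> words w"
        by (auto simp: words_def list_all2_Cons2)
      have am: "sng [a] 1 \<in> Aspan (words [c])" "sng m 1 \<in> Aspan (words w)" "sng k 1 \<in> Aspan (words (c # w))"
        using k \<open>k \<in> words (c # w)\<close> by (auto simp: words_single[of c])
      have "Act x (sng k 1) = uact ?u (conc (sng [a] 1) (sng m 1))"
        using am k by (simp add: Act_urep[OF Aspan_Qspan])
      also have "\<dots> = (\<Sum>(a', b)\<leftarrow>sweedler ?u. conc (uact a' (sng [a] 1)) (uact b (sng m 1)))"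
        by (rule uact_conc) (use Cons.prems am in \<open>auto intro: Aspan_Qspan\<close>)
      also have "\<dots> \<in> Aspan (words ([c] @ w))"
      proof (intro Aspan_sum_list, clarify)
        fix a' b assume "(a', b) \<in> set (sweedler ?u)"
        hence "a' \<in> carrier UA" "b \<in> carrier UA" using sweedler(1)[OF Cons.prems(1)] by auto
        hence "ucls (urep a') \<in> carrier UA" "ucls (urep b) \<in> carrier UA" by (simp_all add: UA_rep)
        thus "conc (uact a' (sng [a] 1)) (uact b (sng m 1)) \<in> Aspan (words ([c] @ w))"
          using am by (intro Aspan_conc_words letter Cons.IH)
      qed
      finally show "Act x (sng k 1) \<in> Aspan (words (c # w))" by simp
    qed
  qed
qed


section \<open>Tensor products over the integral scalars\<close>

text \<open>The tensor product depends only on the additive groups and on the scalar action of \<open>\<A>\<close>.\<close>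

locale tens_pair =
  fixes M :: "'m umod" and N :: "'n umod"
  assumes abelian_M: "abelian_group M" and abelian_N: "abelian_group N"
    and scal_M: "a \<in> Aset \<Longrightarrow> x \<in> carrier M \<Longrightarrow> ascal M a x \<in> carrier M"
    and scal_N: "a \<in> Aset \<Longrightarrow> y \<in> carrier N \<Longrightarrow> ascal N a y \<in> carrier N"
begin

interpretation M: abelian_group M by (rule abelian_M)
interpretation N: abelian_group N by (rule abelian_N)

abbreviation "MN \<equiv> carrier M \<times> carrier N"

interpretation G: comm_group "tfree M N" by (rule abelian_free_Abelian_group)

lemma trels_sub: "trels M N \<subseteq> carrier (tfree M N)"
proof -
  have d: "supp (a - b) \<subseteq> D" if "supp a \<subseteq> D" "supp b \<subseteq> D" for a b :: "'c \<Rightarrow>\<^sub>0 int" and D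
    using that keys_diff[of a b] by blast
  have f: "supp (frag_of p) \<subseteq> D" if "p \<in> D" for p :: 'c and D
    using that by (simp add: keys_frag_of)
  have "supp h \<subseteq> MN" if "h \<in> trels M N" for h
    using that unfolding trels_def
    by (elim UnE CollectE exE conjE; simp only:; intro d f; simp add: scal_M scal_N)
  thus ?thesis by auto
qed

interpretation H: subgroup "tsub M N" "tfree M N"
  unfolding tsub_def by (rule G.generate_is_subgroup[OF trels_sub])

interpretation Hn: normal "tsub M N" "tfree M N"
  by (rule G.subgroup_imp_normal[OF H.subgroup_axioms])

interpretation Q: comm_group "tfree M N Mod tsub M N"
  by (rule G.abelian_FactGroup[OF H.subgroup_axioms])

definition tcls :: "('m \<times> 'n \<Rightarrow>\<^sub>0 int) \<Rightarrow> ('m, 'n) tens" where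
  "tcls r = tsub M N #>\<^bsub>tfree M N\<^esub> r"

lemma tgroup_simps:
  "carrier (tgroup M N) = tcls ` {r. supp r \<subseteq> MN}"
  "\<zero>\<^bsub>tgroup M N\<^esub> = tcls 0"
proof -
  show "carrier (tgroup M N) = tcls ` {r. supp r \<subseteq> MN}"
    by (auto simp: tgroup_def Let_def FactGroup_def RCOSETS_def tcls_def)
  have "tsub M N #>\<^bsub>tfree M N\<^esub> \<one>\<^bsub>tfree M N\<^esub> = tsub M N"
    by (rule G.coset_mult_one) (rule H.subset)
  thus "\<zero>\<^bsub>tgroup M N\<^esub> = tcls 0"
    by (simp add: tgroup_def Let_def FactGroup_def tcls_def)
qed

lemma tcls_add:
  assumes "supp r \<subseteq> MN" "supp s \<subseteq> MN"
  shows "tcls r \<oplus>\<^bsub>tgroup M N\<^esub> tcls s = tcls (r + s)"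
  using Hn.rcos_sum[of r s] assms by (simp add: tgroup_def Let_def FactGroup_def tcls_def)

lemma tcls_self: "supp r \<subseteq> MN \<Longrightarrow> r \<in> tcls r"
  using G.rcos_self[OF _ H.subgroup_axioms, of r] by (simp add: tcls_def)

lemma tcls_mem:
  assumes "supp r \<subseteq> MN" "s \<in> tcls r"
  shows "s - r \<in> tsub M N" "supp s \<subseteq> MN"
proof -
  obtain h where h: "h \<in> tsub M N" "s = h + r"
    using assms by (auto simp: tcls_def r_coset_def)
  thus "s - r \<in> tsub M N" by simp
  have "supp h \<subseteq> MN" using H.mem_carrier[OF h(1)] by simp
  thus "supp s \<subseteq> MN" using h assms keys_add[of h r] by auto
qed

lemma tcls_eqI:
  assumes "supp r \<subseteq> MN" "supp s \<subseteq> MN" "s - r \<in> tsub M N"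
  shows "tcls r = tcls s"
proof -
  have "s \<in> tcls r" using assms by (force simp: tcls_def r_coset_def)
  thus ?thesis using G.repr_independence[of s "tsub M N" r] H.subgroup_axioms assms
    by (simp add: tcls_def)
qed

lemma abelian_tgroup: "abelian_group (tgroup M N)"
proof -
  have eq: "add_monoid (tgroup M N) = tfree M N Mod tsub M N"
    by (simp add: tgroup_def Let_def)
  have "comm_group (add_monoid (tgroup M N))" unfolding eq by (rule Q.comm_group_axioms)
  thus ?thesis
    by (intro abelian_group.intro abelian_monoid.intro abelian_group_axioms.intro)
      (auto simp: comm_group_def)
qed

lemma tensor_simps:
  "carrier (tensor M N) = carrier (tgroup M N)" "x \<oplus>\<^bsub>tensor M N\<^esub> y = x \<oplus>\<^bsub>tgroup M N\<^esub> y"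
  "\<zero>\<^bsub>tensor M N\<^esub> = \<zero>\<^bsub>tgroup M N\<^esub>"
  by (simp_all add: tensor_def)

interpretation T: abelian_group "tgroup M N" by (rule abelian_tgroup)

lemma abelian_tensor: "abelian_group (tensor M N)"
proof (rule abelian_groupI)
  show "\<exists>y\<in>carrier (tensor M N). y \<oplus>\<^bsub>tensor M N\<^esub> x = \<zero>\<^bsub>tensor M N\<^esub>"
    if "x \<in> carrier (tensor M N)" for x
    using that T.l_neg T.a_inv_closed unfolding tensor_simps by blast
qed (simp_all add: tensor_simps T.a_ac)

lemma tpure_closed: "x \<in> carrier M \<Longrightarrow> y \<in> carrier N \<Longrightarrow> tpure M N x y \<in> carrier (tgroup M N)"
  by (auto simp: tgroup_simps tpure_def tcls_def keys_frag_of intro!: image_eqI)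

lemma tpure_tcls: "tpure M N x y = tcls (frag_of (x, y))"
  by (simp add: tpure_def tcls_def)

lemma tsub_trels: "h \<in> trels M N \<Longrightarrow> h \<in> tsub M N"
  unfolding tsub_def by (rule generate.incl)

lemma tpure_add_left:
  assumes "x \<in> carrier M" "x' \<in> carrier M" "y \<in> carrier N"
  shows "tpure M N (x \<oplus>\<^bsub>M\<^esub> x') y = tpure M N x y \<oplus>\<^bsub>tgroup M N\<^esub> tpure M N x' y"
proof -
  have "frag_of (x \<oplus>\<^bsub>M\<^esub> x', y) - frag_of (x, y) - frag_of (x', y) \<in> tsub M N"
    by (rule tsub_trels) (use assms in \<open>auto simp: trels_def\<close>)
  moreover have "supp (frag_of (x, y) + frag_of (x', y)) \<subseteq> MN"
    using keys_add[of "frag_of (x, y) :: _ \<Rightarrow>\<^sub>0 int" "frag_of (x', y)"] assms by (auto simp: keys_frag_of)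
  ultimately have "tcls (frag_of (x, y) + frag_of (x', y)) = tcls (frag_of (x \<oplus>\<^bsub>M\<^esub> x', y))"
    using assms by (intro tcls_eqI) (auto simp: keys_frag_of diff_diff_eq)
  thus ?thesis using assms by (simp add: tpure_tcls tcls_add keys_frag_of)
qed

lemma tpure_add_right:
  assumes "x \<in> carrier M" "y \<in> carrier N" "y' \<in> carrier N"
  shows "tpure M N x (y \<oplus>\<^bsub>N\<^esub> y') = tpure M N x y \<oplus>\<^bsub>tgroup M N\<^esub> tpure M N x y'"
proof -
  have "frag_of (x, y \<oplus>\<^bsub>N\<^esub> y') - frag_of (x, y) - frag_of (x, y') \<in> tsub M N"
    by (rule tsub_trels) (use assms in \<open>auto simp: trels_def\<close>)
  moreover have "supp (frag_of (x, y) + frag_of (x, y')) \<subseteq> MN"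
    using keys_add[of "frag_of (x, y) :: _ \<Rightarrow>\<^sub>0 int" "frag_of (x, y')"] assms by (auto simp: keys_frag_of)
  ultimately have "tcls (frag_of (x, y) + frag_of (x, y')) = tcls (frag_of (x, y \<oplus>\<^bsub>N\<^esub> y'))"
    using assms by (intro tcls_eqI) (auto simp: keys_frag_of diff_diff_eq)
  thus ?thesis using assms by (simp add: tpure_tcls tcls_add keys_frag_of)
qed

lemma tpure_scal:
  assumes "a \<in> Aset" "x \<in> carrier M" "y \<in> carrier N"
  shows "tpure M N (ascal M a x) y = tpure M N x (ascal N a y)"
proof -
  have "frag_of (ascal M a x, y) - frag_of (x, ascal N a y) \<in> tsub M N"
    by (rule tsub_trels) (use assms in \<open>auto simp: trels_def\<close>)
  thus ?thesis using assms unfolding tpure_tcls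
    by (intro tcls_eqI[symmetric]) (simp_all add: keys_frag_of scal_M scal_N)
qed

lemma tpure_minus:
  assumes "x \<in> carrier M" "y \<in> carrier N"
  shows "tpure M N (\<ominus>\<^bsub>M\<^esub> x) y = tcls (- frag_of (x, y))"
proof -
  have z: "tpure M N \<zero>\<^bsub>M\<^esub> y = \<zero>\<^bsub>tgroup M N\<^esub>"
    using tpure_add_left[of "\<zero>\<^bsub>M\<^esub>" "\<zero>\<^bsub>M\<^esub>" y] assms tpure_closed[of "\<zero>\<^bsub>M\<^esub>" y]
    by (simp add: T.add.r_cancel_one')
  have "tpure M N (\<ominus>\<^bsub>M\<^esub> x) y \<oplus>\<^bsub>tgroup M N\<^esub> tpure M N x y = \<zero>\<^bsub>tgroup M N\<^esub>"
    using tpure_add_left[of "\<ominus>\<^bsub>M\<^esub> x" x y] assms z by (simp add: M.l_neg)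
  moreover have "tcls (- frag_of (x, y)) \<oplus>\<^bsub>tgroup M N\<^esub> tpure M N x y = \<zero>\<^bsub>tgroup M N\<^esub>"
    using assms by (simp add: tpure_tcls tcls_add keys_frag_of tgroup_simps)
  moreover have "tcls (- frag_of (x, y)) \<in> carrier (tgroup M N)"
    using assms by (auto simp: tgroup_simps keys_frag_of)
  ultimately show ?thesis using assms tpure_closed by (metis T.minus_equality M.a_inv_closed)
qed

text \<open>Every element is a sum of pure tensors, since \<open>- (x \<otimes> y) = (- x) \<otimes> y\<close>.\<close>

lemma tensor_induct [consumes 1, case_names pure add]:
  assumes "Z \<in> carrier (tensor M N)"
    and pure: "\<And>x y. x \<in> carrier M \<Longrightarrow> y \<in> carrier N \<Longrightarrow> P (tpure M N x y)"
    and add: "\<And>Z W. Z \<in> carrier (tensor M N) \<Longrightarrow> W \<in> carrier (tensor M N) \<Longrightarrow> P Z \<Longrightarrow> P W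
      \<Longrightarrow> P (Z \<oplus>\<^bsub>tensor M N\<^esub> W)"
  shows "P Z"
proof -
  obtain r where r: "supp r \<subseteq> MN" "Z = tcls r"
    using assms(1) by (auto simp: tensor_simps tgroup_simps)
  have "P (tcls r) \<and> P (tcls (- r))"
    using r(1)
  proof (induction r rule: free_Abelian_group_induct[consumes 1, case_names zero diff frag])
    case zero
    have "tpure M N \<zero>\<^bsub>M\<^esub> \<zero>\<^bsub>N\<^esub> = \<zero>\<^bsub>tgroup M N\<^esub>"
      using tpure_add_left[of "\<zero>\<^bsub>M\<^esub>" "\<zero>\<^bsub>M\<^esub>" "\<zero>\<^bsub>N\<^esub>"] tpure_closed[of "\<zero>\<^bsub>M\<^esub>" "\<zero>\<^bsub>N\<^esub>"]
      by (simp add: T.add.r_cancel_one')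
    thus ?case using pure[of "\<zero>\<^bsub>M\<^esub>" "\<zero>\<^bsub>N\<^esub>"] by (simp add: tgroup_simps)
  next
    case (diff x y)
    have c: "tcls x \<in> carrier (tensor M N)" "tcls (- x) \<in> carrier (tensor M N)"
      "tcls y \<in> carrier (tensor M N)" "tcls (- y) \<in> carrier (tensor M N)"
      using diff(1,2) by (auto simp: tensor_simps tgroup_simps)
    have "tcls (x - y) = tcls x \<oplus>\<^bsub>tensor M N\<^esub> tcls (- y)" "tcls (- (x - y)) = tcls (- x) \<oplus>\<^bsub>tensor M N\<^esub> tcls y"
      using diff(1,2) by (simp_all add: tensor_simps tcls_add)
    thus ?case using diff(3,4) add c by simp
  next
    case (frag p)
    thus ?case using pure[of "fst p" "snd p"] pure[of "\<ominus>\<^bsub>M\<^esub> fst p" "snd p"]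
      by (auto simp: tpure_minus) (auto simp: tpure_tcls)
  qed
  thus ?thesis using r by simp
qed

definition balanced :: "('p, 'x) ring_scheme \<Rightarrow> ('m \<Rightarrow> 'n \<Rightarrow> 'p) \<Rightarrow> bool" where
  "balanced P f \<longleftrightarrow>
     (\<forall>x\<in>carrier M. \<forall>y\<in>carrier N. f x y \<in> carrier P) \<and>
     (\<forall>x\<in>carrier M. \<forall>x'\<in>carrier M. \<forall>y\<in>carrier N. f (x \<oplus>\<^bsub>M\<^esub> x') y = f x y \<oplus>\<^bsub>P\<^esub> f x' y) \<and>
     (\<forall>x\<in>carrier M. \<forall>y\<in>carrier N. \<forall>y'\<in>carrier N. f x (y \<oplus>\<^bsub>N\<^esub> y') = f x y \<oplus>\<^bsub>P\<^esub> f x y') \<and>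
     (\<forall>a\<in>Aset. \<forall>x\<in>carrier M. \<forall>y\<in>carrier N. f (ascal M a x) y = f x (ascal N a y))"

text \<open>The universal property: a balanced biadditive map kills the defining relations, so summing it
  over any representative gives the same value.\<close>

lemma
  fixes P :: "('p, 'x) ring_scheme"
  assumes P: "abelian_group P" and f: "balanced P f"
  shows tlift_closed: "Z \<in> carrier (tensor M N) \<Longrightarrow> tlift P f Z \<in> carrier P"
    and tlift_add: "Z \<in> carrier (tensor M N) \<Longrightarrow> W \<in> carrier (tensor M N) \<Longrightarrow>
      tlift P f (Z \<oplus>\<^bsub>tensor M N\<^esub> W) = tlift P f Z \<oplus>\<^bsub>P\<^esub> tlift P f W"
    and tlift_pure: "x \<in> carrier M \<Longrightarrow> y \<in> carrier N \<Longrightarrow> tlift P f (tpure M N x y) = f x y"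
proof -
  interpret P: abelian_group P by (rule P)
  define g where "g = (\<lambda>p. f (fst p) (snd p))"
  define ev where "ev r = (\<Oplus>\<^bsub>P\<^esub>k\<in>supp r. add_pow P (coef r k) (g k))" for r :: "'m \<times> 'n \<Rightarrow>\<^sub>0 int"
  have g: "g p \<in> carrier P" if "p \<in> MN" for p
    using f that by (auto simp: balanced_def g_def)
  have pw: "add_pow P (n) (g p) \<in> carrier P" if "p \<in> MN" for p and n :: int
    using g[OF that] by simp
  have z0: "add_pow P (0 :: int) x = \<zero>\<^bsub>P\<^esub>" for x
    by (simp add: add_pow_def int_pow_def nat_pow_def)
  have ev_sup: "ev r = (\<Oplus>\<^bsub>P\<^esub>k\<in>A. add_pow P (coef r k) (g k))" if "finite A" "supp r \<subseteq> A" "A \<subseteq> MN" for A r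
    unfolding ev_def using that pw
    by (intro P.add.finprod_mono_neutral_cong_left) (auto simp: in_keys_iff z0)
  have ev_closed: "ev r \<in> carrier P" if "supp r \<subseteq> MN" for r
    unfolding ev_def using that pw by (intro P.finsum_closed) auto
  have ev_add: "ev (r + s) = ev r \<oplus>\<^bsub>P\<^esub> ev s" if "supp r \<subseteq> MN" "supp s \<subseteq> MN" for r s
  proof -
    let ?A = "supp r \<union> supp s"
    have "ev (r + s) = (\<Oplus>\<^bsub>P\<^esub>k\<in>?A. add_pow P (coef (r + s) k) (g k))"
      by (rule ev_sup) (use that keys_add[of r s] in auto)
    also have "\<dots> = (\<Oplus>\<^bsub>P\<^esub>k\<in>?A. add_pow P (coef r k) (g k) \<oplus>\<^bsub>P\<^esub> add_pow P (coef s k) (g k))"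
      using that g pw by (intro P.finsum_cong') (auto simp: lookup_add P.add.int_pow_mult)
    also have "\<dots> = (\<Oplus>\<^bsub>P\<^esub>k\<in>?A. add_pow P (coef r k) (g k)) \<oplus>\<^bsub>P\<^esub> (\<Oplus>\<^bsub>P\<^esub>k\<in>?A. add_pow P (coef s k) (g k))"
      using that pw by (intro P.finsum_addf) auto
    also have "\<dots> = ev r \<oplus>\<^bsub>P\<^esub> ev s"
      using that by (subst (1 2) ev_sup[of ?A]) auto
    finally show ?thesis .
  qed
  have ev_frag: "ev (frag_of p) = g p" if "p \<in> MN" for p
    using g[OF that] by (simp add: ev_def keys_frag_of)
  have ev_0: "ev 0 = \<zero>\<^bsub>P\<^esub>" by (simp add: ev_def)
  have ev_minus: "ev (- r) = \<ominus>\<^bsub>P\<^esub> ev r" if "supp r \<subseteq> MN" for r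
    using ev_add[of "- r" r] ev_closed[of r] ev_closed[of "- r"] that
    by (metis P.minus_equality ev_0 keys_minus neg_eq_iff_add_eq_0 verit_minus_simplify(4))
  have ev_diff0: "ev (r - s) = \<zero>\<^bsub>P\<^esub>" if "supp r \<subseteq> MN" "supp s \<subseteq> MN" "ev r = ev s" for r s
    using ev_add[of r "- s"] ev_minus[of s] ev_closed[of s] that by (simp add: P.r_neg)
  have ev_rel: "ev h = \<zero>\<^bsub>P\<^esub>" if "h \<in> trels M N" for h
  proof -
    have d: "supp (frag_of p :: _ \<Rightarrow>\<^sub>0 int) \<subseteq> MN" if "p \<in> MN" for p using that by (simp add: keys_frag_of)
    have d2: "supp (frag_of p + frag_of p' :: _ \<Rightarrow>\<^sub>0 int) \<subseteq> MN" if "p \<in> MN" "p' \<in> MN" for p p'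
      using keys_add[of "frag_of p :: _ \<Rightarrow>\<^sub>0 int" "frag_of p'"] that by (auto simp: keys_frag_of)
    have f': "f x y \<in> carrier P" "f (x \<oplus>\<^bsub>M\<^esub> x') y = f x y \<oplus>\<^bsub>P\<^esub> f x' y"
      "f x (y \<oplus>\<^bsub>N\<^esub> y') = f x y \<oplus>\<^bsub>P\<^esub> f x y'" "a \<in> Aset \<Longrightarrow> f (ascal M a x) y = f x (ascal N a y)"
      if "x \<in> carrier M" "x' \<in> carrier M" "y \<in> carrier N" "y' \<in> carrier N" for x x' y y' a
      using f that unfolding balanced_def by blast+
    from that show ?thesis
      unfolding trels_def
    proof (elim UnE CollectE exE conjE)
      fix x x' y assume c: "x \<in> carrier M" "x' \<in> carrier M" "y \<in> carrier N"
        and h: "h = frag_of (x \<oplus>\<^bsub>M\<^esub> x', y) - frag_of (x, y) - frag_of (x', y)"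
      show ?thesis unfolding h diff_diff_eq
        by (rule ev_diff0[OF d d2]) (use c in \<open>simp_all add: ev_add d ev_frag g_def f'\<close>)
    next
      fix x y y' assume c: "x \<in> carrier M" "y \<in> carrier N" "y' \<in> carrier N"
        and h: "h = frag_of (x, y \<oplus>\<^bsub>N\<^esub> y') - frag_of (x, y) - frag_of (x, y')"
      show ?thesis unfolding h diff_diff_eq
        by (rule ev_diff0[OF d d2]) (use c in \<open>simp_all add: ev_add d ev_frag g_def f'\<close>)
    next
      fix a x y assume c: "a \<in> Aset" "x \<in> carrier M" "y \<in> carrier N"
        and h: "h = frag_of (ascal M a x, y) - frag_of (x, ascal N a y)"
      show ?thesis unfolding h
        by (rule ev_diff0[OF d d]) (use c in \<open>simp_all add: ev_frag g_def f' scal_M scal_N\<close>)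
    qed
  qed
  have ev_tsub: "ev h = \<zero>\<^bsub>P\<^esub> \<and> supp h \<subseteq> MN" if "h \<in> tsub M N" for h
    using that unfolding tsub_def
  proof (induction rule: generate.induct)
    case (incl h)
    thus ?case using ev_rel subsetD[OF trels_sub incl] by simp
  next
    case (inv h)
    hence "supp h \<subseteq> MN" using subsetD[OF trels_sub inv] by simp
    thus ?case using ev_rel[OF inv] ev_minus[of h] by simp
  next
    case (eng h1 h2)
    thus ?case using ev_add[of h1 h2] keys_add[of h1 h2] by auto
  qed (simp add: ev_0)
  have tl: "tlift P f (tcls r) = ev r" if "supp r \<subseteq> MN" for r
  proof -
    define s where "s = (SOME s. s \<in> tcls r)"
    have "s \<in> tcls r" unfolding s_def by (rule someI) (rule tcls_self[OF that])
    hence s: "s - r \<in> tsub M N" "supp s \<subseteq> MN" using tcls_mem[OF that] by auto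
    have "ev s = ev (s - r) \<oplus>\<^bsub>P\<^esub> ev r" using ev_add[of "s - r" r] ev_tsub[OF s(1)] that by simp
    hence "ev s = ev r" using ev_tsub[OF s(1)] ev_closed[OF that] by simp
    thus ?thesis by (simp add: tlift_def Let_def s_def ev_def g_def)
  qed
  show "tlift P f Z \<in> carrier P" if "Z \<in> carrier (tensor M N)"
    using that by (auto simp: tensor_simps tgroup_simps tl ev_closed)
  show "tlift P f (Z \<oplus>\<^bsub>tensor M N\<^esub> W) = tlift P f Z \<oplus>\<^bsub>P\<^esub> tlift P f W"
    if ZW: "Z \<in> carrier (tensor M N)" "W \<in> carrier (tensor M N)"
  proof -
    obtain r s where rs: "Z = tcls r" "supp r \<subseteq> MN" "W = tcls s" "supp s \<subseteq> MN"
      using ZW by (auto simp: tensor_simps tgroup_simps)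
    have "supp (r + s) \<subseteq> MN" using keys_add[of r s] rs by auto
    thus ?thesis using rs by (simp add: tensor_simps tcls_add tl ev_add)
  qed
  show "tlift P f (tpure M N x y) = f x y" if "x \<in> carrier M" "y \<in> carrier N"
    using that by (simp add: tpure_tcls tl keys_frag_of ev_frag) (simp add: g_def)
qed

end


section \<open>The modules on words\<close>

definition wordmod :: "cword \<Rightarrow> vec umod" where
  "wordmod w = \<lparr>carrier = Aspan (words w), monoid.mult = undefined, monoid.one = undefined,
     ring.zero = 0, ring.add = (+), module.smult = (\<lambda>u. uact u)\<rparr>"

text \<open>On one-letter words the value is literally one of the two given modules; the two actions
  agree on the carrier, though not on vectors outside of it.\<close>

definition Xi0 :: "cword \<Rightarrow> vec umod" where
  "Xi0 w = (if w = [C1] then V1 else if w = [C2] then V2 else wordmod w)"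

lemma falg_act_eq:
  assumes \<rho>: "\<And>g x. x \<in> Wt c \<Longrightarrow> \<rho> g x = wrho g x" and v: "v \<in> Qspan (words [c])"
  shows "falg_act \<rho> x v = Act x v"
proof -
  have g: "vlin (\<rho> g) y = gact g y" if "y \<in> Qspan (words [c])" for g y
  proof -
    have "vlin (\<rho> g) y = plin (\<lambda>k. \<rho> g (hd k)) y"
      by (simp add: vlin_def plin_def vscale_psc)
    also have "\<dots> = gact g y"
      using that by (rule plin_eqI) (auto simp: words_single ga_singleton \<rho>)
    finally show ?thesis .
  qed
  have "foldr (\<lambda>g. vlin (\<rho> g)) gs v = wact gs v" for gs
    by (induction gs) (simp_all add: g wact_Qspan v)
  thus ?thesis by (simp add: falg_act_def Act_def plin_def vscale_psc)
qed

lemma Xi0_simps [simp]: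
  "carrier (Xi0 w) = Aspan (words w)" "\<zero>\<^bsub>Xi0 w\<^esub> = 0" "x \<oplus>\<^bsub>Xi0 w\<^esub> y = x + y"
  by (auto simp: Xi0_def wordmod_def V1_def V2_def wmod_def Aspan_def words_single)

lemma Xi0_smult:
  assumes "v \<in> Aspan (words w)"
  shows "u \<odot>\<^bsub>Xi0 w\<^esub> v = uact u v"
proof -
  have 1: "rho1 g x = wrho g x" if "x \<in> Wt C1" for g x
    using that by (simp only: wrho_def Wt.simps if_True)
  have 2: "rho2 g x = wrho g x" if "x \<in> Wt C2" for g x
  proof -
    have "x \<notin> Wt C1" using that by (cases x) (simp, elim disjE conjE; simp)
    thus ?thesis by (simp only: wrho_def Wt.simps if_False)
  qed
  note v = Aspan_Qspan[OF assms]
  show ?thesis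
    using falg_act_eq[of C1 rho1 v, OF 1] falg_act_eq[of C2 rho2 v, OF 2] v
    by (auto simp: Xi0_def wordmod_def V1_def V2_def wmod_def)
qed

lemma uact_ucls: "v \<in> Aspan (words w) \<Longrightarrow> uact (ucls x) v = Act x v"
  by (rule Act_urep[OF Aspan_Qspan])

lemma uact_Aspan: "u \<in> carrier UA \<Longrightarrow> v \<in> Aspan (words w) \<Longrightarrow> uact u v \<in> Aspan (words w)"
  by (rule Act_Aspan) (simp_all add: UA_rep)

lemma Xi0_abelian: "abelian_group (Xi0 w)"
  by (rule abelian_groupI) (auto intro!: bexI[of _ "- _"] Aspan_minus)

lemma Xi0_left_module: "left_module UA (Xi0 w)"
proof (intro left_module.intro left_module_axioms.intro UA_ring Xi0_abelian)
  show "a \<odot>\<^bsub>Xi0 w\<^esub> x \<in> carrier (Xi0 w)" if "a \<in> carrier UA" "x \<in> carrier (Xi0 w)" for a x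
    using that by (simp add: Xi0_smult uact_Aspan)
  show "a \<odot>\<^bsub>Xi0 w\<^esub> (x \<oplus>\<^bsub>Xi0 w\<^esub> y) = a \<odot>\<^bsub>Xi0 w\<^esub> x \<oplus>\<^bsub>Xi0 w\<^esub> a \<odot>\<^bsub>Xi0 w\<^esub> y"
    if "a \<in> carrier UA" "x \<in> carrier (Xi0 w)" "y \<in> carrier (Xi0 w)" for a x y
    using that by (simp add: Xi0_smult Aspan_add Act_vadd)
  show "\<one>\<^bsub>UA\<^esub> \<odot>\<^bsub>Xi0 w\<^esub> x = x" if "x \<in> carrier (Xi0 w)" for x
    using that by (simp add: Xi0_smult uact_ucls Act_one)
  fix a b x assume ab: "a \<in> carrier UA" "b \<in> carrier UA" and x: "x \<in> carrier (Xi0 w)"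
  have r: "ucls (urep a) = a" "ucls (urep b) = b" using ab by (simp_all add: UA_rep)
  have "a \<oplus>\<^bsub>UA\<^esub> b = ucls (urep a + urep b)" "a \<otimes>\<^bsub>UA\<^esub> b = ucls (urep a * urep b)"
    using Uq_simps(2,3)[of "urep a" "urep b"] r by simp_all
  thus "(a \<oplus>\<^bsub>UA\<^esub> b) \<odot>\<^bsub>Xi0 w\<^esub> x = a \<odot>\<^bsub>Xi0 w\<^esub> x \<oplus>\<^bsub>Xi0 w\<^esub> b \<odot>\<^bsub>Xi0 w\<^esub> x"
    "(a \<otimes>\<^bsub>UA\<^esub> b) \<odot>\<^bsub>Xi0 w\<^esub> x = a \<odot>\<^bsub>Xi0 w\<^esub> (b \<odot>\<^bsub>Xi0 w\<^esub> x)"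
    using x ab by (simp_all add: Xi0_smult uact_ucls Act_add Act_mult uact_Aspan)
qed

lemma Xi0_ascal: "v \<in> Aspan (words w) \<Longrightarrow> ascal (Xi0 w) a v = psc a v"
  by (simp add: ascal_def Xi0_smult uact_ucls Act_cst)

lemma Xi0_pair: "tens_pair (Xi0 u) (Xi0 v)"
  by (intro tens_pair.intro Xi0_abelian) (auto simp: Xi0_ascal Aspan_psc)

subsection \<open>The monoidal structure\<close>

text \<open>The isomorphism from the tensor product to the module on concatenated words.\<close>

definition mu :: "cword \<Rightarrow> cword \<Rightarrow> (vec, vec) tens \<Rightarrow> vec" where
  "mu u v = tlift (Xi0 (u @ v)) conc"

abbreviation Xten :: "cword \<Rightarrow> cword \<Rightarrow> (vec, vec) tens umod" where
  "Xten u v \<equiv> tensor (Xi0 u) (Xi0 v)"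

abbreviation xpure :: "cword \<Rightarrow> cword \<Rightarrow> vec \<Rightarrow> vec \<Rightarrow> (vec, vec) tens" where
  "xpure u v \<equiv> tpure (Xi0 u) (Xi0 v)"

lemma conc_balanced: "tens_pair.balanced (Xi0 u) (Xi0 v) (Xi0 (u @ v)) conc"
  by (auto simp: tens_pair.balanced_def[OF Xi0_pair] Aspan_conc_words conc_add_left conc_add_right
      Xi0_ascal conc_psc_left conc_psc_right)

lemmas mu_closed = tens_pair.tlift_closed[OF Xi0_pair Xi0_abelian conc_balanced, folded mu_def, simplified]
lemmas mu_add = tens_pair.tlift_add[OF Xi0_pair Xi0_abelian conc_balanced, folded mu_def, simplified]
lemmas mu_pure = tens_pair.tlift_pure[OF Xi0_pair Xi0_abelian conc_balanced, folded mu_def, simplified]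

lemmas xpure_closed = tens_pair.tpure_closed[OF Xi0_pair, folded tens_pair.tensor_simps(1)[OF Xi0_pair], simplified]
lemmas xpure_add = tens_pair.tpure_add_left[OF Xi0_pair, folded tens_pair.tensor_simps(2)[OF Xi0_pair], simplified]
  tens_pair.tpure_add_right[OF Xi0_pair, folded tens_pair.tensor_simps(2)[OF Xi0_pair], simplified]

lemma Xten_induct [consumes 1, case_names pure add]:
  assumes "Z \<in> carrier (Xten u v)"
    "\<And>x y. x \<in> Aspan (words u) \<Longrightarrow> y \<in> Aspan (words v) \<Longrightarrow> P (xpure u v x y)"
    "\<And>Z W. Z \<in> carrier (Xten u v) \<Longrightarrow> W \<in> carrier (Xten u v) \<Longrightarrow> P Z \<Longrightarrow> P W \<Longrightarrow> P (Z \<oplus>\<^bsub>Xten u v\<^esub> W)"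
  shows "P Z"
  using tens_pair.tensor_induct[OF Xi0_pair assms(1), of P] assms(2,3) by simp

lemma Xten_abelian: "abelian_group (Xten u v)"
  by (rule tens_pair.abelian_tensor[OF Xi0_pair])

lemma Xten_tgroup:
  "carrier (Xten u v) = carrier (tgroup (Xi0 u) (Xi0 v))"
  "x \<oplus>\<^bsub>Xten u v\<^esub> y = x \<oplus>\<^bsub>tgroup (Xi0 u) (Xi0 v)\<^esub> y"
  by (simp_all add: tensor_def)

lemma xpure_psc:
  assumes "a \<in> Aset" "x \<in> Aspan (words u)" "y \<in> Aspan (words v)"
  shows "xpure u v (psc a x) y = xpure u v x (psc a y)"
  using tens_pair.tpure_scal[OF Xi0_pair, of a x u y v] assms by (simp add: Xi0_ascal)

lemma xpure_zero:
  assumes "y \<in> Aspan (words v)"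
  shows "xpure u v 0 y = \<zero>\<^bsub>Xten u v\<^esub>"
proof -
  interpret T: abelian_group "Xten u v" by (rule Xten_abelian)
  show ?thesis using xpure_add(1)[of 0 u 0 y v] xpure_closed[of 0 u y v] assms
    by (simp add: T.add.r_cancel_one')
qed

lemma finite_words: "finite (words w)"
proof (induction w)
  case (Cons c w)
  have "words (c # w) = (\<lambda>(x, k). x # k) ` (Wt c \<times> words w)"
    by (auto simp: words_def list_all2_Cons2)
  moreover have "finite (Wt c)" by (cases c) simp_all
  ultimately show ?case using Cons by simp
qed simp

lemma Aspan_induct [consumes 1, case_names zero single add]:
  assumes "x \<in> Aspan D" "P 0" "\<And>k c. k \<in> D \<Longrightarrow> c \<in> Aset \<Longrightarrow> P (sng k c)"
    "\<And>x y. x \<in> Aspan D \<Longrightarrow> y \<in> Aspan D \<Longrightarrow> P x \<Longrightarrow> P y \<Longrightarrow> P (x + y)"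
  shows "P x"
proof -
  have *: "P (\<Sum>k\<in>I. sng k (coef x k)) \<and> (\<Sum>k\<in>I. sng k (coef x k)) \<in> Aspan D" if "finite I" "I \<subseteq> D" for I
    using that
  proof (induction I)
    case (insert k I)
    have "sng k (coef x k) \<in> Aspan D" "P (sng k (coef x k))"
      using insert.prems assms(3) Aspan_coef[OF assms(1)] by auto
    thus ?case using insert assms(4) by auto
  qed (simp add: assms(2))
  have "supp x \<subseteq> D" using assms(1) by (simp add: Aspan_def)
  hence "P (\<Sum>k\<in>supp x. sng k (coef x k))" using *[OF finite_keys, of x] by simp
  thus ?thesis using pm_expand[OF finite_keys order_refl, of x] by simp
qed

text \<open>The tensor product of two free modules is free on pairs of basis vectors: the map below sends
  a combination of words back to the tensor product by cutting each word in two.\<close>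

lemma mu_inverse:
  obtains nu where "\<And>Z. Z \<in> carrier (Xten u v) \<Longrightarrow> nu (mu u v Z) = Z"
proof -
  interpret T: abelian_group "Xten u v" by (rule Xten_abelian)
  define t where "t k c = xpure u v (sng (take (length u) k) c) (sng (drop (length u) k) 1)" for k c
  have cut: "take (length u) k \<in> words u" "drop (length u) k \<in> words v" if "k \<in> words (u @ v)" for k
    using that by (auto elim!: words_appendE)
  have t_closed: "t k c \<in> carrier (Xten u v)" if "k \<in> words (u @ v)" "c \<in> Aset" for k c
    unfolding t_def using cut[OF that(1)] that(2) by (intro xpure_closed) auto
  have t_add: "t k (c + d) = t k c \<oplus>\<^bsub>Xten u v\<^esub> t k d"
    if "k \<in> words (u @ v)" "c \<in> Aset" "d \<in> Aset" for k c d
    unfolding t_def single_add using cut[OF that(1)] that(2,3) by (intro xpure_add) auto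
  have t_0: "t k 0 = \<zero>\<^bsub>Xten u v\<^esub>" if "k \<in> words (u @ v)" for k
    unfolding t_def using cut[OF that] by (simp add: xpure_zero Aspan_single)
  define nu where "nu z = (\<Oplus>\<^bsub>Xten u v\<^esub>k\<in>words (u @ v). t k (coef z k))" for z
  have nu_add: "nu (z + z') = nu z \<oplus>\<^bsub>Xten u v\<^esub> nu z'"
    if "z \<in> Aspan (words (u @ v))" "z' \<in> Aspan (words (u @ v))" for z z'
  proof -
    note c = Aspan_coef[OF that(1)] Aspan_coef[OF that(2)]
    have "nu (z + z') = (\<Oplus>\<^bsub>Xten u v\<^esub>k\<in>words (u @ v). t k (coef z k) \<oplus>\<^bsub>Xten u v\<^esub> t k (coef z' k))"
      unfolding nu_def using c t_closed t_add by (intro T.finsum_cong') (auto simp: lookup_add)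
    also have "\<dots> = nu z \<oplus>\<^bsub>Xten u v\<^esub> nu z'"
      unfolding nu_def using c t_closed by (intro T.finsum_addf) auto
    finally show ?thesis .
  qed
  have nu_0: "nu 0 = \<zero>\<^bsub>Xten u v\<^esub>"
  proof -
    have "nu 0 = (\<Oplus>\<^bsub>Xten u v\<^esub>k\<in>words (u @ v). \<zero>\<^bsub>Xten u v\<^esub>)"
      unfolding nu_def by (intro T.finsum_cong') (auto simp: t_0)
    thus ?thesis by simp
  qed
  have nu_single: "nu (sng k c) = t k c" if "k \<in> words (u @ v)" "c \<in> Aset" for k c
  proof -
    have "nu (sng k c) = (\<Oplus>\<^bsub>Xten u v\<^esub>m\<in>words (u @ v). if k = m then t m c else \<zero>\<^bsub>Xten u v\<^esub>)"
      unfolding nu_def using that t_closed t_0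
      by (intro T.finsum_cong') (auto simp: lookup_single when_def)
    also have "\<dots> = t k c"
      using that t_closed finite_words by (intro T.add.finprod_singleton) auto
    finally show ?thesis .
  qed
  have nu_conc: "nu (conc x y) = xpure u v x y" if x: "x \<in> Aspan (words u)" and y: "y \<in> Aspan (words v)" for x y
    using x
  proof (induction x rule: Aspan_induct)
    case (single k a)
    from y show ?case
    proof (induction y rule: Aspan_induct)
      case (single m b)
      have km: "k @ m \<in> words (u @ v)" using \<open>k \<in> words u\<close> single(1) by (rule words_appendI)
      have "nu (conc (sng k a) (sng m b)) = xpure u v (sng k (a * b)) (sng m 1)"
        using nu_single[OF km] \<open>a \<in> Aset\<close> single words_length[OF \<open>k \<in> words u\<close>] by (simp add: t_def)
      also have "\<dots> = xpure u v (psc b (sng k a)) (sng m 1)" by (simp add: mult.commute)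
      also have "\<dots> = xpure u v (sng k a) (sng m b)"
        using \<open>k \<in> words u\<close> \<open>a \<in> Aset\<close> single by (subst xpure_psc) auto
      finally show ?case .
    next
      case zero
      have "xpure u v (sng k a) 0 = xpure u v (psc 0 (sng k a)) 0"
        using \<open>k \<in> words u\<close> \<open>a \<in> Aset\<close> by (subst xpure_psc) auto
      thus ?case by (simp add: xpure_zero nu_0)
    next
      case (add y y')
      have k: "sng k a \<in> Aspan (words u)" using \<open>k \<in> words u\<close> \<open>a \<in> Aset\<close> by auto
      show ?case using add k
        by (simp add: conc_add_right nu_add Aspan_conc_words xpure_add)
    qed
  next
    case zero
    show ?case using y by (simp add: xpure_zero nu_0)
  next
    case (add x x')
    thus ?case using y by (simp add: conc_add_left nu_add Aspan_conc_words xpure_add)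
  qed
  have "nu (mu u v Z) = Z" if "Z \<in> carrier (Xten u v)" for Z
    using that
    by (induction Z rule: Xten_induct) (simp_all add: mu_pure nu_conc mu_add nu_add mu_closed)
  thus ?thesis by (rule that)
qed

lemma mu_inj:
  "Z \<in> carrier (Xten u v) \<Longrightarrow> W \<in> carrier (Xten u v) \<Longrightarrow> mu u v Z = mu u v W \<Longrightarrow> Z = W"
  by (metis mu_inverse)

lemma mu_surj: "z \<in> Aspan (words (u @ v)) \<Longrightarrow> z \<in> mu u v ` carrier (Xten u v)"
proof (induction z rule: Aspan_induct)
  case zero
  have "mu u v (xpure u v 0 0) = 0" by (simp add: mu_pure)
  thus ?case using xpure_closed[of 0 u 0 v] by (metis Aspan_zero imageI)
next
  case (single k c)
  then obtain k1 k2 where k: "k = k1 @ k2" "k1 \<in> words u" "k2 \<in> words v" by (auto elim: words_appendE)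
  have l: "sng k1 c \<in> Aspan (words u)" "sng k2 1 \<in> Aspan (words v)" using k single by auto
  have "mu u v (xpure u v (sng k1 c) (sng k2 1)) = sng k c" using l k by (simp add: mu_pure)
  thus ?case using xpure_closed[OF l] by (metis imageI)
next
  case (add x y)
  then obtain Z W where "Z \<in> carrier (Xten u v)" "W \<in> carrier (Xten u v)" "x = mu u v Z" "y = mu u v W" by auto
  thus ?case using mu_add[of Z u v W] abelian_group.axioms(1)[OF Xten_abelian[of u v]]
    by (metis abelian_monoid.a_closed imageI)
qed

text \<open>The isomorphism with words respects the action: the action on the tensor product is given by the chosen
  decomposition of the coproduct, and \<open>uact_conc\<close> says that words are acted on in the same way.\<close>

lemma Xten_smult:
  assumes u: "a \<in> carrier UA"
  shows "Z \<in> carrier (Xten v w) \<Longrightarrow> a \<odot>\<^bsub>Xten v w\<^esub> Z \<in> carrier (Xten v w)"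
    and "Z \<in> carrier (Xten v w) \<Longrightarrow> mu v w (a \<odot>\<^bsub>Xten v w\<^esub> Z) = uact a (mu v w Z)"
    and "Z \<in> carrier (Xten v w) \<Longrightarrow> W \<in> carrier (Xten v w) \<Longrightarrow>
      a \<odot>\<^bsub>Xten v w\<^esub> (Z \<oplus>\<^bsub>Xten v w\<^esub> W) = a \<odot>\<^bsub>Xten v w\<^esub> Z \<oplus>\<^bsub>Xten v w\<^esub> a \<odot>\<^bsub>Xten v w\<^esub> W"
proof -
  let ?T = "tgroup (Xi0 v) (Xi0 w)"
  interpret T: abelian_group ?T by (rule tens_pair.abelian_tgroup[OF Xi0_pair])
  define f where "f l x y = foldr (\<lambda>(b, c) s. xpure v w (b \<odot>\<^bsub>Xi0 v\<^esub> x) (c \<odot>\<^bsub>Xi0 w\<^esub> y) \<oplus>\<^bsub>?T\<^esub> s) l \<zero>\<^bsub>?T\<^esub>" for l x y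
  have f_simps: "f [] x y = \<zero>\<^bsub>?T\<^esub>"
    "f ((b, c) # l) x y = xpure v w (b \<odot>\<^bsub>Xi0 v\<^esub> x) (c \<odot>\<^bsub>Xi0 w\<^esub> y) \<oplus>\<^bsub>?T\<^esub> f l x y" for b c l x y
    by (simp_all add: f_def)
  note pc = xpure_closed[unfolded Xten_tgroup] and pa = xpure_add[unfolded Xten_tgroup]
  have f_closed: "f l x y \<in> carrier ?T"
    if "set l \<subseteq> carrier UA \<times> carrier UA" "x \<in> Aspan (words v)" "y \<in> Aspan (words w)" for l x y
    using that(1) by (induction l) (auto simp: f_simps Xi0_smult that(2,3) uact_Aspan intro!: T.a_closed pc)
  have f_left: "f l (x + x') y = f l x y \<oplus>\<^bsub>?T\<^esub> f l x' y"
    if "set l \<subseteq> carrier UA \<times> carrier UA" "x \<in> Aspan (words v)" "x' \<in> Aspan (words v)" "y \<in> Aspan (words w)" for l x x' y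
    using that(1)
  proof (induction l)
    case (Cons p l)
    obtain b c where p: "p = (b, c)" by (cases p)
    show ?case using Cons that(2-)
      by (simp add: p f_simps Xi0_smult Aspan_add Act_vadd pa uact_Aspan T.a_ac pc f_closed)
  qed (simp add: f_simps)
  have f_right: "f l x (y + y') = f l x y \<oplus>\<^bsub>?T\<^esub> f l x y'"
    if "set l \<subseteq> carrier UA \<times> carrier UA" "x \<in> Aspan (words v)" "y \<in> Aspan (words w)" "y' \<in> Aspan (words w)" for l x y y'
    using that(1)
  proof (induction l)
    case (Cons p l)
    obtain b c where p: "p = (b, c)" by (cases p)
    show ?case using Cons that(2-)
      by (simp add: p f_simps Xi0_smult Aspan_add Act_vadd pa uact_Aspan T.a_ac pc f_closed)
  qed (simp add: f_simps)
  have f_scal: "f l (psc \<alpha> x) y = f l x (psc \<alpha> y)"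
    if "set l \<subseteq> carrier UA \<times> carrier UA" "\<alpha> \<in> Aset" "x \<in> Aspan (words v)" "y \<in> Aspan (words w)" for l x y \<alpha>
    using that(1)
    by (induction l) (auto simp: f_simps Xi0_smult that(2-) Aspan_psc Act_vpsc xpure_psc uact_Aspan)
  note S = sweedler(1)[OF u]
  have bal: "tens_pair.balanced (Xi0 v) (Xi0 w) ?T (f (sweedler a))"
    unfolding tens_pair.balanced_def[OF Xi0_pair] using S
    by (simp add: f_closed f_left f_right f_scal Xi0_ascal)
  have sm: "a \<odot>\<^bsub>Xten v w\<^esub> Z = tlift ?T (f (sweedler a)) Z" for Z
  proof -
    have "f l = (\<lambda>x y. foldr (\<lambda>(b, c) s. xpure v w (b \<odot>\<^bsub>Xi0 v\<^esub> x) (c \<odot>\<^bsub>Xi0 w\<^esub> y) \<oplus>\<^bsub>?T\<^esub> s) l \<zero>\<^bsub>?T\<^esub>)" for l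
      by (intro ext) (rule f_def)
    thus ?thesis by (simp add: tensor_def)
  qed
  note tl = tens_pair.tlift_closed[OF Xi0_pair T.abelian_group_axioms bal]
    tens_pair.tlift_add[OF Xi0_pair T.abelian_group_axioms bal]
    tens_pair.tlift_pure[OF Xi0_pair T.abelian_group_axioms bal, simplified]
  show c: "a \<odot>\<^bsub>Xten v w\<^esub> Z \<in> carrier (Xten v w)" if "Z \<in> carrier (Xten v w)" for Z
    using tl(1)[OF that] by (simp add: sm Xten_tgroup)
  show ad: "a \<odot>\<^bsub>Xten v w\<^esub> (Z \<oplus>\<^bsub>Xten v w\<^esub> W) = a \<odot>\<^bsub>Xten v w\<^esub> Z \<oplus>\<^bsub>Xten v w\<^esub> a \<odot>\<^bsub>Xten v w\<^esub> W"
    if "Z \<in> carrier (Xten v w)" "W \<in> carrier (Xten v w)" for Z W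
    using tl(2)[OF that] by (simp add: sm Xten_tgroup)
  have mu0: "mu v w \<zero>\<^bsub>Xten v w\<^esub> = 0"
    using mu_pure[of 0 v 0 w] by (simp add: xpure_zero)
  have mu_f: "mu v w (f l x y) = (\<Sum>(b, c)\<leftarrow>l. conc (uact b x) (uact c y))"
    if "set l \<subseteq> carrier UA \<times> carrier UA" "x \<in> Aspan (words v)" "y \<in> Aspan (words w)" for l x y
    using that(1)
  proof (induction l)
    case Nil
    thus ?case using mu0 by (simp add: f_simps tensor_def)
  next
    case (Cons p l)
    obtain b c where p: "p = (b, c)" by (cases p)
    show ?case using Cons that(2-)
      by (simp add: p f_simps mu_add[unfolded Xten_tgroup] pc f_closed Xi0_smult uact_Aspan mu_pure)
  qed
  show "mu v w (a \<odot>\<^bsub>Xten v w\<^esub> Z) = uact a (mu v w Z)" if "Z \<in> carrier (Xten v w)"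
    using that
  proof (induction Z rule: Xten_induct)
    case (pure x y)
    thus ?case using S by (simp add: sm tl(3) mu_f mu_pure uact_conc[OF u Aspan_Qspan Aspan_Qspan])
  next
    case (add Z W)
    thus ?case by (simp add: ad mu_add c Act_vadd)
  qed
qed

lemma mu_iso: "mu u v \<in> umod_iso (Xten u v) (Xi0 (u @ v))"
proof -
  have "inj_on (mu u v) (carrier (Xten u v))" using mu_inj by (auto simp: inj_on_def)
  moreover have "mu u v ` carrier (Xten u v) = Aspan (words (u @ v))" using mu_surj mu_closed by blast
  ultimately show ?thesis
    by (auto simp: umod_iso_def umod_hom_def bij_betw_def mu_closed mu_add Xten_smult Xi0_smult)
qed

lemma UA_cst: "a \<in> Aset \<Longrightarrow> ucls (cst a) \<in> carrier UA"
  by (rule UA_gens)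

lemma Xten_ascal:
  assumes "a \<in> Aset"
  shows "Z \<in> carrier (Xten v w) \<Longrightarrow> ascal (Xten v w) a Z \<in> carrier (Xten v w)"
    and "Z \<in> carrier (Xten v w) \<Longrightarrow> mu v w (ascal (Xten v w) a Z) = psc a (mu v w Z)"
    and "Z \<in> carrier (Xten v w) \<Longrightarrow> W \<in> carrier (Xten v w) \<Longrightarrow>
      ascal (Xten v w) a (Z \<oplus>\<^bsub>Xten v w\<^esub> W) = ascal (Xten v w) a Z \<oplus>\<^bsub>Xten v w\<^esub> ascal (Xten v w) a W"
    and "x \<in> Aspan (words v) \<Longrightarrow> y \<in> Aspan (words w) \<Longrightarrow> ascal (Xten v w) a (xpure v w x y) = xpure v w (psc a x) y"
proof -
  show c: "ascal (Xten v w) a Z \<in> carrier (Xten v w)" if "Z \<in> carrier (Xten v w)" for Z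
    using Xten_smult(1)[OF UA_cst[OF assms] that] by (simp add: ascal_def)
  show m: "mu v w (ascal (Xten v w) a Z) = psc a (mu v w Z)" if "Z \<in> carrier (Xten v w)" for Z
    using Xten_smult(2)[OF UA_cst[OF assms] that] uact_ucls[OF mu_closed[OF that], of "cst a"]
    by (simp add: ascal_def Act_cst)
  show "ascal (Xten v w) a (Z \<oplus>\<^bsub>Xten v w\<^esub> W) = ascal (Xten v w) a Z \<oplus>\<^bsub>Xten v w\<^esub> ascal (Xten v w) a W"
    if "Z \<in> carrier (Xten v w)" "W \<in> carrier (Xten v w)"
    using Xten_smult(3)[OF UA_cst[OF assms] that] by (simp add: ascal_def)
  show "ascal (Xten v w) a (xpure v w x y) = xpure v w (psc a x) y"
    if "x \<in> Aspan (words v)" "y \<in> Aspan (words w)"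
    by (rule mu_inj[of _ v w])
      (use that assms in \<open>simp_all add: c m xpure_closed Aspan_psc mu_pure conc_psc_left\<close>)
qed

lemma Xten_pair: "tens_pair (Xten u v) (Xi0 w)" "tens_pair (Xi0 w) (Xten u v)"
  by (intro tens_pair.intro Xi0_abelian Xten_abelian; auto simp: Xi0_ascal Aspan_psc Xten_ascal)+

text \<open>The maps that induce maps between tensor products over \<open>\<A>\<close>.\<close>

definition amap :: "'m umod \<Rightarrow> 'n umod \<Rightarrow> ('m \<Rightarrow> 'n) \<Rightarrow> bool" where
  "amap M N h \<longleftrightarrow> (\<forall>x\<in>carrier M. h x \<in> carrier N) \<and>
     (\<forall>x\<in>carrier M. \<forall>y\<in>carrier M. h (x \<oplus>\<^bsub>M\<^esub> y) = h x \<oplus>\<^bsub>N\<^esub> h y) \<and>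
     (\<forall>a\<in>Aset. \<forall>x\<in>carrier M. h (ascal M a x) = ascal N a (h x))"

lemma amap_id: "amap M M (\<lambda>x. x)"
  by (simp add: amap_def)

lemma amap_mu: "amap (Xten u v) (Xi0 (u @ v)) (mu u v)"
  by (auto simp: amap_def mu_closed mu_add Xten_ascal Xi0_ascal)

lemma tmap_balanced:
  assumes "tens_pair M' N'" "tens_pair M N" "amap M' M h" "amap N' N k"
  shows "tens_pair.balanced M' N' (tensor M N) (\<lambda>x y. tpure M N (h x) (k y))"
  using assms(3,4) unfolding tens_pair.balanced_def[OF assms(1)] tens_pair.tensor_simps[OF assms(2)]
  by (auto simp: amap_def tens_pair.tpure_closed[OF assms(2)] tens_pair.tpure_add_left[OF assms(2)]
      tens_pair.tpure_add_right[OF assms(2)] tens_pair.tpure_scal[OF assms(2)])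

lemma
  assumes "tens_pair M' N'" "tens_pair M N" "amap M' M h" "amap N' N k"
  shows tmap_closed: "Z \<in> carrier (tensor M' N') \<Longrightarrow> tmap M N h k Z \<in> carrier (tensor M N)"
    and tmap_add: "Z \<in> carrier (tensor M' N') \<Longrightarrow> W \<in> carrier (tensor M' N') \<Longrightarrow>
      tmap M N h k (Z \<oplus>\<^bsub>tensor M' N'\<^esub> W) = tmap M N h k Z \<oplus>\<^bsub>tensor M N\<^esub> tmap M N h k W"
    and tmap_pure: "x \<in> carrier M' \<Longrightarrow> y \<in> carrier N' \<Longrightarrow>
      tmap M N h k (tpure M' N' x y) = tpure M N (h x) (k y)"
  unfolding tmap_def
  by (rule tens_pair.tlift_closed[OF assms(1) tens_pair.abelian_tensor[OF assms(2)] tmap_balanced[OF assms]]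
      tens_pair.tlift_add[OF assms(1) tens_pair.abelian_tensor[OF assms(2)] tmap_balanced[OF assms]]
      tens_pair.tlift_pure[OF assms(1) tens_pair.abelian_tensor[OF assms(2)] tmap_balanced[OF assms]];
    assumption)+

text \<open>Both sides send \<open>(x \<otimes> y) \<otimes> z\<close> to the concatenation of the three vectors. The proof has to
  unfold the associator, which is a lift inside a lift; \<open>G Z z\<close> is the inner one.\<close>

lemma mu_associative:
  assumes "s \<in> carrier (tensor (Xten u v) (Xi0 w))"
  shows "mu (u @ v) w (tmap (Xi0 (u @ v)) (Xi0 w) (mu u v) (\<lambda>z. z) s)
    = mu u (v @ w) (tmap (Xi0 u) (Xi0 (v @ w)) (\<lambda>x. x) (mu v w) (tassoc (Xi0 u) (Xi0 v) (Xi0 w) s))"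
proof -
  let ?R = "tensor (Xi0 u) (Xten v w)"
  let ?p = "tpure (Xi0 u) (Xten v w)"
  note R = Xten_pair(2)[of u v w]
  note Ra = tens_pair.abelian_tensor[OF R]
  interpret R: abelian_group ?R by (rule Ra)
  note pc = tens_pair.tpure_closed[OF R, folded tens_pair.tensor_simps(1)[OF R], simplified]
  note pa = tens_pair.tpure_add_left[OF R, folded tens_pair.tensor_simps(2)[OF R], simplified]
    tens_pair.tpure_add_right[OF R, folded tens_pair.tensor_simps(2)[OF R], simplified]
  note ps = tens_pair.tpure_scal[OF R, simplified]
  define G where "G Z z = tlift ?R (\<lambda>x y. ?p x (xpure v w y z)) Z" for Z z
  have B1: "tens_pair.balanced (Xi0 u) (Xi0 v) ?R (\<lambda>x y. ?p x (xpure v w y z))"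
    if "z \<in> Aspan (words w)" for z
    unfolding tens_pair.balanced_def[OF Xi0_pair] using that
    by (auto simp: pc pa xpure_closed xpure_add ps Xten_ascal Xi0_ascal Aspan_psc simp flip: Xi0_ascal)
  note G = tens_pair.tlift_closed[OF Xi0_pair Ra B1, folded G_def]
    tens_pair.tlift_add[OF Xi0_pair Ra B1, folded G_def]
    tens_pair.tlift_pure[OF Xi0_pair Ra B1, folded G_def, simplified]
  have G_right: "G Z (z + z') = G Z z \<oplus>\<^bsub>?R\<^esub> G Z z'"
    if "Z \<in> carrier (Xten u v)" "z \<in> Aspan (words w)" "z' \<in> Aspan (words w)" for Z z z'
    using that(1)
    by (induction Z rule: Xten_induct)
      (use that(2-) in \<open>simp_all add: G Aspan_add xpure_add xpure_closed pa pc R.a_ac\<close>)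
  have G_scal: "G (ascal (Xten u v) a Z) z = G Z (ascal (Xi0 w) a z)"
    if "Z \<in> carrier (Xten u v)" "z \<in> Aspan (words w)" "a \<in> Aset" for Z z a
    using that(1)
  proof (induction Z rule: Xten_induct)
    case (pure x y)
    have "?p (psc a x) (xpure v w y z) = ?p x (xpure v w (psc a y) z)"
      using ps[of a x "xpure v w y z"] pure that(2,3) by (simp add: xpure_closed Xi0_ascal Xten_ascal)
    thus ?case using pure that(2,3) by (simp add: G Xten_ascal Xi0_ascal Aspan_psc xpure_psc)
  next
    case (add Z W)
    thus ?case using that(2,3) by (simp add: G Xten_ascal Xi0_ascal Aspan_psc)
  qed
  have B2: "tens_pair.balanced (Xten u v) (Xi0 w) ?R G"
    unfolding tens_pair.balanced_def[OF Xten_pair(1)] by (auto simp: G G_right G_scal)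
  have "G = (\<lambda>Z z. tlift ?R (\<lambda>x y. ?p x (xpure v w y z)) Z)"
    by (intro ext) (rule G_def)
  hence ta: "tassoc (Xi0 u) (Xi0 v) (Xi0 w) = tlift ?R G"
    by (simp add: tassoc_def Let_def)
  note T = tens_pair.tlift_closed[OF Xten_pair(1) Ra B2, folded ta]
    tens_pair.tlift_add[OF Xten_pair(1) Ra B2, folded ta]
    tens_pair.tlift_pure[OF Xten_pair(1) Ra B2, folded ta, simplified]
  note m1 = tmap_closed[OF Xten_pair(1) Xi0_pair amap_mu amap_id]
    tmap_add[OF Xten_pair(1) Xi0_pair amap_mu amap_id]
    tmap_pure[OF Xten_pair(1) Xi0_pair amap_mu amap_id, simplified]
  note m2 = tmap_closed[OF Xten_pair(2) Xi0_pair amap_id amap_mu]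
    tmap_add[OF Xten_pair(2) Xi0_pair amap_id amap_mu]
    tmap_pure[OF Xten_pair(2) Xi0_pair amap_id amap_mu, simplified]
  have right: "mu u (v @ w) (tmap (Xi0 u) (Xi0 (v @ w)) (\<lambda>x. x) (mu v w) (G Z z)) = conc (mu u v Z) z"
    if "Z \<in> carrier (Xten u v)" "z \<in> Aspan (words w)" for Z z
    using that(1)
    by (induction Z rule: Xten_induct)
      (use that(2) in \<open>simp_all add: G m2 xpure_closed mu_pure mu_closed mu_add conc_assoc
        conc_add_left Aspan_conc_words\<close>)
  show ?thesis
    using assms
  proof (induction s rule: tens_pair.tensor_induct[OF Xten_pair(1), consumes 1, case_names pure add])
    case (pure Z z)
    thus ?case by (simp add: m1 T mu_pure mu_closed right)
  next
    case (add Z W)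
    thus ?case by (simp add: m1 m2 T mu_add)
  qed
qed

subsection \<open>The unit\<close>

definition eta :: "Kq \<Rightarrow> vec" where
  "eta a = sng [] a"

lemma Act_Nil: "Act x (sng [] c) = sng [] (fext (\<lambda>c. c) counit_gen x * c)"
proof (induction x rule: pm_induct_UNIV)
  case (single w a)
  have "wact gs (sng [] c) = sng [] (prod_list (map counit_gen gs) * c)" for gs
    by (induction gs) (simp_all add: mult_ac)
  thus ?case by (simp add: Act_single ident.fext_single mult_ac)
qed (simp_all add: ident.fext_zero ident.fext_add Act_add distrib_right single_add)

lemma uunit_simps [simp]:
  "carrier uunit = Aset" "\<zero>\<^bsub>uunit\<^esub> = 0" "x \<oplus>\<^bsub>uunit\<^esub> y = x + y" "u \<odot>\<^bsub>uunit\<^esub> a = ucounit u * a"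
  by (simp_all add: uunit_def)

lemma uunit_ascal [simp]: "ascal uunit a x = a * x"
proof -
  have "uact (ucls (cst a)) (sng [] 1) = Act (cst a) (sng [] 1)"
    by (rule uact_ucls[of _ "[]"]) auto
  thus ?thesis by (simp add: ascal_def ucounit_def Act_cst Act_Nil ident.fext_cst)
qed

lemma uunit_abelian: "abelian_group uunit"
  by (rule abelian_groupI) (auto intro!: bexI[of _ "- _"])

lemma uunit_pair: "tens_pair uunit (Xi0 u)" "tens_pair (Xi0 u) uunit"
  by (intro tens_pair.intro Xi0_abelian uunit_abelian; auto simp: Xi0_ascal Aspan_psc)+

lemma Aspan_Nil: "x \<in> Aspan (words []) \<longleftrightarrow> (\<exists>a\<in>Aset. x = eta a)"
proof
  assume x: "x \<in> Aspan (words [])"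
  thus "\<exists>a\<in>Aset. x = eta a" using Qspan_Nil[OF Aspan_Qspan[OF x]] Aspan_coef[OF x] by (auto simp: eta_def)
qed (auto simp: eta_def)

lemma eta_Aspan: "a \<in> Aset \<Longrightarrow> eta a \<in> Aspan (words [])"
  unfolding Aspan_Nil by blast

lemma eta_iso: "eta \<in> umod_iso uunit (Xi0 [])"
proof -
  have "bij_betw eta Aset (Aspan (words []))"
    unfolding bij_betw_def using Aspan_Nil by (auto simp: inj_on_def eta_def)
  thus ?thesis
    using eta_Aspan
    by (auto simp: umod_iso_def umod_hom_def Xi0_smult eta_def single_add Act_Nil ucounit_def)
qed

lemma conc_eta: "conc (eta a) x = psc a x" "conc x (eta a) = psc a x"
  by (simp_all add: eta_def)

lemma amap_eta: "amap uunit (Xi0 []) eta"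
  using eta_Aspan by (auto simp: amap_def Xi0_ascal) (auto simp: eta_def single_add)

lemma mu_left_unit:
  assumes "s \<in> carrier (tensor uunit (Xi0 u))"
  shows "mu [] u (tmap (Xi0 []) (Xi0 u) eta (\<lambda>x. x) s) = tlunit (Xi0 u) s"
proof -
  have B: "tens_pair.balanced uunit (Xi0 u) (Xi0 u) (\<lambda>a x. ascal (Xi0 u) a x)"
    unfolding tens_pair.balanced_def[OF uunit_pair(1)]
    by (auto simp: Xi0_ascal Aspan_psc Aspan_add psc_add psc_add_left psc_psc mult.commute)
  note t = tens_pair.tlift_add[OF uunit_pair(1) Xi0_abelian B, folded tlunit_def]
    tens_pair.tlift_pure[OF uunit_pair(1) Xi0_abelian B, folded tlunit_def, simplified]
  note m = tmap_closed[OF uunit_pair(1) Xi0_pair amap_eta amap_id]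
    tmap_add[OF uunit_pair(1) Xi0_pair amap_eta amap_id]
    tmap_pure[OF uunit_pair(1) Xi0_pair amap_eta amap_id, simplified]
  from assms show ?thesis
  proof (induction s rule: tens_pair.tensor_induct[OF uunit_pair(1), consumes 1, case_names pure add])
    case (pure a x)
    have "mu [] u (xpure [] u (eta a) x) = psc a x"
      using pure mu_pure[OF eta_Aspan, of a x u] by (simp add: conc_eta)
    thus ?case using pure by (simp add: t m Xi0_ascal)
  next
    case (add Z W)
    thus ?case using mu_add[of "tmap (Xi0 []) (Xi0 u) eta (\<lambda>x. x) Z" "[]" u] by (simp add: t m)
  qed
qed

lemma mu_right_unit:
  assumes "s \<in> carrier (tensor (Xi0 u) uunit)"
  shows "mu u [] (tmap (Xi0 u) (Xi0 []) (\<lambda>x. x) eta s) = trunit (Xi0 u) s"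
proof -
  have B: "tens_pair.balanced (Xi0 u) uunit (Xi0 u) (\<lambda>x a. ascal (Xi0 u) a x)"
    unfolding tens_pair.balanced_def[OF uunit_pair(2)]
    by (auto simp: Xi0_ascal Aspan_psc Aspan_add psc_add psc_add_left psc_psc mult.commute)
  note t = tens_pair.tlift_add[OF uunit_pair(2) Xi0_abelian B, folded trunit_def]
    tens_pair.tlift_pure[OF uunit_pair(2) Xi0_abelian B, folded trunit_def, simplified]
  note m = tmap_closed[OF uunit_pair(2) Xi0_pair amap_id amap_eta]
    tmap_add[OF uunit_pair(2) Xi0_pair amap_id amap_eta]
    tmap_pure[OF uunit_pair(2) Xi0_pair amap_id amap_eta, simplified]
  from assms show ?thesis
  proof (induction s rule: tens_pair.tensor_induct[OF uunit_pair(2), consumes 1, case_names pure add])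
    case (pure x a)
    have "mu u [] (xpure u [] x (eta a)) = psc a x"
      using pure mu_pure[OF _ eta_Aspan, of x u a] by (simp add: conc_eta)
    thus ?case using pure by (simp add: t m Xi0_ascal)
  next
    case (add Z W)
    thus ?case using mu_add[of "tmap (Xi0 u) (Xi0 []) (\<lambda>x. x) eta Z" u "[]"] by (simp add: t m)
  qed
qed


section \<open>Diagrams as matrices\<close>

definition vsum :: "(Kq \<times> weight list) list \<Rightarrow> vec" where
  "vsum l = (\<Sum>(c, k)\<leftarrow>l. sng k c)"

lemma vsum_simps [simp]: "vsum [] = 0" "vsum ((c, k) # l) = sng k c + vsum l"
  by (simp_all add: vsum_def)

text \<open>The coefficients of the caps, the cups and \<open>i\<close> as lists, so that a matrix can be compared with a map on
  tensor products for an arbitrary list.\<close>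

definition cap1_table :: "((weight \<times> weight) \<times> Kq) list" where
  "cap1_table = [(((1, 0), (- 1, 0)), 1),
   (((- 1, 1), (1, - 1)), - qv),
   (((1, - 1), (- 1, 1)), qv ^ 3),
   (((- 1, 0), (1, 0)), - (qv ^ 4))]"

definition cap2_table :: "((weight \<times> weight) \<times> Kq) list" where
  "cap2_table = [(((0, 1), (0, - 1)), 1),
   (((2, - 1), (- 2, 1)), - (qv ^ 2)),
   (((0, 0), (0, 0)), qv ^ 2 * qn 2),
   (((- 2, 1), (2, - 1)), - (qv ^ 4)),
   (((0, - 1), (0, 1)), qv ^ 6)]"

definition cup1_table :: "(Kq \<times> weight \<times> weight) list" where
  "cup1_table = [
     (- (qv powi (- 4)), (1, 0), (- 1, 0)),
     (qv powi (- 3), (- 1, 1), (1, - 1)),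
     (- (qv powi (- 1)), (1, - 1), (- 1, 1)),
     (1, (- 1, 0), (1, 0))]"

definition cup2_table :: "(Kq \<times> weight \<times> weight) list" where
  "cup2_table = [
     (qv powi (- 6), (0, 1), (0, - 1)),
     (- (qv powi (- 4)), (2, - 1), (- 2, 1)),
     (qv powi (- 2) / qn 2, (0, 0), (0, 0)),
     (- (qv powi (- 2)), (- 2, 1), (2, - 1)),
     (1, (0, - 1), (0, 1))]"

definition i_table :: "weight \<Rightarrow> (Kq \<times> weight \<times> weight) list" where
  "i_table w =
    (if w = (0, 1) then
       [(inverse qv, (1, 0), (- 1, 1)), (- 1, (- 1, 1), (1, 0))]
     else if w = (2, - 1) then
       [(inverse qv, (1, 0), (1, - 1)), (- 1, (1, - 1), (1, 0))]
     else if w = (0, 0) then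
       [(inverse qv, (1, 0), (- 1, 0)), (qv powi (- 2), (- 1, 1), (1, - 1)),
        (- 1, (1, - 1), (- 1, 1)), (- inverse qv, (- 1, 0), (1, 0))]
     else if w = (- 2, 1) then
       [(inverse qv, (- 1, 1), (- 1, 0)), (- 1, (- 1, 0), (- 1, 1))]
     else if w = (0, - 1) then
       [(inverse qv, (1, - 1), (- 1, 0)), (- 1, (- 1, 0), (1, - 1))]
     else [])"

abbreviation pair_words :: "(Kq \<times> weight \<times> weight) list \<Rightarrow> (Kq \<times> weight list) list" where
  "pair_words \<equiv> map (\<lambda>(c, x, y). (c, [x, y]))"

text \<open>The given module maps on words. Only words with the shape of the source of the generator matter; the value
  at other words is arbitrary.\<close>

primrec gmat :: "dgen \<Rightarrow> weight list \<Rightarrow> vec" where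
  "gmat Cap1 k = sng [] (tabled cap1_table (hd k, hd (tl k)))"
| "gmat Cap2 k = sng [] (tabled cap2_table (hd k, hd (tl k)))"
| "gmat Cup1 k = vsum (pair_words cup1_table)"
| "gmat Cup2 k = vsum (pair_words cup2_table)"
| "gmat Pgen k = tabled mp_table (hd k, hd (tl k))"
| "gmat Igen k = vsum (pair_words (i_table (hd k)))"

lemma gmat_Cap1:
  "gmat Cap1 [(1, 0), (1, 0)] = 0"
  "gmat Cap1 [(1, 0), (- 1, 1)] = 0"
  "gmat Cap1 [(1, 0), (1, - 1)] = 0"
  "gmat Cap1 [(1, 0), (- 1, 0)] = sng [] (1)"
  "gmat Cap1 [(- 1, 1), (1, 0)] = 0"
  "gmat Cap1 [(- 1, 1), (- 1, 1)] = 0"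
  "gmat Cap1 [(- 1, 1), (1, - 1)] = sng [] (- qv)"
  "gmat Cap1 [(- 1, 1), (- 1, 0)] = 0"
  "gmat Cap1 [(1, - 1), (1, 0)] = 0"
  "gmat Cap1 [(1, - 1), (- 1, 1)] = sng [] (qv ^ 3)"
  "gmat Cap1 [(1, - 1), (1, - 1)] = 0"
  "gmat Cap1 [(1, - 1), (- 1, 0)] = 0"
  "gmat Cap1 [(- 1, 0), (1, 0)] = sng [] (- (qv ^ 4))"
  "gmat Cap1 [(- 1, 0), (- 1, 1)] = 0"
  "gmat Cap1 [(- 1, 0), (1, - 1)] = 0"
  "gmat Cap1 [(- 1, 0), (- 1, 0)] = 0"
  by (simp_all add: tabled_def cap1_table_def)

lemma gmat_Cap2:
  "gmat Cap2 [(0, 1), (0, 1)] = 0"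
  "gmat Cap2 [(0, 1), (2, - 1)] = 0"
  "gmat Cap2 [(0, 1), (0, 0)] = 0"
  "gmat Cap2 [(0, 1), (- 2, 1)] = 0"
  "gmat Cap2 [(0, 1), (0, - 1)] = sng [] (1)"
  "gmat Cap2 [(2, - 1), (0, 1)] = 0"
  "gmat Cap2 [(2, - 1), (2, - 1)] = 0"
  "gmat Cap2 [(2, - 1), (0, 0)] = 0"
  "gmat Cap2 [(2, - 1), (- 2, 1)] = sng [] (- (qv ^ 2))"
  "gmat Cap2 [(2, - 1), (0, - 1)] = 0"
  "gmat Cap2 [(0, 0), (0, 1)] = 0"
  "gmat Cap2 [(0, 0), (2, - 1)] = 0"
  "gmat Cap2 [(0, 0), (0, 0)] = sng [] (qv ^ 2 * qn 2)"
  "gmat Cap2 [(0, 0), (- 2, 1)] = 0"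
  "gmat Cap2 [(0, 0), (0, - 1)] = 0"
  "gmat Cap2 [(- 2, 1), (0, 1)] = 0"
  "gmat Cap2 [(- 2, 1), (2, - 1)] = sng [] (- (qv ^ 4))"
  "gmat Cap2 [(- 2, 1), (0, 0)] = 0"
  "gmat Cap2 [(- 2, 1), (- 2, 1)] = 0"
  "gmat Cap2 [(- 2, 1), (0, - 1)] = 0"
  "gmat Cap2 [(0, - 1), (0, 1)] = sng [] (qv ^ 6)"
  "gmat Cap2 [(0, - 1), (2, - 1)] = 0"
  "gmat Cap2 [(0, - 1), (0, 0)] = 0"
  "gmat Cap2 [(0, - 1), (- 2, 1)] = 0"
  "gmat Cap2 [(0, - 1), (0, - 1)] = 0"
  by (simp_all add: tabled_def cap2_table_def)

lemma gmat_Pgen: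
  "gmat Pgen [(1, 0), (1, 0)] = 0"
  "gmat Pgen [(1, 0), (- 1, 1)] = sng [(0, 1)] (- 1)"
  "gmat Pgen [(1, 0), (1, - 1)] = sng [(2, - 1)] (- 1)"
  "gmat Pgen [(1, 0), (- 1, 0)] = sng [(0, 0)] (- qv / qn 2)"
  "gmat Pgen [(- 1, 1), (1, 0)] = sng [(0, 1)] (qv)"
  "gmat Pgen [(- 1, 1), (- 1, 1)] = 0"
  "gmat Pgen [(- 1, 1), (1, - 1)] = sng [(0, 0)] (- 1 / qn 2)"
  "gmat Pgen [(- 1, 1), (- 1, 0)] = sng [(- 2, 1)] (- 1)"
  "gmat Pgen [(1, - 1), (1, 0)] = sng [(2, - 1)] (qv)"
  "gmat Pgen [(1, - 1), (- 1, 1)] = sng [(0, 0)] (qv ^ 2 / qn 2)"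
  "gmat Pgen [(1, - 1), (1, - 1)] = 0"
  "gmat Pgen [(1, - 1), (- 1, 0)] = sng [(0, - 1)] (- 1)"
  "gmat Pgen [(- 1, 0), (1, 0)] = sng [(0, 0)] (qv / qn 2)"
  "gmat Pgen [(- 1, 0), (- 1, 1)] = sng [(- 2, 1)] (qv)"
  "gmat Pgen [(- 1, 0), (1, - 1)] = sng [(0, - 1)] (qv)"
  "gmat Pgen [(- 1, 0), (- 1, 0)] = 0"
  by (simp_all add: tabled_def mp_table_def vscale_psc vb_def)

lemma gmat_Cup:
  "gmat Cup1 k = sng [(1, 0), (- 1, 0)] (- (inverse qv ^ 4)) + (sng [(- 1, 1), (1, - 1)] (inverse qv ^ 3)
    + (sng [(1, - 1), (- 1, 1)] (- inverse qv) + sng [(- 1, 0), (1, 0)] 1))"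
  "gmat Cup2 k = sng [(0, 1), (0, - 1)] (inverse qv ^ 6) + (sng [(2, - 1), (- 2, 1)] (- (inverse qv ^ 4))
    + (sng [(0, 0), (0, 0)] (inverse qv ^ 2 / qn 2) + (sng [(- 2, 1), (2, - 1)] (- (inverse qv ^ 2))
    + sng [(0, - 1), (0, 1)] 1)))"
  by (simp_all add: cup1_table_def cup2_table_def power_int_def)

lemma gmat_Igen:
  "gmat Igen [(0, 1)] = sng [(1, 0), (- 1, 1)] (inverse qv) + sng [(- 1, 1), (1, 0)] (- 1)"
  "gmat Igen [(2, - 1)] = sng [(1, 0), (1, - 1)] (inverse qv) + sng [(1, - 1), (1, 0)] (- 1)"
  "gmat Igen [(0, 0)] = sng [(1, 0), (- 1, 0)] (inverse qv) + (sng [(- 1, 1), (1, - 1)] (inverse qv ^ 2)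
    + (sng [(1, - 1), (- 1, 1)] (- 1) + sng [(- 1, 0), (1, 0)] (- inverse qv)))"
  "gmat Igen [(- 2, 1)] = sng [(- 1, 1), (- 1, 0)] (inverse qv) + sng [(- 1, 0), (- 1, 1)] (- 1)"
  "gmat Igen [(0, - 1)] = sng [(1, - 1), (- 1, 0)] (inverse qv) + sng [(- 1, 0), (1, - 1)] (- 1)"
  by (simp_all add: i_table_def power_int_def)

lemmas gmat_eval = gmat_Cap1 gmat_Cap2 gmat_Pgen gmat_Cup gmat_Igen

declare gmat.simps [simp del]

lemma words_1: "k \<in> words [c] \<Longrightarrow> \<exists>x\<in>Wt c. k = [x]"
  by (auto simp: words_def list_all2_Cons2)

lemma words_2: "k \<in> words [c, d] \<Longrightarrow> \<exists>x\<in>Wt c. \<exists>y\<in>Wt d. k = [x, y]"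
  by (auto simp: words_def list_all2_Cons2)

lemma gmat_Aspan:
  assumes "k \<in> words (dgen_src g)"
  shows "gmat g k \<in> Aspan (words (dgen_tgt g))"
proof -
  have in2: "[x, y] \<in> words [c, d]" if "x \<in> Wt c" "y \<in> Wt d" for x y c d
    using that by (simp add: words_def)
  have in1: "[x] \<in> words [c]" if "x \<in> Wt c" for x c
    using that by (simp add: words_def)
  show ?thesis
  proof (cases g)
    case Cap1
    with assms words_2[of k C1 C1] show ?thesis by (auto simp: gmat_eval intro!: Aspan_single Aset_minus)
  next
    case Cap2
    with assms words_2[of k C2 C2] show ?thesis by (auto simp: gmat_eval intro!: Aspan_single Aset_minus)
  next
    case Cup1
    thus ?thesis by (auto simp: gmat_eval intro!: Aspan_add Aspan_single Aset_minus in2)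
  next
    case Cup2
    thus ?thesis by (auto simp: gmat_eval intro!: Aspan_add Aspan_single Aset_minus Aset_divide_qn_2 in2)
  next
    case Pgen
    with assms words_2[of k C1 C1] show ?thesis
      by (auto simp: gmat_eval intro!: Aspan_single in1 Aset_divide_qn_2)
  next
    case Igen
    with assms words_1[of k C2] show ?thesis
      by (auto simp: gmat_eval intro!: Aspan_add Aspan_single in2)
  qed
qed

lemmas lin_simps = plin_add conc_add_left conc_add_right psc_add

text \<open>Identities between explicit combinations of basis words are checked one coefficient at a
  time; every coefficient is a rational function of \<open>q\<close> with denominator \<open>q\<^sup>i (q\<^sup>2 + 1)\<^sup>j\<close>.\<close>

lemmas coef_simps = lookup_add lookup_single when_def qn_2 power_int_def field_simps eval_nat_numeral

primrec dsrc :: "dterm \<Rightarrow> cword" where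
  "dsrc (DId u) = u"
| "dsrc (DGen x) = dgen_src x"
| "dsrc (g \<circ>\<^sub>D f) = dsrc f"
| "dsrc (f \<otimes>\<^sub>D g) = dsrc f @ dsrc g"
| "dsrc (DZero u v) = u"
| "dsrc (f +\<^sub>D g) = dsrc f"
| "dsrc (a *\<^sub>D f) = dsrc f"

primrec dtgt :: "dterm \<Rightarrow> cword" where
  "dtgt (DId u) = u"
| "dtgt (DGen x) = dgen_tgt x"
| "dtgt (g \<circ>\<^sub>D f) = dtgt g"
| "dtgt (f \<otimes>\<^sub>D g) = dtgt f @ dtgt g"
| "dtgt (DZero u v) = v"
| "dtgt (f +\<^sub>D g) = dtgt f"
| "dtgt (a *\<^sub>D f) = dtgt f"

lemma dtyped_src_tgt: "dtyped f u v \<Longrightarrow> dsrc f = u \<and> dtgt f = v"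
  by (induction rule: dtyped.induct) auto

text \<open>The matrix of a diagram. A tensor product of diagrams cuts a word where the source of the left factor ends.\<close>

primrec dmat :: "dterm \<Rightarrow> weight list \<Rightarrow> vec" where
  "dmat (DId u) k = sng k 1"
| "dmat (DGen x) k = gmat x k"
| "dmat (g \<circ>\<^sub>D f) k = plin (dmat g) (dmat f k)"
| "dmat (f \<otimes>\<^sub>D g) k = conc (dmat f (take (length (dsrc f)) k)) (dmat g (drop (length (dsrc f)) k))"
| "dmat (DZero u v) k = 0"
| "dmat (f +\<^sub>D g) k = dmat f k + dmat g k"
| "dmat (a *\<^sub>D f) k = psc a (dmat f k)"


section \<open>The defining relations between the matrices\<close>

text \<open>The values of the two circles, with the denominators \<open>[3]\<close> and \<open>[2]\<close> divided out.\<close>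

lemma circle_values:
  "qn 6 * qn 2 / qn 3 = (qv ^ 3 + inverse qv ^ 3) * ((qv * qv + 1) / qv)"
  "qn 6 * qn 5 / (qn 3 * qn 2) = (qv ^ 2 - 1 + inverse qv ^ 2)
     * (qv ^ 4 + qv ^ 2 + 1 + inverse qv ^ 2 + inverse qv ^ 4)"
proof -
  have "qv ^ 6 - inverse qv ^ 6 = (qv ^ 3 - inverse qv ^ 3) * (qv ^ 3 + inverse qv ^ 3)"
    by (simp add: algebra_simps flip: power_add)
  hence 6: "qn 6 = qn 3 * (qv ^ 3 + inverse qv ^ 3)" by (simp add: qint_def)
  have "(qv ^ 4 + qv ^ 2 + 1 + inverse qv ^ 2 + inverse qv ^ 4) * (qv - inverse qv) = qv ^ 5 - inverse qv ^ 5"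
    by (simp add: field_simps eval_nat_numeral)
  hence 5: "qn 5 = qv ^ 4 + qv ^ 2 + 1 + inverse qv ^ 2 + inverse qv ^ 4"
    using qv_diff_inverse_nonzero by (simp add: qint_def field_simps)
  have 3: "qn 3 \<noteq> 0" by (rule qn_nonzero) simp
  show "qn 6 * qn 2 / qn 3 = (qv ^ 3 + inverse qv ^ 3) * ((qv * qv + 1) / qv)"
    unfolding 6 qn_2 using 3 by simp
  have "qv ^ 3 + inverse qv ^ 3 = qn 2 * (qv ^ 2 - 1 + inverse qv ^ 2)"
    unfolding qn_2 by (simp add: field_simps eval_nat_numeral)
  thus "qn 6 * qn 5 / (qn 3 * qn 2) = (qv ^ 2 - 1 + inverse qv ^ 2)
     * (qv ^ 4 + qv ^ 2 + 1 + inverse qv ^ 2 + inverse qv ^ 4)"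
    unfolding 6 5 using 3 qn_nonzero[of 2] by simp
qed

text \<open>The powers of \<open>q\<^sup>2 + 1\<close>, times powers of \<open>q\<close>, in the expanded form in which they arise as
  common denominators below.\<close>

lemma denominators:
  "1 + (qv * (qv * (qv * qv)) + qv * (qv * 2)) \<noteq> 0" "qv + qv * (qv * qv) \<noteq> 0"
proof -
  have "1 + (qv * (qv * (qv * qv)) + qv * (qv * 2)) = (1 + qv * qv) * (1 + qv * qv)"
    by (simp add: algebra_simps)
  thus "1 + (qv * (qv * (qv * qv)) + qv * (qv * 2)) \<noteq> 0" by simp
  have "qv + qv * (qv * qv) = qv * (1 + qv * qv)" by (simp add: algebra_simps)
  thus "qv + qv * (qv * qv) \<noteq> 0" by simp
qed

lemma denominator_bigon:
  "qv + (qv * (qv * (qv * 3)) + (qv * (qv * (qv * (qv * (qv * (qv * qv)))))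
    + qv * (qv * (qv * (qv * (qv * 3)))))) \<noteq> 0"
proof -
  have "qv + (qv * (qv * (qv * 3)) + (qv * (qv * (qv * (qv * (qv * (qv * qv)))))
      + qv * (qv * (qv * (qv * (qv * 3))))))
    = qv * ((1 + qv * qv) * ((1 + qv * qv) * (1 + qv * qv)))"
    by (simp add: algebra_simps)
  thus "qv + (qv * (qv * (qv * 3)) + (qv * (qv * (qv * (qv * (qv * (qv * qv)))))
    + qv * (qv * (qv * (qv * (qv * 3)))))) \<noteq> 0" by simp
qed

lemma ball_words_0: "(\<forall>k\<in>words []. P k) \<longleftrightarrow> P []"
  by simp

lemma ball_words_1: "(\<forall>k\<in>words [c]. P k) \<longleftrightarrow> (\<forall>x\<in>Wt c. P [x])"
  by (auto simp: words_def list_all2_Cons2)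

lemma ball_words_2: "(\<forall>k\<in>words [c, d]. P k) \<longleftrightarrow> (\<forall>x\<in>Wt c. \<forall>y\<in>Wt d. P [x, y])"
  by (auto simp: words_def list_all2_Cons2)

lemmas ball_words = ball_words_0 ball_words_1 ball_words_2 Wt.simps ball_simps simp_thms

text \<open>Each relation is evaluated on all words of its source; the results are explicit combinations of words,
  whose coefficients are compared after clearing denominators.\<close>

lemma dmat_zigzag1: "\<forall>k\<in>words [C1]. dmat ((id1 \<otimes>\<^sub>D cap1) \<circ>\<^sub>D (cup1 \<otimes>\<^sub>D id1)) k = dmat (id1) k"
  unfolding ball_words
  by ((intro conjI)?; (simp add: denominators qn_2 Hdiag_def gmat_eval lin_simps)?; (rule poly_mapping_eqI)?;
    (auto simp: coef_simps denominators)?)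

lemma dmat_zigzag2: "\<forall>k\<in>words [C1]. dmat ((cap1 \<otimes>\<^sub>D id1) \<circ>\<^sub>D (id1 \<otimes>\<^sub>D cup1)) k = dmat (id1) k"
  unfolding ball_words
  by ((intro conjI)?; (simp add: denominators qn_2 Hdiag_def gmat_eval lin_simps)?; (rule poly_mapping_eqI)?;
    (auto simp: coef_simps denominators)?)

lemma dmat_zigzag3: "\<forall>k\<in>words [C2]. dmat ((id2 \<otimes>\<^sub>D cap2) \<circ>\<^sub>D (cup2 \<otimes>\<^sub>D id2)) k = dmat (id2) k"
  unfolding ball_words
  by ((intro conjI)?; (simp add: denominators qn_2 Hdiag_def gmat_eval lin_simps)?; (rule poly_mapping_eqI)?;
    (auto simp: coef_simps denominators)?)

lemma dmat_zigzag4: "\<forall>k\<in>words [C2]. dmat ((cap2 \<otimes>\<^sub>D id2) \<circ>\<^sub>D (id2 \<otimes>\<^sub>D cup2)) k = dmat (id2) k"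
  unfolding ball_words
  by ((intro conjI)?; (simp add: denominators qn_2 Hdiag_def gmat_eval lin_simps)?; (rule poly_mapping_eqI)?;
    (auto simp: coef_simps denominators)?)

lemma dmat_rotate_left: "\<forall>k\<in>words [C1, C1]. dmat (pgen) k = dmat ((id2 \<otimes>\<^sub>D cap1) \<circ>\<^sub>D (id2 \<otimes>\<^sub>D id1 \<otimes>\<^sub>D cap1 \<otimes>\<^sub>D id1)
      \<circ>\<^sub>D (id2 \<otimes>\<^sub>D igen \<otimes>\<^sub>D id1 \<otimes>\<^sub>D id1) \<circ>\<^sub>D (cup2 \<otimes>\<^sub>D id1 \<otimes>\<^sub>D id1)) k"
  unfolding ball_words
  by ((intro conjI)?; (simp add: denominators qn_2 Hdiag_def gmat_eval lin_simps)?; (rule poly_mapping_eqI)?;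
    (auto simp: coef_simps denominators)?)

lemma dmat_rotate_right: "\<forall>k\<in>words [C1, C1]. dmat (pgen) k = dmat ((cap1 \<otimes>\<^sub>D id2) \<circ>\<^sub>D (id1 \<otimes>\<^sub>D cap1 \<otimes>\<^sub>D id1 \<otimes>\<^sub>D id2)
      \<circ>\<^sub>D (id1 \<otimes>\<^sub>D id1 \<otimes>\<^sub>D igen \<otimes>\<^sub>D id2) \<circ>\<^sub>D (id1 \<otimes>\<^sub>D id1 \<otimes>\<^sub>D cup2)) k"
  unfolding ball_words
  by ((intro conjI)?; (simp add: denominators qn_2 Hdiag_def gmat_eval lin_simps)?; (rule poly_mapping_eqI)?;
    (auto simp: coef_simps denominators)?)

lemma dmat_circle1: "\<forall>k\<in>words []. dmat (cap1 \<circ>\<^sub>D cup1) k = dmat ((- (qn 6 * qn 2 / qn 3)) *\<^sub>D DId []) k"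
  unfolding ball_words circle_values
  by ((intro conjI)?; (simp add: denominators qn_2 Hdiag_def gmat_eval lin_simps)?; (rule poly_mapping_eqI)?;
    (auto simp: coef_simps denominators)?)

lemma dmat_circle2: "\<forall>k\<in>words []. dmat (cap2 \<circ>\<^sub>D cup2) k = dmat ((qn 6 * qn 5 / (qn 3 * qn 2)) *\<^sub>D DId []) k"
  unfolding ball_words circle_values
  by ((intro conjI)?; (simp add: denominators qn_2 Hdiag_def gmat_eval lin_simps)?; (rule poly_mapping_eqI)?;
    (auto simp: coef_simps denominators)?)

lemma dmat_cap_i: "\<forall>k\<in>words [C2]. dmat (cap1 \<circ>\<^sub>D igen) k = dmat (DZero [C2] []) k"
  unfolding ball_words
  by ((intro conjI)?; (simp add: denominators qn_2 Hdiag_def gmat_eval lin_simps)?; (rule poly_mapping_eqI)?;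
    (auto simp: coef_simps denominators)?)

lemma dmat_bigon: "\<forall>k\<in>words [C2]. dmat (pgen \<circ>\<^sub>D igen) k = dmat ((- qn 2) *\<^sub>D id2) k"
  unfolding ball_words
  by ((intro conjI)?; (simp add: denominators denominator_bigon qn_2 Hdiag_def gmat_eval lin_simps)?; (rule poly_mapping_eqI)?;
    (auto simp: coef_simps denominators denominator_bigon)?)

lemma dmat_triangle: "\<forall>k\<in>words [C2]. dmat ((pgen \<otimes>\<^sub>D pgen) \<circ>\<^sub>D (id1 \<otimes>\<^sub>D cup1 \<otimes>\<^sub>D id1) \<circ>\<^sub>D igen) k = dmat (DZero [C2] [C2, C2]) k"
  unfolding ball_words
  by ((intro conjI)?; (simp add: Hdiag_def gmat_eval lin_simps)?; (rule poly_mapping_eqI)?;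
    (auto simp: coef_simps)?)

lemma dmat_H: "\<forall>k\<in>words [C1, C1]. dmat (Hdiag) k = dmat ((1 / qn 2) *\<^sub>D DId [C1, C1] +\<^sub>D igen \<circ>\<^sub>D pgen
      +\<^sub>D (- (1 / qn 2)) *\<^sub>D (cup1 \<circ>\<^sub>D cap1)) k"
  unfolding ball_words
  by ((intro conjI)?; (simp add: Hdiag_def gmat_eval lin_simps)?; (rule poly_mapping_eqI)?;
    (auto simp: lookup_add lookup_single when_def field_simps power2_eq_square power3_eq_cube
      power4_eq_xxxx)?; (simp add: qn_2 field_simps denominators)?)

text \<open>The given maps commute with the generators of the quantum group, again by evaluation on all words.\<close>

lemma gmat_gact_Cap1: "\<forall>k\<in>words [C1, C1]. \<forall>g\<in>{E S, E T, F S, F T, K S, K T, Kinv S, Kinv T}.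
    gact g (gmat Cap1 k) = plin (gmat Cap1) (ga g k)"
  unfolding ball_words
  by ((intro conjI)?; (simp add: denominators qn_2 gmat_eval letter_simps lin_simps)?; (rule poly_mapping_eqI)?;
    (auto simp: coef_simps denominators)?)

lemma gmat_gact_Cap2: "\<forall>k\<in>words [C2, C2]. \<forall>g\<in>{E S, E T, F S, F T, K S, K T, Kinv S, Kinv T}.
    gact g (gmat Cap2 k) = plin (gmat Cap2) (ga g k)"
  unfolding ball_words
  by ((intro conjI)?; (simp add: denominators qn_2 gmat_eval letter_simps lin_simps)?; (rule poly_mapping_eqI)?;
    (auto simp: coef_simps denominators)?)

lemma gmat_gact_Cup1: "\<forall>k\<in>words []. \<forall>g\<in>{E S, E T, F S, F T, K S, K T, Kinv S, Kinv T}.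
    gact g (gmat Cup1 k) = plin (gmat Cup1) (ga g k)"
  unfolding ball_words
  by ((intro conjI)?; (simp add: denominators qn_2 gmat_eval letter_simps lin_simps)?; (rule poly_mapping_eqI)?;
    (auto simp: coef_simps denominators)?)

lemma gmat_gact_Cup2: "\<forall>k\<in>words []. \<forall>g\<in>{E S, E T, F S, F T, K S, K T, Kinv S, Kinv T}.
    gact g (gmat Cup2 k) = plin (gmat Cup2) (ga g k)"
  unfolding ball_words
  by ((intro conjI)?; (simp add: denominators qn_2 gmat_eval letter_simps lin_simps)?; (rule poly_mapping_eqI)?;
    (auto simp: coef_simps denominators)?)

lemma gmat_gact_Pgen: "\<forall>k\<in>words [C1, C1]. \<forall>g\<in>{E S, E T, F S, F T, K S, K T, Kinv S, Kinv T}.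
    gact g (gmat Pgen k) = plin (gmat Pgen) (ga g k)"
  unfolding ball_words
  by ((intro conjI)?; (simp add: denominators qn_2 gmat_eval letter_simps lin_simps)?; (rule poly_mapping_eqI)?;
    (auto simp: coef_simps denominators)?)

lemma gmat_gact_Igen: "\<forall>k\<in>words [C2]. \<forall>g\<in>{E S, E T, F S, F T, K S, K T, Kinv S, Kinv T}.
    gact g (gmat Igen k) = plin (gmat Igen) (ga g k)"
  unfolding ball_words
  by ((intro conjI)?; (simp add: denominators qn_2 gmat_eval letter_simps lin_simps)?; (rule poly_mapping_eqI)?;
    (auto simp: coef_simps denominators)?)

lemma gmat_gact: "k \<in> words (dgen_src x) \<Longrightarrow> gact g (gmat x k) = plin (gmat x) (ga g k)"
proof -
  assume k: "k \<in> words (dgen_src x)"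
  have g: "g \<in> {E S, E T, F S, F T, K S, K T, Kinv S, Kinv T}"
  proof (cases g)
    case (E a)
    thus ?thesis by (cases a) simp_all
  next
    case (F a)
    thus ?thesis by (cases a) simp_all
  next
    case (K a)
    thus ?thesis by (cases a) simp_all
  next
    case (Kinv a)
    thus ?thesis by (cases a) simp_all
  qed
  have "\<forall>k\<in>words (dgen_src x). \<forall>g\<in>{E S, E T, F S, F T, K S, K T, Kinv S, Kinv T}.
      gact g (gmat x k) = plin (gmat x) (ga g k)"
    by (cases x; simp only: dgen_src.simps;
        rule gmat_gact_Cap1 gmat_gact_Cap2 gmat_gact_Cup1 gmat_gact_Cup2 gmat_gact_Pgen gmat_gact_Igen)
  from bspec[OF bspec[OF this k] g] show ?thesis .
qed

lemma dmat_drels: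
  assumes "(f, g) \<in> drels" "k \<in> words (dsrc f)"
  shows "dmat f k = dmat g k"
proof -
  have "dsrc Hdiag = [C1, C1]" by (simp add: Hdiag_def)
  note src = this dsrc.simps dgen_src.simps append.simps
  show ?thesis
    using assms unfolding drels_def insert_iff empty_iff prod.inject simp_thms
    apply (elim disjE conjE; hypsubst)
    apply (simp_all only: src)
    apply (rule dmat_zigzag1[rule_format] dmat_zigzag2[rule_format] dmat_zigzag3[rule_format]
        dmat_zigzag4[rule_format] dmat_rotate_left[rule_format] dmat_rotate_right[rule_format]
        dmat_circle1[rule_format] dmat_circle2[rule_format] dmat_cap_i[rule_format] dmat_bigon[rule_format]
        dmat_triangle[rule_format] dmat_H[rule_format]; assumption)+
    done
qed

lemma dmat_Aspan: "dtyped f u v \<Longrightarrow> k \<in> words u \<Longrightarrow> dmat f k \<in> Aspan (words v)"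
proof (induction arbitrary: k rule: dtyped.induct)
  case (2 x)
  thus ?case by (simp add: gmat_Aspan)
next
  case (3 g v w f u)
  thus ?case by (auto intro: Aspan_plin)
next
  case (4 f u u' g v v')
  then obtain k1 k2 where k: "k1 \<in> words u" "k2 \<in> words v" "take (length u) k = k1" "drop (length u) k = k2"
    by (auto elim: words_appendE)
  show ?case using 4 k dtyped_src_tgt[OF 4(1)] by (simp add: Aspan_conc_words)
qed auto

text \<open>The interchange law for matrices, on vectors whose left part has the shape of the source of \<open>f\<close>.\<close>

lemma dmat_tens:
  assumes "dtyped f u u'" "x \<in> Qspan (words u)"
  shows "plin (dmat (f \<otimes>\<^sub>D g)) (conc x y) = conc (plin (dmat f) x) (plin (dmat g) y)"
proof -
  have "plin (dmat (f \<otimes>\<^sub>D g)) (conc x y) = plin (\<lambda>k. plin (\<lambda>m. conc (dmat f k) (dmat g m)) y) x"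
    by (rule plin_conc)
      (use assms dtyped_src_tgt[OF assms(1)] words_length in \<open>auto simp: Qspan_def subset_iff\<close>)
  thus ?thesis by (simp only: conc_plin_left) (simp only: conc_plin_right)
qed

lemma dmat_tens_append:
  "dtyped f u u' \<Longrightarrow> k1 \<in> words u \<Longrightarrow> dmat (f \<otimes>\<^sub>D g) (k1 @ k2) = conc (dmat f k1) (dmat g k2)"
  using dtyped_src_tgt[of f u u'] words_length[of k1 u] by simp

text \<open>Induction on the diagram. For a tensor product of diagrams the generator is distributed over the two
  factors by its coproduct.\<close>

lemma dmat_gact: "dtyped f u v \<Longrightarrow> k \<in> words u \<Longrightarrow> gact g (dmat f k) = plin (dmat f) (ga g k)"
proof (induction arbitrary: k g rule: dtyped.induct)
  case (1 u)
  thus ?case by (simp add: fun_eq_iff)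
next
  case (2 x)
  have "dmat (DGen x) = gmat x" by (simp add: fun_eq_iff)
  thus ?case using 2 by (simp add: gmat_gact)
next
  case (3 h v w f u)
  have "gact g (dmat (h \<circ>\<^sub>D f) k) = plin (\<lambda>m. gact g (dmat h m)) (dmat f k)" by (simp add: plin_plin)
  also have "\<dots> = plin (\<lambda>m. plin (dmat h) (ga g m)) (dmat f k)"
    using 3 by (intro plin_eqI[where B = "words v"]) (auto intro: Aspan_Qspan dmat_Aspan)
  also have "\<dots> = plin (dmat h) (plin (dmat f) (ga g k))" using 3 by (simp flip: plin_plin)
  also have "\<dots> = plin (dmat (h \<circ>\<^sub>D f)) (ga g k)"
    unfolding plin_plin by (rule plin_cong) simp
  finally show ?case .
next
  case (4 f u u' h v v')
  then obtain k1 k2 where k: "k = k1 @ k2" "k1 \<in> words u" "k2 \<in> words v" by (auto elim: words_appendE)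
  have s: "ga g k1 \<in> Qspan (words u)" "sng k1 1 \<in> Qspan (words u)" for g
    using k by (auto intro: Aspan_Qspan ga_Aspan)
  note t = dmat_tens[OF 4(1) s(1), of h] dmat_tens[OF 4(1) s(2), of h]
  show ?case unfolding k dmat_tens_append[OF 4(1) k(2)]
    using 4 k by (cases g) (simp_all add: gact_conc ga_append plin_add t del: dmat.simps)
next
  case (6 f u v f')
  have "dmat (f +\<^sub>D f') = (\<lambda>k. dmat f k + dmat f' k)" by (simp add: fun_eq_iff)
  thus ?case using 6 by (simp add: plin_add plin_fun_add)
next
  case (7 a f u v)
  have "dmat (a *\<^sub>D f) = (\<lambda>k. psc a (dmat f k))" by (simp add: fun_eq_iff)
  thus ?case using 7 by (simp add: plin_psc plin_fun_psc)
next
  case (5 u v)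
  have "dmat (DZero u v) = (\<lambda>k. 0)" by (simp add: fun_eq_iff)
  thus ?case by simp
qed

lemma dmat_Act:
  assumes "dtyped f u v" "x \<in> Qspan (words u)"
  shows "Act y (plin (dmat f) x) = plin (dmat f) (Act y x)"
proof -
  have g: "gact g (plin (dmat f) x) = plin (dmat f) (gact g x)" if "x \<in> Qspan (words u)" for g x
    unfolding plin_plin using that dmat_gact[OF assms(1)] by (intro plin_eqI)
  have w: "wact gs (plin (dmat f) x) = plin (dmat f) (wact gs x)" for gs
    by (induction gs) (simp_all add: g wact_Qspan assms(2))
  show ?thesis unfolding Act_def w by (simp add: plin_plin)
qed

lemma deq_typed: "deq u v f g \<Longrightarrow> dtyped f u v \<and> dtyped g u v"
proof (induction rule: deq.induct)
  case (tens_assoc f u u' g v v' h w w')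
  thus ?case using dtyped.intros(4)[of "f \<otimes>\<^sub>D g" "u @ v" "u' @ v'" h w w'] by (auto intro: dtyped.intros)
next
  case (tens_unit_left f u v)
  thus ?case using dtyped.intros(4)[OF dtyped.intros(1)[of "[]"], of f u v] by auto
next
  case (tens_unit_right f u v)
  thus ?case using dtyped.intros(4)[OF _ dtyped.intros(1)[of "[]"], of f u v] by auto
qed (auto intro: dtyped.intros)

lemma dmat_eqI:
  assumes "dtyped f u v" "\<And>m. m \<in> words v \<Longrightarrow> dmat g m = dmat g' m" "k \<in> words u"
  shows "plin (dmat g) (dmat f k) = plin (dmat g') (dmat f k)"
  using dmat_Aspan[OF assms(1,3)] assms(2) by (intro plin_eqI[where B = "words v"] Aspan_Qspan)

text \<open>The axioms of a linear monoidal category hold for matrices on words, and the defining relations were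
  verified above.\<close>

lemma deq_dmat: "deq u v f g \<Longrightarrow> k \<in> words u \<Longrightarrow> dmat f k = dmat g k"
proof (induction arbitrary: k rule: deq.induct)
  case (cong_comp v w g g' u f f')
  have "plin (dmat g) (dmat f k) = plin (dmat g') (dmat f k)"
    using deq_typed[OF cong_comp(2)] cong_comp by (intro dmat_eqI) auto
  thus ?case using cong_comp by simp
next
  case (cong_tens u u' f f' v v' g g')
  then obtain k1 k2 where k: "k = k1 @ k2" "k1 \<in> words u" "k2 \<in> words v" by (auto elim: words_appendE)
  thus ?case using cong_tens deq_typed[OF cong_tens(1)] dmat_tens_append[of f u u' k1] dmat_tens_append[of f' u u' k1]
    by simp
next
  case (relation f g u v)
  thus ?case using dtyped_src_tgt[of f u v] by (auto intro: dmat_drels)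
next
  case (interchange g v w f u g' v' w' f' u')
  then obtain k1 k2 where k: "k = k1 @ k2" "k1 \<in> words u" "k2 \<in> words u'" by (auto elim: words_appendE)
  have "dmat ((g \<otimes>\<^sub>D g') \<circ>\<^sub>D (f \<otimes>\<^sub>D f')) k = plin (dmat (g \<otimes>\<^sub>D g')) (conc (dmat f k1) (dmat f' k2))"
    using dmat_tens_append[OF interchange(2) k(2)] k(1) by simp
  also have "\<dots> = conc (plin (dmat g) (dmat f k1)) (plin (dmat g') (dmat f' k2))"
    using interchange k by (intro dmat_tens[of g v w]) (auto intro: Aspan_Qspan dmat_Aspan)
  also have "\<dots> = dmat ((g \<circ>\<^sub>D f) \<otimes>\<^sub>D (g' \<circ>\<^sub>D f')) k"
    using dmat_tens_append[OF dtyped.intros(3)[OF interchange(1,2)] k(2), of "g' \<circ>\<^sub>D f'" k2] k(1) by simp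
  finally show ?case by simp
next
  case (tens_assoc f u u' g v v' h w w')
  then obtain k1 m where 1: "k = k1 @ m" "k1 \<in> words u" "m \<in> words (v @ w)" by (auto elim: words_appendE)
  then obtain k2 k3 where k: "k = k1 @ k2 @ k3" "k2 \<in> words v" "k3 \<in> words w" by (auto elim: words_appendE)
  have "dmat ((f \<otimes>\<^sub>D g) \<otimes>\<^sub>D h) ((k1 @ k2) @ k3) = conc (conc (dmat f k1) (dmat g k2)) (dmat h k3)"
    using dmat_tens_append[OF dtyped.intros(4)[OF tens_assoc(1,2)] words_appendI[OF 1(2) k(2)], of h k3]
      dmat_tens_append[OF tens_assoc(1) 1(2), of g k2] by (simp only:)
  moreover have "dmat (f \<otimes>\<^sub>D (g \<otimes>\<^sub>D h)) (k1 @ k2 @ k3) = conc (dmat f k1) (conc (dmat g k2) (dmat h k3))"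
    using dmat_tens_append[OF tens_assoc(1) 1(2), of "g \<otimes>\<^sub>D h" "k2 @ k3"]
      dmat_tens_append[OF tens_assoc(2) k(2), of h k3] by (simp only:)
  ultimately show ?case by (simp add: k conc_assoc del: dmat.simps)
next
  case (tens_unit_left f u v)
  thus ?case by simp
next
  case (tens_unit_right f u v)
  thus ?case using dtyped_src_tgt[of f u v] words_length[of k u] by simp
next
  case (comp_id_left f u v)
  have "dmat (DId v) = (\<lambda>k. sng k 1)" by (simp add: fun_eq_iff)
  thus ?case by simp
next
  case (comp_add_left g v w g' f u)
  have "dmat (g +\<^sub>D g') = (\<lambda>k. dmat g k + dmat g' k)" by (simp add: fun_eq_iff)
  thus ?case by (simp add: plin_fun_add)
next
  case (comp_assoc h w x g v f u)
  have "dmat (h \<circ>\<^sub>D g) = (\<lambda>k. plin (dmat h) (dmat g k))" by (simp add: fun_eq_iff)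
  thus ?case by (simp add: plin_plin)
next
  case (tens_add_left f u u' f' g v v')
  have "dsrc f = dsrc f'" using dtyped_src_tgt tens_add_left(1,2) by metis
  thus ?case by (simp add: conc_add_left)
next
  case (comp_scale_left a g v w f u)
  have "dmat (a *\<^sub>D g) = (\<lambda>k. psc a (dmat g k))" by (simp add: fun_eq_iff)
  thus ?case by (simp add: plin_fun_psc)
qed (simp_all add: add_ac plin_add plin_psc psc_add psc_add_left psc_psc psc_minus_left psc_neg1
    conc_add_left conc_add_right conc_psc_left conc_psc_right)


section \<open>The diagrammatic category\<close>

definition welltyped :: "dterm \<Rightarrow> bool" where
  "welltyped f \<longleftrightarrow> dtyped f (dsrc f) (dtgt f)"

lemma dtyped_iff: "dtyped f u v \<longleftrightarrow> welltyped f \<and> dsrc f = u \<and> dtgt f = v"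
  using dtyped_src_tgt[of f u v] by (auto simp: welltyped_def)

lemma welltyped_dtyped: "welltyped f \<Longrightarrow> dsrc f = u \<Longrightarrow> dtgt f = v \<Longrightarrow> dtyped f u v"
  by (simp add: dtyped_iff)

lemma welltyped_simps [simp]:
  "welltyped (DId u)" "welltyped (DGen x)" "welltyped (DZero u v)"
  "welltyped g \<Longrightarrow> welltyped f \<Longrightarrow> dsrc g = dtgt f \<Longrightarrow> welltyped (g \<circ>\<^sub>D f)"
  "welltyped f \<Longrightarrow> welltyped g \<Longrightarrow> welltyped (f \<otimes>\<^sub>D g)"
  "welltyped f \<Longrightarrow> welltyped g \<Longrightarrow> dsrc f = dsrc g \<Longrightarrow> dtgt f = dtgt g \<Longrightarrow> welltyped (f +\<^sub>D g)"
  "a \<in> Aset \<Longrightarrow> welltyped f \<Longrightarrow> welltyped (a *\<^sub>D f)"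
  unfolding welltyped_def by (auto intro: dtyped.intros)

lemma dcls_eqI:
  assumes "deq u v f g"
  shows "dcls f = dcls g"
proof -
  have "deq u' v' f h \<Longrightarrow> deq u' v' g h" "deq u' v' g h \<Longrightarrow> deq u' v' f h" for u' v' h
    using assms deq_typed[OF assms] deq_typed[of u' v' f h] deq_typed[of u' v' g h]
    by (metis deq_sym deq_trans dtyped_src_tgt)+
  thus ?thesis unfolding dcls_def by blast
qed

text \<open>The congruence is typed, but an expression has at most one source and target, so classes need not
  record them.\<close>

lemma dcls_mem:
  assumes "dtyped f u v"
  shows "g \<in> dcls f \<longleftrightarrow> deq u v f g"
proof -
  have "u' = u \<and> v' = v" if "deq u' v' f g" for u' v'
    using deq_typed[OF that] dtyped_src_tgt[of f u' v'] dtyped_src_tgt[OF assms] by simp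
  thus ?thesis unfolding dcls_def by blast
qed

lemma dcls_self: "welltyped f \<Longrightarrow> f \<in> dcls f"
  using dcls_mem[of f "dsrc f" "dtgt f" f] by (simp add: welltyped_def deq_refl)

lemma dcls_memD: "g \<in> dcls f \<Longrightarrow> welltyped f \<Longrightarrow> deq (dsrc f) (dtgt f) f g"
  using dcls_mem[of f "dsrc f" "dtgt f" g] by (simp add: welltyped_def)

text \<open>The operations of \<open>Dsp4\<close> are unions over representatives; for a congruence all members of the union
  coincide.\<close>

lemma lift_dcls2:
  assumes "welltyped f" "welltyped g"
    "\<And>f' g'. deq (dsrc f) (dtgt f) f f' \<Longrightarrow> deq (dsrc g) (dtgt g) g g' \<Longrightarrow> deq u v (op f g) (op f' g')"
  shows "(\<Union>f'\<in>dcls f. \<Union>g'\<in>dcls g. dcls (op f' g')) = dcls (op f g)"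
proof -
  have "dcls (op f' g') = dcls (op f g)" if "f' \<in> dcls f" "g' \<in> dcls g" for f' g'
    using dcls_eqI[OF assms(3)[OF dcls_memD[OF that(1) assms(1)] dcls_memD[OF that(2) assms(2)]]] ..
  thus ?thesis using dcls_self[OF assms(1)] dcls_self[OF assms(2)] by blast
qed

lemma D_arr: "arr Dsp4 u v = {dcls f | f. welltyped f \<and> dsrc f = u \<and> dtgt f = v}"
  by (simp add: Dsp4_def dtyped_iff)

lemma D_comp:
  assumes "welltyped g" "welltyped f" "dsrc g = dtgt f"
  shows "Cmp Dsp4 (dcls g) (dcls f) = dcls (g \<circ>\<^sub>D f)"
proof -
  have "(\<Union>g'\<in>dcls g. \<Union>f'\<in>dcls f. dcls (g' \<circ>\<^sub>D f')) = dcls (g \<circ>\<^sub>D f)"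
    by (rule lift_dcls2[where u = "dsrc f" and v = "dtgt g"])
      (use assms in \<open>auto intro: cong_comp\<close>)
  thus ?thesis by (simp add: Dsp4_def)
qed

lemma D_tens:
  assumes "welltyped f" "welltyped g"
  shows "MTen Dsp4 (dcls f) (dcls g) = dcls (f \<otimes>\<^sub>D g)"
proof -
  have "(\<Union>f'\<in>dcls f. \<Union>g'\<in>dcls g. dcls (f' \<otimes>\<^sub>D g')) = dcls (f \<otimes>\<^sub>D g)"
    by (rule lift_dcls2) (use assms in \<open>auto intro: cong_tens\<close>)
  thus ?thesis by (simp add: Dsp4_def)
qed

lemma D_add:
  assumes "welltyped f" "welltyped g" "dsrc f = dsrc g" "dtgt f = dtgt g"
  shows "dcls f \<oplus>\<^bsub>Hom Dsp4 u v\<^esub> dcls g = dcls (f +\<^sub>D g)"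
proof -
  have "(\<Union>f'\<in>dcls f. \<Union>g'\<in>dcls g. dcls (f' +\<^sub>D g')) = dcls (f +\<^sub>D g)"
    by (rule lift_dcls2) (use assms in \<open>auto intro: cong_add\<close>)
  thus ?thesis by (simp add: Dsp4_def)
qed

lemma D_smult:
  assumes "a \<in> Aset" "welltyped f"
  shows "a \<odot>\<^bsub>Hom Dsp4 u v\<^esub> dcls f = dcls (a *\<^sub>D f)"
proof -
  have "dcls (a *\<^sub>D f') = dcls (a *\<^sub>D f)" if "f' \<in> dcls f" for f'
    using dcls_eqI[OF cong_scale[OF assms(1) dcls_memD[OF that assms(2)]]] ..
  hence "(\<Union>f'\<in>dcls f. dcls (a *\<^sub>D f')) = dcls (a *\<^sub>D f)" using dcls_self[OF assms(2)] by blast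
  thus ?thesis by (simp add: Dsp4_def)
qed

lemma D_consts [simp]:
  "Obj Dsp4 = UNIV" "Idm Dsp4 u = dcls (DId u)" "OTen Dsp4 u v = u @ v" "Unt Dsp4 = []"
  "\<zero>\<^bsub>Hom Dsp4 u v\<^esub> = dcls (DZero u v)"
  by (simp_all add: Dsp4_def)

lemmas D_simps = D_comp D_tens D_add D_smult

lemma arrI: "welltyped f \<Longrightarrow> dsrc f = u \<Longrightarrow> dtgt f = v \<Longrightarrow> dcls f \<in> arr Dsp4 u v"
  by (auto simp: D_arr)

lemma arrE:
  assumes "x \<in> arr Dsp4 u v"
  obtains f where "x = dcls f" "welltyped f" "dsrc f = u" "dtgt f = v"
  using assms by (auto simp: D_arr)

lemma D_abelian: "abelian_group (Hom Dsp4 u v)"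
proof (rule abelian_groupI)
  fix x y z assume xyz: "x \<in> arr Dsp4 u v" "y \<in> arr Dsp4 u v" "z \<in> arr Dsp4 u v"
  show "x \<oplus>\<^bsub>Hom Dsp4 u v\<^esub> y \<in> arr Dsp4 u v"
    using xyz by (elim arrE) (simp add: D_simps arrI)
  show "x \<oplus>\<^bsub>Hom Dsp4 u v\<^esub> y \<oplus>\<^bsub>Hom Dsp4 u v\<^esub> z = x \<oplus>\<^bsub>Hom Dsp4 u v\<^esub> (y \<oplus>\<^bsub>Hom Dsp4 u v\<^esub> z)"
    using xyz by (elim arrE)
      (simp add: D_simps, rule dcls_eqI, rule deq.add_assoc; (assumption | (rule welltyped_dtyped; (assumption | rule refl | (simp; fail)))))
next
  fix x y assume xy: "x \<in> arr Dsp4 u v" "y \<in> arr Dsp4 u v"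
  show "x \<oplus>\<^bsub>Hom Dsp4 u v\<^esub> y = y \<oplus>\<^bsub>Hom Dsp4 u v\<^esub> x"
    using xy by (elim arrE)
      (simp add: D_simps, rule dcls_eqI, rule deq.add_comm; (assumption | (rule welltyped_dtyped; (assumption | rule refl | (simp; fail)))))
next
  fix x assume x: "x \<in> arr Dsp4 u v"
  show "\<zero>\<^bsub>Hom Dsp4 u v\<^esub> \<oplus>\<^bsub>Hom Dsp4 u v\<^esub> x = x"
    using x by (elim arrE)
      (simp add: D_simps, rule dcls_eqI, rule deq.add_zero; (assumption | (rule welltyped_dtyped; (assumption | rule refl | (simp; fail)))))
  from x obtain f where f: "x = dcls f" "welltyped f" "dsrc f = u" "dtgt f = v" by (auto simp: D_arr)
  have "dcls (f +\<^sub>D (- 1) *\<^sub>D f) = dcls (DZero u v)"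
    using f by (intro dcls_eqI[OF add_neg]) (simp add: dtyped_iff)
  moreover have "dcls ((- 1) *\<^sub>D f +\<^sub>D f) = dcls (f +\<^sub>D (- 1) *\<^sub>D f)"
    using f by (intro dcls_eqI[OF add_comm, of _ u v]) (simp_all add: dtyped_iff)
  ultimately have "dcls ((- 1) *\<^sub>D f) \<oplus>\<^bsub>Hom Dsp4 u v\<^esub> x = \<zero>\<^bsub>Hom Dsp4 u v\<^esub>"
    using f by (simp add: D_simps)
  moreover have "dcls ((- 1) *\<^sub>D f) \<in> arr Dsp4 u v"
    unfolding D_arr using f by (intro CollectI exI[of _ "(- 1) *\<^sub>D f"]) simp
  ultimately show "\<exists>y\<in>arr Dsp4 u v. y \<oplus>\<^bsub>Hom Dsp4 u v\<^esub> x = \<zero>\<^bsub>Hom Dsp4 u v\<^esub>" by blast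
next
  show "\<zero>\<^bsub>Hom Dsp4 u v\<^esub> \<in> arr Dsp4 u v"
    unfolding D_arr by (intro CollectI exI[of _ "DZero u v"]) simp
qed

lemma D_module: "module Aring (Hom Dsp4 u v)"
proof (rule moduleI[OF Aring_cring D_abelian])
  show "a \<odot>\<^bsub>Hom Dsp4 u v\<^esub> x \<in> arr Dsp4 u v" if "a \<in> Aset" "x \<in> arr Dsp4 u v" for a x
    using that by (elim arrE) (simp add: D_simps arrI)
  show "(a \<oplus>\<^bsub>Aring\<^esub> b) \<odot>\<^bsub>Hom Dsp4 u v\<^esub> x = a \<odot>\<^bsub>Hom Dsp4 u v\<^esub> x \<oplus>\<^bsub>Hom Dsp4 u v\<^esub> b \<odot>\<^bsub>Hom Dsp4 u v\<^esub> x"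
    if "a \<in> Aset" "b \<in> Aset" "x \<in> arr Dsp4 u v" for a b x
    using that by (elim arrE)
      (simp add: D_simps, rule dcls_eqI, rule deq.scale_add_left; (assumption | (rule welltyped_dtyped; (assumption | rule refl | (simp; fail)))))
  show "a \<odot>\<^bsub>Hom Dsp4 u v\<^esub> (x \<oplus>\<^bsub>Hom Dsp4 u v\<^esub> y) = a \<odot>\<^bsub>Hom Dsp4 u v\<^esub> x \<oplus>\<^bsub>Hom Dsp4 u v\<^esub> a \<odot>\<^bsub>Hom Dsp4 u v\<^esub> y"
    if "a \<in> Aset" "x \<in> arr Dsp4 u v" "y \<in> arr Dsp4 u v" for a x y
    using that by (elim arrE)
      (simp add: D_simps, rule dcls_eqI, rule deq.scale_add_right; (assumption | (rule welltyped_dtyped; (assumption | rule refl | (simp; fail)))))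
  show "(a \<otimes>\<^bsub>Aring\<^esub> b) \<odot>\<^bsub>Hom Dsp4 u v\<^esub> x = a \<odot>\<^bsub>Hom Dsp4 u v\<^esub> (b \<odot>\<^bsub>Hom Dsp4 u v\<^esub> x)"
    if "a \<in> Aset" "b \<in> Aset" "x \<in> arr Dsp4 u v" for a b x
    using that by (elim arrE)
      (simp add: D_simps, rule dcls_eqI, rule deq.scale_scale; (assumption | (rule welltyped_dtyped; (assumption | rule refl | (simp; fail)))))
  show "\<one>\<^bsub>Aring\<^esub> \<odot>\<^bsub>Hom Dsp4 u v\<^esub> x = x" if "x \<in> arr Dsp4 u v" for x
    using that by (elim arrE)
      (simp add: D_simps, rule dcls_eqI, rule deq.scale_one; (rule welltyped_dtyped; (assumption | rule refl | (simp; fail))))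
qed

lemmas deq_laws = deq.comp_id_left deq.comp_id_right deq.comp_assoc deq.comp_add_left deq.comp_add_right
  deq.comp_scale_left deq.comp_scale_right deq.tens_add_left deq.tens_add_right deq.tens_scale_left
  deq.tens_scale_right deq.tens_id deq.interchange deq.tens_assoc deq.tens_unit_left deq.tens_unit_right

text \<open>For representatives of the arrows, each axiom of a linear monoidal category is one of the rules that
  generate the congruence.\<close>

lemma D_category: "strict_linear_monoidal_category Dsp4"
  by (rule strict_linear_monoidal_category.intro; (elim arrE)?;
      (simp add: D_module D_simps arrI; fail |
        (simp add: D_simps, rule dcls_eqI, rule deq_laws;
          (assumption | (rule welltyped_dtyped; (assumption | rule refl | (simp; fail)))))))


section \<open>The functor\<close>

definition Xi :: "dterm set \<Rightarrow> vec \<Rightarrow> vec" where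
  "Xi Z = plin (dmat (SOME f. f \<in> Z))"

text \<open>Congruent diagrams have the same matrix on words of the right shape, so the choice of a representative
  is immaterial there.\<close>

lemma Xi_dcls:
  assumes "welltyped f" "x \<in> Aspan (words (dsrc f))"
  shows "Xi (dcls f) x = plin (dmat f) x"
proof -
  have "(SOME g. g \<in> dcls f) \<in> dcls f" using dcls_self[OF assms(1)] by (rule someI)
  hence "deq (dsrc f) (dtgt f) f (SOME g. g \<in> dcls f)" using dcls_memD assms(1) by blast
  thus ?thesis unfolding Xi_def
    by (intro plin_eqI[OF Aspan_Qspan[OF assms(2)]] deq_dmat[symmetric])
qed

lemma dmat_plin_Aspan: "welltyped f \<Longrightarrow> x \<in> Aspan (words (dsrc f)) \<Longrightarrow> plin (dmat f) x \<in> Aspan (words (dtgt f))"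
  by (erule Aspan_plin) (simp add: dmat_Aspan welltyped_def)

lemma Xi_hom:
  assumes "f \<in> arr Dsp4 u v"
  shows "Xi f \<in> umod_hom (Xi0 u) (Xi0 v)"
proof -
  obtain g where g: "f = dcls g" "welltyped g" "dsrc g = u" "dtgt g = v" using assms by (rule arrE)
  have "uact a (plin (dmat g) x) = plin (dmat g) (uact a x)" if "x \<in> Aspan (words u)" for a x
    by (rule dmat_Act[of g u v]) (use g that in \<open>auto simp: dtyped_iff Aspan_Qspan\<close>)
  thus ?thesis
    using g dmat_plin_Aspan[OF g(2)] Xi_dcls[OF g(2)]
    by (auto simp: umod_hom_def Xi0_smult uact_Aspan plin_add Aspan_add)
qed

lemma amap_hom: "h \<in> umod_hom M N \<Longrightarrow> amap M N h"
  by (auto simp: umod_hom_def amap_def ascal_def UA_cst)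

text \<open>On pure tensors both sides are the concatenation of the images under the two matrices.\<close>

lemma mu_natural:
  assumes "f \<in> arr Dsp4 u u'" "g \<in> arr Dsp4 v v'" "t \<in> carrier (Xten u v)"
  shows "Xi (MTen Dsp4 f g) (mu u v t) = mu u' v' (tmap (Xi0 u') (Xi0 v') (Xi f) (Xi g) t)"
proof -
  obtain f' where f: "f = dcls f'" "welltyped f'" "dsrc f' = u" "dtgt f' = u'" using assms(1) by (rule arrE)
  obtain g' where g: "g = dcls g'" "welltyped g'" "dsrc g' = v" "dtgt g' = v'" using assms(2) by (rule arrE)
  have fg: "Xi (MTen Dsp4 f g) x = plin (dmat (f' \<otimes>\<^sub>D g')) x" if "x \<in> Aspan (words (u @ v))" for x
    using f g that by (simp add: D_tens Xi_dcls del: dmat.simps)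
  note m = tmap_closed[OF Xi0_pair Xi0_pair amap_hom[OF Xi_hom[OF assms(1)]] amap_hom[OF Xi_hom[OF assms(2)]]]
    tmap_add[OF Xi0_pair Xi0_pair amap_hom[OF Xi_hom[OF assms(1)]] amap_hom[OF Xi_hom[OF assms(2)]]]
    tmap_pure[OF Xi0_pair Xi0_pair amap_hom[OF Xi_hom[OF assms(1)]] amap_hom[OF Xi_hom[OF assms(2)]], simplified]
  from assms(3) show ?thesis
  proof (induction t rule: Xten_induct)
    case (pure x y)
    have t: "plin (dmat (f' \<otimes>\<^sub>D g')) (conc x y) = conc (plin (dmat f') x) (plin (dmat g') y)"
      using f pure by (intro dmat_tens[of f' u u']) (auto simp: dtyped_iff Aspan_Qspan)
    have "Xi f x = plin (dmat f') x" "Xi g y = plin (dmat g') y"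
      "plin (dmat f') x \<in> Aspan (words u')" "plin (dmat g') y \<in> Aspan (words v')"
      using f g pure dmat_plin_Aspan[of f' x] dmat_plin_Aspan[of g' y] by (simp_all add: Xi_dcls)
    thus ?case using pure by (simp add: mu_pure m fg Aspan_conc_words t del: dmat.simps)
  next
    case (add Z W)
    thus ?case by (simp add: m mu_add mu_closed fg Aspan_add plin_add del: dmat.simps)
  qed
qed

lemma Xi_functor: "linear_monoidal_functor Dsp4 Xi0 Xi mu eta"
proof (intro linear_monoidal_functor.intro[OF D_category] linear_monoidal_functor_axioms.intro)
  show "left_module UA (Xi0 u)" for u by (rule Xi0_left_module)
  show "Xi f \<in> umod_hom (Xi0 u) (Xi0 v)" if "f \<in> arr Dsp4 u v" for u v f using that by (rule Xi_hom)
  show "Xi (Idm Dsp4 u) x = x" if "x \<in> carrier (Xi0 u)" for u x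
  proof -
    have "dmat (DId u) = (\<lambda>k. sng k 1)" by (simp add: fun_eq_iff)
    thus ?thesis using that by (simp add: Xi_dcls)
  qed
  show "Xi (Cmp Dsp4 g f) x = Xi g (Xi f x)"
    if h: "g \<in> arr Dsp4 v w" "f \<in> arr Dsp4 u v" and x: "x \<in> carrier (Xi0 u)" for u v w g f x
  proof -
    obtain g' where g: "g = dcls g'" "welltyped g'" "dsrc g' = v" "dtgt g' = w" using h(1) by (rule arrE)
    obtain f' where f: "f = dcls f'" "welltyped f'" "dsrc f' = u" "dtgt f' = v" using h(2) by (rule arrE)
    have "dmat (g' \<circ>\<^sub>D f') = (\<lambda>k. plin (dmat g') (dmat f' k))" by (simp add: fun_eq_iff)
    thus ?thesis using f g x dmat_plin_Aspan[OF f(2), of x]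
      by (simp add: D_comp Xi_dcls plin_plin)
  qed
  show "Xi (f \<oplus>\<^bsub>Hom Dsp4 u v\<^esub> g) x = Xi f x \<oplus>\<^bsub>Xi0 v\<^esub> Xi g x"
    if h: "f \<in> arr Dsp4 u v" "g \<in> arr Dsp4 u v" and x: "x \<in> carrier (Xi0 u)" for u v f g x
  proof -
    obtain g' where g: "g = dcls g'" "welltyped g'" "dsrc g' = u" "dtgt g' = v" using h(2) by (rule arrE)
    obtain f' where f: "f = dcls f'" "welltyped f'" "dsrc f' = u" "dtgt f' = v" using h(1) by (rule arrE)
    have "dmat (f' +\<^sub>D g') = (\<lambda>k. dmat f' k + dmat g' k)" by (simp add: fun_eq_iff)
    thus ?thesis using f g x by (simp add: D_add Xi_dcls plin_fun_add)
  qed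
  show "Xi (a \<odot>\<^bsub>Hom Dsp4 u v\<^esub> f) x = ascal (Xi0 v) a (Xi f x)"
    if a: "a \<in> Aset" and h: "f \<in> arr Dsp4 u v" and x: "x \<in> carrier (Xi0 u)" for u v a f x
  proof -
    obtain f' where f: "f = dcls f'" "welltyped f'" "dsrc f' = u" "dtgt f' = v" using h by (rule arrE)
    have "dmat (a *\<^sub>D f') = (\<lambda>k. psc a (dmat f' k))" by (simp add: fun_eq_iff)
    thus ?thesis using f a x dmat_plin_Aspan[OF f(2), of x]
      by (simp add: D_smult Xi_dcls plin_fun_psc Xi0_ascal)
  qed
  show "mu u v \<in> umod_iso (Xten u v) (Xi0 (OTen Dsp4 u v))" for u v using mu_iso by simp
  show "Xi (MTen Dsp4 f g) (mu u v t) = mu u' v' (tmap (Xi0 u') (Xi0 v') (Xi f) (Xi g) t)"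
    if "f \<in> arr Dsp4 u u'" "g \<in> arr Dsp4 v v'" "t \<in> carrier (Xten u v)" for u u' v v' f g t
    using that by (rule mu_natural)
  show "eta \<in> umod_iso uunit (Xi0 (Unt Dsp4))" using eta_iso by simp
  show "mu (OTen Dsp4 u v) w (tmap (Xi0 (OTen Dsp4 u v)) (Xi0 w) (mu u v) (\<lambda>z. z) s)
      = mu u (OTen Dsp4 v w) (tmap (Xi0 u) (Xi0 (OTen Dsp4 v w)) (\<lambda>x. x) (mu v w)
          (tassoc (Xi0 u) (Xi0 v) (Xi0 w) s))"
    if "s \<in> carrier (tensor (Xten u v) (Xi0 w))" for u v w s
    using mu_associative[OF that] by simp
  show "mu (Unt Dsp4) u (tmap (Xi0 (Unt Dsp4)) (Xi0 u) eta (\<lambda>x. x) y) = tlunit (Xi0 u) y"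
    if "y \<in> carrier (tensor uunit (Xi0 u))" for u y
    using mu_left_unit[OF that] by simp
  show "mu u (Unt Dsp4) (tmap (Xi0 u) (Xi0 (Unt Dsp4)) (\<lambda>x. x) eta z) = trunit (Xi0 u) z"
    if "z \<in> carrier (tensor (Xi0 u) uunit)" for u z
    using mu_right_unit[OF that] by simp
qed

subsection \<open>Values on the generators\<close>

lemma Xi0_letters: "V1 = Xi0 [C1]" "V2 = Xi0 [C2]"
  by (simp_all add: Xi0_def)

lemma Xi_gen: "x \<in> Aspan (words (dgen_src g)) \<Longrightarrow> Xi (dcls (DGen g)) x = plin (gmat g) x"
proof -
  have "dmat (DGen g) = gmat g" by (simp add: fun_eq_iff)
  thus "x \<in> Aspan (words (dgen_src g)) \<Longrightarrow> Xi (dcls (DGen g)) x = plin (gmat g) x"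
    using Xi_dcls[of "DGen g" x] by simp
qed

text \<open>A map on the tensor product given by \<open>b\<close> on pure tensors is the matrix \<open>G\<close> on words if the two agree on
  concatenations; that \<open>b\<close> is balanced is inherited from the linearity of \<open>G\<close>. The injection \<open>e\<close>
  embeds the target into vectors, so that the unit module can be treated like a module on words.\<close>

lemma tlift_plin:
  fixes P :: "('p, 'x) ring_scheme"
  assumes P: "abelian_group P" and inj: "inj_on e (carrier P)"
    and add: "\<And>p q. p \<in> carrier P \<Longrightarrow> q \<in> carrier P \<Longrightarrow> e (p \<oplus>\<^bsub>P\<^esub> q) = e p + e q"
    and b: "\<And>x y. x \<in> Aspan (words u) \<Longrightarrow> y \<in> Aspan (words v) \<Longrightarrow> b x y \<in> carrier P \<and> e (b x y) = plin G (conc x y)"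
    and t: "t \<in> carrier (Xten u v)"
  shows "e (tlift P b t) = plin G (mu u v t)"
proof -
  interpret P: abelian_group P by (rule P)
  have bal: "tens_pair.balanced (Xi0 u) (Xi0 v) P b"
    unfolding tens_pair.balanced_def[OF Xi0_pair] using b
    by (auto intro!: inj_onD[OF inj] simp: add Aspan_add Aspan_psc Xi0_ascal plin_add conc_add_left
        conc_add_right conc_psc_left conc_psc_right)
  note tl = tens_pair.tlift_closed[OF Xi0_pair P bal] tens_pair.tlift_add[OF Xi0_pair P bal]
    tens_pair.tlift_pure[OF Xi0_pair P bal, simplified]
  show ?thesis using t
    by (induction t rule: Xten_induct) (simp_all add: tl b mu_pure mu_add add plin_add)
qed

lemma plin_conc_letters:
  assumes "\<And>r s. G [r, s] = h (r, s)" "x \<in> Aspan (words [c])" "y \<in> Aspan (words [d])"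
  shows "plin G (conc x y) = (\<Sum>k\<in>supp x. \<Sum>m\<in>supp y. psc (coef x k * coef y m) (h (hd k, hd m)))"
proof -
  have "plin G (conc x y) = plin (\<lambda>k. plin (\<lambda>m. h (hd k, hd m)) y) x"
    using words_1 Aspan_supp[OF assms(2)] Aspan_supp[OF assms(3)]
    by (intro plin_conc) (metis append_Cons append_Nil assms(1) list.sel(1))
  thus ?thesis by (simp add: plin_def psc_sum psc_psc)
qed

lemma mcap_plin:
  assumes G: "\<And>r s. gmat g [r, s] = sng [] (tabled l (r, s))"
    and g: "dgen_src g = [c, d]" "dgen_tgt g = []" and t: "t \<in> carrier (Xten [c] [d])"
  shows "eta (mcap l t) = plin (gmat g) (mu [c] [d] t)"
  unfolding mcap_def
proof (rule tlift_plin[OF uunit_abelian _ _ _ t])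
  show "inj_on eta (carrier uunit)" by (auto simp: inj_on_def eta_def)
  show "eta (p \<oplus>\<^bsub>uunit\<^esub> q) = eta p + eta q" for p q by (simp add: eta_def single_add)
  fix x y assume x: "x \<in> Aspan (words [c])" and y: "y \<in> Aspan (words [d])"
  let ?b = "\<Sum>k\<in>supp x. \<Sum>m\<in>supp y. coef x k * coef y m * tabled l (hd k, hd m)"
  have s: "sng [] (sum f I) = (\<Sum>i\<in>I. sng [] (f i))" for f :: "weight list \<Rightarrow> Kq" and I
    by (induction I rule: infinite_finite_induct) (simp_all add: single_add)
  have b: "plin (gmat g) (conc x y) = eta ?b"
    using plin_conc_letters[where G = "gmat g" and h = "\<lambda>p. sng [] (tabled l p)", OF G x y]
    by (simp add: eta_def s)
  have "eta ?b \<in> Aspan (words [])"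
    unfolding b[symmetric]
    by (rule Aspan_plin[of _ "words [c, d]"]) (use gmat_Aspan[of _ g] g Aspan_conc_words[OF x y] in auto)
  hence "?b \<in> Aset" using Aspan_coef[of "eta ?b" _ "[]"] by (simp add: eta_def)
  thus "?b \<in> carrier uunit \<and> eta ?b = plin (gmat g) (conc x y)" using b by simp
qed

lemma mp_plin:
  assumes t: "t \<in> carrier (Xten [C1] [C1])"
  shows "mp t = plin (gmat Pgen) (mu [C1] [C1] t)"
proof -
  have G: "gmat Pgen [r, s] = tabled mp_table (r, s)" for r s by (simp add: gmat.simps)
  show ?thesis
    unfolding mp_def Xi0_letters
  proof (rule tlift_plin[OF Xi0_abelian _ _ _ t, where e = "\<lambda>x. x"])
    fix x y assume x: "x \<in> Aspan (words [C1])" and y: "y \<in> Aspan (words [C1])"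
    let ?b = "\<Sum>k\<in>supp x. \<Sum>m\<in>supp y. vscale (coef x k * coef y m) (tabled mp_table (hd k, hd m))"
    have b: "?b = plin (gmat Pgen) (conc x y)"
      using plin_conc_letters[where G = "gmat Pgen" and h = "tabled mp_table", OF G x y]
      by (simp add: vscale_psc)
    have "plin (gmat Pgen) (conc x y) \<in> Aspan (words [C2])"
      by (rule Aspan_plin[of _ "words [C1, C1]"]) (use gmat_Aspan[of _ Pgen] Aspan_conc_words[OF x y] in auto)
    thus "?b \<in> carrier (Xi0 [C2]) \<and> ?b = plin (gmat Pgen) (conc x y)" using b by simp
  qed auto
qed

lemma mu_zero: "mu u v \<zero>\<^bsub>Xten u v\<^esub> = 0"
  using mu_pure[of 0 u 0 v] by (simp add: xpure_zero)

lemma mu_lincomb: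
  assumes "\<And>c Z. (c, Z) \<in> set l \<Longrightarrow> c \<in> Aset \<and> Z \<in> carrier (Xten u v)"
  shows "lincomb (Xten u v) l \<in> carrier (Xten u v) \<and>
    mu u v (lincomb (Xten u v) l) = (\<Sum>(c, Z)\<leftarrow>l. psc c (mu u v Z))"
proof -
  interpret Xten: abelian_group "Xten u v" by (rule Xten_abelian)
  show ?thesis
    using assms
  proof (induction l)
    case (Cons p l)
    obtain c Z where p: "p = (c, Z)" by (cases p)
    have h: "c \<in> Aset" "Z \<in> carrier (Xten u v)" using Cons(2)[of c Z] by (simp_all add: p)
    have "lincomb (Xten u v) l \<in> carrier (Xten u v)"
      "mu u v (lincomb (Xten u v) l) = (\<Sum>(c, Z)\<leftarrow>l. psc c (mu u v Z))"
      using Cons by auto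
    thus ?case using h by (simp add: p lincomb_def Xten_ascal mu_add)
  qed (simp add: lincomb_def mu_zero)
qed

text \<open>The combinations of pure tensors that define the cups and \<open>i\<close>, read as combinations of words.\<close>

lemma mu_pairs:
  assumes "\<And>a r s. (a, r, s) \<in> set l \<Longrightarrow> a \<in> Aset \<and> r \<in> Wt c \<and> s \<in> Wt d"
  defines "L \<equiv> lincomb (Xten [c] [d])
    (map (\<lambda>(a, r, s). (a, xpure [c] [d] (vb (fst r) (snd r)) (vb (fst s) (snd s)))) l)"
  shows "L \<in> carrier (Xten [c] [d])" "mu [c] [d] L = vsum (pair_words l)"
proof -
  let ?L = "map (\<lambda>(a, r, s). (a, xpure [c] [d] (vb (fst r) (snd r)) (vb (fst s) (snd s))))"
  have v: "vb (fst r) (snd r) = sng [r] 1" for r by (simp add: vb_def)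
  have w: "sng [r] 1 \<in> Aspan (words [c])" if "r \<in> Wt c" for r c
    using that by (intro Aspan_single) (auto simp: words_single)
  have m: "mu [c] [d] (xpure [c] [d] (vb (fst r) (snd r)) (vb (fst s) (snd s))) = sng [r, s] 1"
    if "r \<in> Wt c" "s \<in> Wt d" for r s
    using that by (simp add: v mu_pure w)
  have 1: "L \<in> carrier (Xten [c] [d]) \<and> mu [c] [d] L = (\<Sum>(a, Z)\<leftarrow>?L l. psc a (mu [c] [d] Z))"
    unfolding L_def by (rule mu_lincomb) (use assms(1) in \<open>auto simp: v xpure_closed w\<close>)
  moreover have "(\<Sum>(a, Z)\<leftarrow>?L l. psc a (mu [c] [d] Z)) = vsum (pair_words l)"
    using assms(1)
  proof (induction l)
    case (Cons p l)
    obtain a r s where p: "p = (a, r, s)" by (cases p) auto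
    have "(\<Sum>(a, Z)\<leftarrow>?L l. psc a (mu [c] [d] Z)) = vsum (pair_words l)"
      using Cons(1)[OF Cons(2)] by simp
    thus ?case using Cons(2)[of a r s] by (simp add: p m)
  qed simp
  ultimately show "L \<in> carrier (Xten [c] [d])" "mu [c] [d] L = vsum (pair_words l)" by auto
qed

lemma cup_plin:
  assumes "\<And>c r s. (c, r, s) \<in> set l \<Longrightarrow> c \<in> Aset \<and> r \<in> Wt d \<and> s \<in> Wt d"
    and "gmat g [] = vsum (pair_words l)" and "a \<in> Aset"
  shows "plin (gmat g) (eta a) = mu [d] [d] (ascal (Xten [d] [d]) a (lincomb (Xten [d] [d])
    (map (\<lambda>(a, r, s). (a, xpure [d] [d] (vb (fst r) (snd r)) (vb (fst s) (snd s)))) l)))"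
  using mu_pairs[of l d d, OF assms(1)] assms(2,3) by (simp add: Xten_ascal eta_def)

lemma mu_finsum:
  assumes "finite A" "\<And>k. k \<in> A \<Longrightarrow> f k \<in> carrier (Xten u v)"
  shows "mu u v (\<Oplus>\<^bsub>Xten u v\<^esub>k\<in>A. f k) = (\<Sum>k\<in>A. mu u v (f k))"
proof -
  interpret Xten: abelian_group "Xten u v" by (rule Xten_abelian)
  have *: "f \<in> A \<rightarrow> carrier (Xten u v) \<Longrightarrow> mu u v (\<Oplus>\<^bsub>Xten u v\<^esub>k\<in>A. f k) = (\<Sum>k\<in>A. mu u v (f k))"
    using assms(1) by (induction A rule: finite_induct) (simp_all add: mu_zero mu_add)
  show ?thesis by (rule *) (use assms(2) in auto)
qed

lemma mi_plin:
  assumes "x \<in> Aspan (words [C2])"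
  shows "mu [C1] [C1] (mi x) = plin (gmat Igen) x"
proof -
  define B where "B w = lincomb (Xten [C1] [C1]) (mi_basis w)" for w
  have "mi_basis w = map (\<lambda>(a, r, s). (a, xpure [C1] [C1] (vb (fst r) (snd r)) (vb (fst s) (snd s)))) (i_table w)" for w
    by (simp add: mi_basis_def i_table_def Xi0_letters)
  moreover have "a \<in> Aset \<and> r \<in> Wt C1 \<and> s \<in> Wt C1" if "(a, r, s) \<in> set (i_table w)" for a r s w
    using that by (auto simp: i_table_def power_int_def Aset_minus split: if_splits)
  ultimately have B: "B w \<in> carrier (Xten [C1] [C1])" "mu [C1] [C1] (B w) = vsum (pair_words (i_table w))" for w
    using mu_pairs[of "i_table w" C1 C1] by (auto simp: B_def)
  have "mu [C1] [C1] (mi x) = (\<Sum>k\<in>supp x. mu [C1] [C1] (ascal (Xten [C1] [C1]) (coef x k) (B (hd k))))"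
    unfolding mi_def Xi0_letters B_def[symmetric] using assms
    by (intro mu_finsum) (auto simp: Xten_ascal B Aspan_coef)
  thus ?thesis using assms by (simp add: Xten_ascal B Aspan_coef plin_def gmat.simps)
qed

lemma Aset_tables:
  "(a, r, s) \<in> set cup1_table \<Longrightarrow> a \<in> Aset \<and> r \<in> Wt C1 \<and> s \<in> Wt C1"
  "(a, r, s) \<in> set cup2_table \<Longrightarrow> a \<in> Aset \<and> r \<in> Wt C2 \<and> s \<in> Wt C2"
  by (auto simp: cup1_table_def cup2_table_def power_int_def Aset_minus Aset_divide_qn_2)

theorem theorem3p6:
  shows "\<exists>(\<Xi>\<^sub>0 :: cword \<Rightarrow> vec umod) (\<Xi> :: dterm set \<Rightarrow> vec \<Rightarrow> vec)
           (\<mu> :: cword \<Rightarrow> cword \<Rightarrow> (vec, vec) tens \<Rightarrow> vec) (\<eta> :: Kq \<Rightarrow> vec).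
    linear_monoidal_functor Dsp4 \<Xi>\<^sub>0 \<Xi> \<mu> \<eta> \<and>
    \<Xi>\<^sub>0 [C1] = V1 \<and> \<Xi>\<^sub>0 [C2] = V2 \<and>
    (\<forall>t \<in> carrier (tensor V1 V1). \<Xi> (dcls cap1) (\<mu> [C1] [C1] t) = \<eta> (mcap1 t)) \<and>
    (\<forall>t \<in> carrier (tensor V2 V2). \<Xi> (dcls cap2) (\<mu> [C2] [C2] t) = \<eta> (mcap2 t)) \<and>
    (\<forall>a \<in> Aset. \<Xi> (dcls cup1) (\<eta> a) = \<mu> [C1] [C1] (mcup1 a)) \<and>
    (\<forall>a \<in> Aset. \<Xi> (dcls cup2) (\<eta> a) = \<mu> [C2] [C2] (mcup2 a)) \<and>
    (\<forall>t \<in> carrier (tensor V1 V1). \<Xi> (dcls pgen) (\<mu> [C1] [C1] t) = mp t) \<and>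
    (\<forall>x \<in> carrier V2. \<Xi> (dcls igen) x = \<mu> [C1] [C1] (mi x))"
proof (intro exI conjI ballI)
  show "linear_monoidal_functor Dsp4 Xi0 Xi mu eta" by (rule Xi_functor)
  show "Xi0 [C1] = V1" "Xi0 [C2] = V2" by (simp_all add: Xi0_letters)
  have mu2: "mu [c] [c] t \<in> Aspan (words [c, c])" if "t \<in> carrier (Xten [c] [c])" for c t
    using mu_closed[OF that] by simp
  show "Xi (dcls cap1) (mu [C1] [C1] t) = eta (mcap1 t)" if "t \<in> carrier (tensor V1 V1)" for t
  proof -
    have t: "t \<in> carrier (Xten [C1] [C1])" using that by (simp only: Xi0_letters)
    have "eta (mcap cap1_table t) = plin (gmat Cap1) (mu [C1] [C1] t)"
      by (rule mcap_plin[OF _ _ _ t]) (simp_all add: gmat.simps)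
    thus ?thesis using mu2[OF t] by (simp add: Xi_gen mcap1_def cap1_table_def)
  qed
  show "Xi (dcls cap2) (mu [C2] [C2] t) = eta (mcap2 t)" if "t \<in> carrier (tensor V2 V2)" for t
  proof -
    have t: "t \<in> carrier (Xten [C2] [C2])" using that by (simp only: Xi0_letters)
    have "eta (mcap cap2_table t) = plin (gmat Cap2) (mu [C2] [C2] t)"
      by (rule mcap_plin[OF _ _ _ t]) (simp_all add: gmat.simps)
    thus ?thesis using mu2[OF t] by (simp add: Xi_gen mcap2_def cap2_table_def)
  qed
  show "Xi (dcls cup1) (eta a) = mu [C1] [C1] (mcup1 a)" if a: "a \<in> Aset" for a
  proof -
    have "plin (gmat Cup1) (eta a) = mu [C1] [C1] (mcup1 a)"
      using cup_plin[of cup1_table C1 Cup1 a, OF Aset_tables(1) _ a]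
      by (simp add: gmat.simps mcup1_def Xi0_letters) (simp add: cup1_table_def)
    thus ?thesis using eta_Aspan[OF a] by (simp add: Xi_gen)
  qed
  show "Xi (dcls cup2) (eta a) = mu [C2] [C2] (mcup2 a)" if a: "a \<in> Aset" for a
  proof -
    have "plin (gmat Cup2) (eta a) = mu [C2] [C2] (mcup2 a)"
      using cup_plin[of cup2_table C2 Cup2 a, OF Aset_tables(2) _ a]
      by (simp add: gmat.simps mcup2_def Xi0_letters) (simp add: cup2_table_def)
    thus ?thesis using eta_Aspan[OF a] by (simp add: Xi_gen)
  qed
  show "Xi (dcls pgen) (mu [C1] [C1] t) = mp t" if "t \<in> carrier (tensor V1 V1)" for t
  proof -
    have t: "t \<in> carrier (Xten [C1] [C1])" using that by (simp only: Xi0_letters)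
    show ?thesis using mu2[OF t] mp_plin[OF t] by (simp add: Xi_gen)
  qed
  show "Xi (dcls igen) x = mu [C1] [C1] (mi x)" if "x \<in> carrier V2" for x
  proof -
    have x: "x \<in> Aspan (words [C2])" using that by (simp add: Xi0_letters)
    show ?thesis using x mi_plin[OF x] by (simp add: Xi_gen)
  qed
qed

end
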